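(* Let $\gamma\in\{1,-1\}$, $\sigma\in(0,1)$, and let $a_n>0$, $b_n\in\mathbb R$ satisfy, as $n\to\infty$, $$a_n=n^\sigma(1+\alpha n^{-1}+O(n^{-2})),\qquad b_n=2\gamma n^\sigma(1+\beta n^{-1}+O(n^{-2})),$$ with $\alpha,\beta\in\mathbb R$; put $\tau=2\beta-2\alpha+\sigma$. Set $\rho=\sigma/4$ and let $\theta_n(z)=\sqrt{T_n(z)}$ with $T_n$ as in the context. Let $D$ be the complex plane cut along $\gamma[0,\infty)$, with both edges $\lambda\pm i0$ ($\gamma\lambda>0$) of the cut included and the point $z=0$ excluded. Then for every $z\in D$ the equation $$a_{n-1}F_{n-1}+b_nF_n+a_nF_{n+1}=zF_n,\qquad n\ge1,$$ has a solution $f_n(z)$ such that: (a) for all $n\in\mathbb Z_+$ the function $f_n(z)$ is analytic in $z\in\mathbb C\setminus\gamma[0,\infty)$ and continuous up to the cut along $\gamma[0,\infty)$, with a possible exception of the boundary point $z=0$; (b) for every compact $K\subset D$ and every sufficiently large integer $N$ (depending on $K$) there is a nowhere vanishing continuous function $C(z)$ on $K$ such that, for every $z\in K$, $$f_n(z)=C(z)(-\gamma)^n n^{-\rho}e^{i\varphi_n(\gamma z)}(1+o(1)),\quad n\to\infty,\qquad \varphi_n(z)=\sum_{m=N}^n\theta_m(z).$$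
   Context: $\mathbb Z_+=\{0,1,2,\dots\}$. For $n\ge1$ put $t_n(z)=-\tau n^{-1}+zn^{-\sigma}$ and $T_n(z)=t_n(z)+\sum_{l=2}^Lp_l\,t_n(z)^l$, where $L\ge1$ is a fixed integer with $(L+1/2)\sigma>1$ (for $L=1$, possible if $\sigma>2/3$, $T_n=t_n$), and the real numbers $p_2,\dots,p_L$ are determined by the requirement that, with $c_k=2(-1)^{k+1}/(2k)!$ and $P(t)=\sum_{l=2}^Lp_lt^l$, the polynomial $P(t)+\sum_{k=2}^Lc_k(P(t)+t)^k$ has no terms of degree $\le L$. The function $\sqrt t$ is the analytic branch on $\mathbb C\setminus[0,\infty)$ with $\Im\sqrt t>0$, $\sqrt{t\pm i0}=\pm|t|^{1/2}$ for $t>0$. For $z$ in a compact subset of the plane cut along $[0,\infty)$ (edges included, $0$ excluded) and $n$ large enough, $T_n(z)$ lies in the plane cut along $[0,\infty)$ (edges included; $T_n(\lambda\pm i0)=T_n(\lambda)\pm i0$ for $\lambda>0$), so $\theta_n(z)$ is well defined with $\Im\theta_n(z)\ge0$. Functions at $\lambda\pm i0$ are limits from the upper/lower half-plane; multiplication by $\gamma=-1$ maps $\lambda\pm i0$ to $(-\lambda)\mp i0$. *)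

theory Defs
  imports
    "HOL-Analysis.Analysis"
    "HOL-Computational_Algebra.Polynomial"
    "HOL-Library.Landau_Symbols"
begin

definition cut_ray :: "real \<Rightarrow> complex set" where
  "cut_ray \<gamma> = (\<lambda>x. complex_of_real (\<gamma> * x)) ` {0..}"

text \<open>The analytic branch on the complement of \<open>[0, \<infinity>)\<close> with positive imaginary part.  At a point
  \<open>t > 0\<close> of the cut the formula returns the value \<open>- sqrt t\<close> of the lower edge.\<close>

definition sqrt_slit :: "complex \<Rightarrow> complex" where
  "sqrt_slit t = \<i> * csqrt (- t)"

text \<open>The plane cut along \<open>\<gamma>[0, \<infinity>)\<close> (where \<open>\<gamma>\<close> is \<open>1\<close> or \<open>-1\<close>), with both edges of the cut and
  without \<open>0\<close>.  A point is a pair \<open>(z, w)\<close>: \<open>z\<close> is the underlying complex number and \<open>w\<close> is the value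
  at this point of the branch of \<open>sqrt (\<gamma> z)\<close>.  Away from the cut \<open>w\<close> is determined by \<open>z\<close>; over a
  point \<open>z\<close> of the cut the two real values of \<open>w\<close> distinguish the two edges.  The topology is the one
  inherited from \<open>\<complex> \<times> \<complex>\<close>, so that each edge is adjacent only to its own side of the cut.\<close>

definition cut_plane :: "real \<Rightarrow> (complex \<times> complex) set" where
  "cut_plane \<gamma> = {(z, w). z \<noteq> 0 \<and> w\<^sup>2 = of_real \<gamma> * z \<and> Im w \<ge> 0}"

definition slit_point :: "real \<Rightarrow> complex \<Rightarrow> complex \<times> complex" where
  "slit_point \<gamma> z = (z, sqrt_slit (of_real \<gamma> * z))"

text \<open>The point \<open>r + i0\<close> (for \<open>s = 1\<close>) or \<open>r - i0\<close> (for \<open>s = -1\<close>).\<close>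

definition edge_point :: "real \<Rightarrow> real \<Rightarrow> real \<Rightarrow> complex \<times> complex" where
  "edge_point \<gamma> s r = (of_real r, of_real (\<gamma> * s * sqrt \<bar>r\<bar>))"

text \<open>Multiplication by \<open>\<gamma>\<close>, a map from the plane cut along \<open>\<gamma>[0, \<infinity>)\<close> to the plane cut along
  \<open>[0, \<infinity>)\<close>.\<close>

definition cut_scale :: "real \<Rightarrow> complex \<times> complex \<Rightarrow> complex \<times> complex" where
  "cut_scale \<gamma> = (\<lambda>(z, w). (of_real \<gamma> * z, w))"

lemma in_cut_ray_iff: "\<gamma> = 1 \<or> \<gamma> = -1 \<Longrightarrow> z \<in> cut_ray \<gamma> \<longleftrightarrow> Im z = 0 \<and> \<gamma> * Re z \<ge> 0"
  by (auto simp: cut_ray_def image_iff complex_eq_iff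
      intro: bexI[of _ "Re z"] bexI[of _ "- Re z"])

lemma sqrt_slit_square [simp]: "(sqrt_slit t)\<^sup>2 = t"
  by (simp add: sqrt_slit_def power_mult_distrib)

lemma not_cut_imp_nonpos: "t \<notin> cut_ray 1 \<Longrightarrow> - t \<notin> \<real>\<^sub>\<le>\<^sub>0"
  using in_cut_ray_iff[of 1 t] by (auto simp: complex_nonpos_Reals_iff)

lemma Im_sqrt_slit_pos:
  assumes "t \<notin> cut_ray 1"
  shows "Im (sqrt_slit t) > 0"
proof -
  have "Re (csqrt (- t)) \<noteq> 0"
  proof
    assume "Re (csqrt (- t)) = 0"
    then have "- t = of_real (- (Im (csqrt (- t)))\<^sup>2)"
      by (metis complex_eq_iff Re_power2 Im_power2 power2_csqrt Re_complex_of_real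
          Im_complex_of_real mult_zero_left mult_zero_right diff_0 power_zero_numeral zero_power2)
    then show False
      using not_cut_imp_nonpos[OF assms] by (metis nonpos_Reals_of_real_iff neg_le_0_iff_le zero_le_power2)
  qed
  moreover have "Re (csqrt (- t)) \<ge> 0"
    using csqrt_principal[of "- t"] by auto
  ultimately show ?thesis
    by (simp add: sqrt_slit_def)
qed

lemma sqrt_slit_holomorphic: "sqrt_slit holomorphic_on - cut_ray 1"
  unfolding sqrt_slit_def
  by (intro holomorphic_intros) (use not_cut_imp_nonpos in auto)

lemma cut_plane_eq:
  assumes "\<gamma> = 1 \<or> \<gamma> = -1"
  shows "cut_plane \<gamma> =
    slit_point \<gamma> ` (- cut_ray \<gamma>) \<union> {edge_point \<gamma> s r | s r. s \<in> {1, -1} \<and> \<gamma> * r > 0}"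
    (is "_ = ?R")
proof -
  have gz: "of_real \<gamma> * z \<notin> cut_ray 1" if "z \<notin> cut_ray \<gamma>" for z
    using that assms by (auto simp: in_cut_ray_iff)
  have "(z, w) \<in> ?R" if "z \<noteq> 0" "w\<^sup>2 = of_real \<gamma> * z" "Im w \<ge> 0" for z w
  proof (cases "z \<in> cut_ray \<gamma>")
    case False
    have "w\<^sup>2 = (sqrt_slit (of_real \<gamma> * z))\<^sup>2"
      using that by simp
    then have "w = sqrt_slit (of_real \<gamma> * z) \<or> w = - sqrt_slit (of_real \<gamma> * z)"
      by (simp only: power2_eq_iff)
    with Im_sqrt_slit_pos[OF gz[OF False]] that(3) have "w = sqrt_slit (of_real \<gamma> * z)"
      by auto
    with False show ?thesis
      by (auto simp: slit_point_def)
  next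
    case True
    then have z: "Im z = 0" "\<gamma> * Re z \<ge> 0"
      using assms by (auto simp: in_cut_ray_iff)
    then have "Re z \<noteq> 0"
      using that(1) by (auto simp: complex_eq_iff)
    with z assms have pos: "\<gamma> * Re z > 0"
      by auto
    then have abs: "\<gamma> * Re z = \<bar>Re z\<bar>"
      using assms by auto
    have "w\<^sup>2 = (of_real (sqrt \<bar>Re z\<bar>))\<^sup>2"
      using that(2) z(1) abs
      by (simp flip: of_real_power) (simp add: complex_eq_iff)
    then have "w = of_real (sqrt \<bar>Re z\<bar>) \<or> w = - of_real (sqrt \<bar>Re z\<bar>)"
      by (simp only: power2_eq_iff)
    then have "\<exists>s \<in> {1, -1}. w = of_real (\<gamma> * s * sqrt \<bar>Re z\<bar>)"
      using assms by auto
    then have "\<exists>s \<in> {1, -1}. (z, w) = edge_point \<gamma> s (Re z)"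
      using z(1) by (auto simp: edge_point_def complex_eq_iff)
    with pos show ?thesis
      by blast
  qed
  moreover have "slit_point \<gamma> z \<in> cut_plane \<gamma>" if "z \<notin> cut_ray \<gamma>" for z
    using that Im_sqrt_slit_pos[OF gz[OF that]] assms
    by (auto simp: slit_point_def cut_plane_def in_cut_ray_iff)
  moreover have "edge_point \<gamma> s r \<in> cut_plane \<gamma>" if "s \<in> {1, -1}" "\<gamma> * r > 0" for s r
    using that assms
    by (auto simp: edge_point_def cut_plane_def abs_if simp flip: of_real_power)
  ultimately show ?thesis
    by (intro equalityI subsetI) (fastforce simp: cut_plane_def)+
qed

lemma edge_point_limit:
  assumes \<gamma>: "\<gamma> = 1 \<or> \<gamma> = -1" and s: "s \<in> {1, -1}" and r: "\<gamma> * r > 0"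
  shows "(slit_point \<gamma> \<longlongrightarrow> edge_point \<gamma> s r) (at (of_real r) within {z. s * Im z > 0})"
proof -
  let ?F = "at (complex_of_real r) within {z. s * Im z > 0}"
  have branch: "sqrt_slit (of_real \<gamma> * z) = of_real (\<gamma> * s) * csqrt (of_real \<gamma> * z)"
    if "s * Im z > 0" for z
  proof (cases "\<gamma> * s = 1")
    case True
    with that \<gamma> s have "Im (of_real \<gamma> * z) > 0"
      by auto
    with True show ?thesis
      using csqrt_minus[of "- (of_real \<gamma> * z)"] by (simp add: sqrt_slit_def)
  next
    case False
    with \<gamma> s have gs: "\<gamma> * s = -1"
      by auto
    with that \<gamma> s have "Im (of_real \<gamma> * z) < 0"
      by auto
    with gs show ?thesis
      using csqrt_minus[of "of_real \<gamma> * z"] by (simp add: sqrt_slit_def flip: mult.assoc)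
  qed
  have "isCont csqrt (of_real (\<gamma> * r))"
    using r by (intro continuous_at_csqrt) (simp only: nonpos_Reals_of_real_iff not_le)
  moreover have "((\<lambda>z. of_real \<gamma> * z) \<longlongrightarrow> of_real (\<gamma> * r)) ?F"
    by (auto intro!: tendsto_eq_intros)
  ultimately have "((\<lambda>z. csqrt (of_real \<gamma> * z)) \<longlongrightarrow> csqrt (of_real (\<gamma> * r))) ?F"
    by (rule isCont_tendsto_compose)
  moreover have "csqrt (of_real (\<gamma> * r)) = of_real (sqrt \<bar>r\<bar>)"
    using \<gamma> r by (subst of_real_sqrt[symmetric]) auto
  ultimately have "((\<lambda>z. of_real (\<gamma> * s) * csqrt (of_real \<gamma> * z))
      \<longlongrightarrow> of_real (\<gamma> * s) * of_real (sqrt \<bar>r\<bar>)) ?F"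
    by (intro tendsto_intros) simp
  then have "((\<lambda>z. of_real (\<gamma> * s) * csqrt (of_real \<gamma> * z))
      \<longlongrightarrow> of_real (\<gamma> * s * sqrt \<bar>r\<bar>)) ?F"
    by (simp only: of_real_mult)
  moreover have "\<forall>\<^sub>F z in ?F. of_real (\<gamma> * s) * csqrt (of_real \<gamma> * z) = sqrt_slit (of_real \<gamma> * z)"
    unfolding eventually_at_filter by (simp add: branch del: of_real_mult)
  ultimately have "((\<lambda>z. sqrt_slit (of_real \<gamma> * z)) \<longlongrightarrow> of_real (\<gamma> * s * sqrt \<bar>r\<bar>)) ?F"
    by (rule Lim_transform_eventually)
  then show ?thesis
    unfolding slit_point_def edge_point_def by (intro tendsto_intros)
qed

lemma cut_scale_edge_point:
  assumes "\<gamma> = 1 \<or> \<gamma> = -1" "\<gamma> * r > 0"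
  shows "cut_scale \<gamma> (edge_point \<gamma> s r) = edge_point 1 (\<gamma> * s) (\<gamma> * r)"
  using assms by (auto simp: cut_scale_def edge_point_def)


text \<open>\<open>c_coeff k\<close> is the coefficient of \<open>x ^ k\<close> in \<open>2 - 2 * cos (sqrt x)\<close>; an admissible \<open>p\<close> makes
  \<open>x = t + P t\<close> a solution of \<open>2 - 2 * cos (sqrt x) = t\<close> up to order \<open>t ^ L\<close>.  This determines
  \<open>p 2, \<dots>, p L\<close>; the other values of \<open>p\<close> are not used.\<close>

definition c_coeff :: "nat \<Rightarrow> real" where
  "c_coeff k = 2 * (- 1) ^ (k + 1) / fact (2 * k)"

definition P_poly :: "nat \<Rightarrow> (nat \<Rightarrow> real) \<Rightarrow> real poly" where
  "P_poly L p = (\<Sum>l = 2..L. monom (p l) l)"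

definition admissible_coeffs :: "nat \<Rightarrow> (nat \<Rightarrow> real) \<Rightarrow> bool" where
  "admissible_coeffs L p \<longleftrightarrow>
    (\<forall>j\<le>L. coeff (P_poly L p + (\<Sum>k = 2..L. smult (c_coeff k) ((P_poly L p + [:0, 1:]) ^ k))) j = 0)"

lemma ex_admissible_coeffs: "L \<ge> 1 \<Longrightarrow> \<exists>p. admissible_coeffs L p"
proof (induction L rule: dec_induct)
  case base
  then show ?case
    by (auto simp: admissible_coeffs_def P_poly_def)
next
  case (step L)
  then obtain p where p: "admissible_coeffs L p"
    by blast
  define Q where "Q = P_poly L p + [:0, 1:]"
  define B where "B = coeff (P_poly L p + (\<Sum>k = 2..Suc L. smult (c_coeff k) (Q ^ k))) (Suc L)"
  define M where "M = monom (- B) (Suc L)"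
  define p' where "p' = p(Suc L := - B)"
  have P': "P_poly (Suc L) p' = P_poly L p + M"
    using step.hyps by (simp add: P_poly_def p'_def M_def)
  have X: "monom 1 1 dvd q \<longleftrightarrow> coeff q 0 = 0" for q :: "real poly"
    by (simp add: monom_1_dvd_iff')
  have Q0: "monom 1 1 dvd Q" "monom 1 1 dvd Q + M"
    unfolding X by (simp_all add: Q_def P_poly_def M_def coeff_sum)
  have pow: "coeff ((Q + M) ^ k) j = coeff (Q ^ k) j" if "k \<ge> 2" "j \<le> Suc L" for k j
  proof -
    have "monom 1 1 dvd (\<Sum>i<k. Q ^ (k - Suc i) * (Q + M) ^ i)"
    proof (rule dvd_sum)
      fix i assume "i \<in> {..<k}"
      show "monom 1 1 dvd Q ^ (k - Suc i) * (Q + M) ^ i"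
      proof (cases "i = 0")
        case True
        then show ?thesis
          using Q0(1) that(1) by (auto intro: dvd_trans[OF _ dvd_power])
      next
        case False
        then show ?thesis
          by (intro dvd_mult dvd_trans[OF Q0(2) dvd_power]) simp
      qed
    qed
    moreover have "monom 1 (Suc L) dvd M"
      by (simp add: monom_1_dvd_iff' M_def)
    ultimately have "monom 1 (Suc L) * monom 1 1 dvd M * (\<Sum>i<k. Q ^ (k - Suc i) * (Q + M) ^ i)"
      by (intro mult_dvd_mono)
    then have "monom 1 (Suc (Suc L)) dvd (Q + M) ^ k - Q ^ k"
      using power_diff_sumr2[of "Q + M" k Q] by (simp add: mult_monom)
    then have "\<forall>i<Suc (Suc L). coeff ((Q + M) ^ k - Q ^ k) i = 0"
      unfolding monom_1_dvd_iff' .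
    with that(2) show ?thesis
      by simp
  qed
  have "monom 1 1 ^ Suc L dvd Q ^ Suc L"
    using Q0(1) by (rule dvd_power_same)
  then have "monom 1 (Suc L) dvd Q ^ Suc L"
    by (simp only: monom_power) simp
  then have low: "coeff (Q ^ Suc L) j = 0" if "j \<le> L" for j
    using that by (auto simp: monom_1_dvd_iff' simp del: power_Suc)
  have "coeff (P_poly (Suc L) p' + (\<Sum>k = 2..Suc L.
      smult (c_coeff k) ((P_poly (Suc L) p' + [:0, 1:]) ^ k))) j = 0" if "j \<le> Suc L" for j
  proof -
    have P'X: "P_poly (Suc L) p' + [:0, 1:] = Q + M"
      by (simp add: P' Q_def)
    have eq: "coeff (P_poly (Suc L) p' + (\<Sum>k = 2..Suc L.
        smult (c_coeff k) ((P_poly (Suc L) p' + [:0, 1:]) ^ k))) j =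
        coeff M j + coeff (P_poly L p + (\<Sum>k = 2..Suc L. smult (c_coeff k) (Q ^ k))) j"
      unfolding P'X using that by (simp add: P' coeff_sum pow del: power_Suc sum.cl_ivl_Suc)
    show ?thesis
    proof (cases "j = Suc L")
      case True
      then show ?thesis
        unfolding eq by (simp add: M_def B_def del: power_Suc sum.cl_ivl_Suc)
    next
      case False
      with that have j: "j \<le> L"
        by simp
      then have "coeff (P_poly L p + (\<Sum>k = 2..L. smult (c_coeff k) (Q ^ k))) j = 0"
        using p by (simp add: admissible_coeffs_def Q_def)
      with j low[OF j] step.hyps show ?thesis
        unfolding eq by (simp add: M_def del: power_Suc)
    qed
  qed
  then show ?case
    unfolding admissible_coeffs_def by blast
qed

definition t_fun :: "real \<Rightarrow> real \<Rightarrow> nat \<Rightarrow> complex \<Rightarrow> complex" where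
  "t_fun \<sigma> \<tau> n z = - of_real (\<tau> / real n) + z * of_real (real n powr (- \<sigma>))"

definition T_fun :: "real \<Rightarrow> real \<Rightarrow> nat \<Rightarrow> (nat \<Rightarrow> real) \<Rightarrow> nat \<Rightarrow> complex \<Rightarrow> complex" where
  "T_fun \<sigma> \<tau> L p n z = t_fun \<sigma> \<tau> n z + (\<Sum>l = 2..L. of_real (p l) * (t_fun \<sigma> \<tau> n z) ^ l)"

text \<open>The function \<open>sqrt (T n z)\<close> on the plane cut along \<open>[0, \<infinity>)\<close>.  When \<open>T n z\<close> is a positive
  number (for large \<open>n\<close> this happens only if \<open>z\<close> is itself on an edge), \<open>T n z\<close> is put on the
  same edge as \<open>z\<close>, i.e. \<open>T n (r \<plusminus> i0) = T n r \<plusminus> i0\<close>; the edge of \<open>z\<close> is the sign of the real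
  number \<open>w\<close>.\<close>

definition theta :: "real \<Rightarrow> real \<Rightarrow> nat \<Rightarrow> (nat \<Rightarrow> real) \<Rightarrow> nat \<Rightarrow> complex \<times> complex \<Rightarrow> complex" where
  "theta \<sigma> \<tau> L p n = (\<lambda>(z, w).
     let T = T_fun \<sigma> \<tau> L p n z in
       if Im T = 0 \<and> Re T > 0 then of_real (sgn (Re w) * sqrt (Re T)) else sqrt_slit T)"

definition phi :: "real \<Rightarrow> real \<Rightarrow> nat \<Rightarrow> (nat \<Rightarrow> real) \<Rightarrow> nat \<Rightarrow> nat \<Rightarrow> complex \<times> complex \<Rightarrow> complex" where
  "phi \<sigma> \<tau> L p N n x = (\<Sum>m = N..n. theta \<sigma> \<tau> L p m x)"

end

theory Submission
  imports Defs "HOL-Complex_Analysis.Complex_Analysis" "HOL-Real_Asymp.Real_Asymp"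
begin

text \<open>
  Put \<open>F n = (-\<gamma>) ^ n * G n\<close> and use as spectral variable the square root \<open>w\<close> of \<open>\<gamma> z\<close>. The
  plane cut along \<open>\<gamma>[0, \<infinity>)\<close> becomes the closed upper half-plane without \<open>0\<close>, its two edges
  become the two real half-axes, and the equation becomes \<open>a (n - 1) * G (n - 1) + a n * G (n +
  1) = (\<gamma> * b n - w\<^sup>2) * G n\<close>.

  The solutions are of WKB type. After division by \<open>a n\<close> the coefficient on the right is \<open>2 - t
  n - \<sigma> / n\<close> up to \<open>O(n powr (-1 - \<sigma>))\<close>, so a solution \<open>exp (\<i> * \<phi> n)\<close> with increments \<open>\<theta> n\<close> of
  the phase needs \<open>2 - 2 * cos (\<theta> n) = t n\<close>; the admissible polynomial \<open>T n\<close> in \<open>t n\<close> is the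
  truncated solution \<open>(\<theta> n)\<^sup>2\<close> of this equation. Since \<open>\<theta> (n + 1) - \<theta> n\<close> is \<open>- \<sigma> / (2 * n) * \<theta>
  n\<close> to leading order, the factor \<open>n powr (- \<sigma> / 4)\<close> is the one that removes all terms of order
  \<open>n powr (-1 - \<sigma> / 2)\<close>. The resulting ansatz satisfies the equation with a relative residual
  \<open>O(n powr (-1 - \<sigma> / 2 - \<epsilon>))\<close>, where \<open>\<epsilon> = min ((L + 1 / 2) * \<sigma> - 1) (min (\<sigma> / 2) (1 - \<sigma>))\<close>; the
  truncation error \<open>t n ^ (L + 1)\<close> is the reason for the condition on \<open>L\<close> (lemma
  \<open>residual_bound\<close>).

  The square root of \<open>T n\<close> has branch points that move with \<open>n\<close>, so an ansatz built from it
  exists only for \<open>n\<close> large depending on the compact set, and the solutions obtained on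
  different compact sets would have to be matched. This is avoided by replacing \<open>\<theta> n\<close> with
  \<open>phase n w = w * n powr (- \<sigma> / 2) * R (T n / (w\<^sup>2 * n powr (- \<sigma>)) - 1)\<close>, where the polynomial
  \<open>R\<close> agrees with \<open>sqrt (1 + X)\<close> to high order at \<open>X = 0\<close>. It is holomorphic in \<open>w \<noteq> 0\<close> for
  every \<open>n \<ge> 1\<close> and differs from \<open>\<theta> n\<close> by \<open>O(n powr (-2))\<close> on compact sets (lemma
  \<open>theta_minus_phase\<close>). One ansatz serves all \<open>w\<close>, and the convergent sum of the differences
  gives the factor \<open>C\<close> of the asymptotic formula (lemma \<open>ansatz_normalization\<close>).

  The solution is the limit over \<open>N\<close> of the solutions that agree with the ansatz \<open>A\<close> at \<open>N\<close> and
  \<open>N + 1\<close>. Passing from \<open>N - 1\<close> to \<open>N\<close> changes the solution at \<open>n\<close> by the residual at \<open>N\<close> times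
  \<open>a N * A N\<close> times the Green function of \<open>n\<close> and \<open>N\<close>, and the Green function satisfies a
  Volterra equation whose kernel is \<open>\<Sum>k=n..<m. a m * (A m)\<^sup>2 / (a k * A k * A (k + 1))\<close>. On the
  edges of the cut the phases are real, so there is no decay and the summands have size \<open>(m / k)
  powr (\<sigma> / 2)\<close>: the absolute values sum to order \<open>m\<close>, which is too much. Summation by parts
  uses the oscillation and gives \<open>O(m powr (\<sigma> / 2 + \<epsilon> / 2))\<close> (lemma \<open>kernel_bound\<close>). Residual
  times kernel is then summable, and Gronwall's inequality yields locally uniform convergence
  together with \<open>G n / A n \<longlonglongrightarrow> 1\<close> (theorem \<open>jost_solution_uniform\<close>). Analyticity and continuity
  pass to the limit, because for fixed \<open>N\<close> the approximants are polynomials in \<open>w\<close> combined with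
  values of the ansatz.
\<close>

section \<open>Power bounds that are uniform in a parameter\<close>

definition unif_O :: "'x set \<Rightarrow> real \<Rightarrow> (nat \<Rightarrow> 'x \<Rightarrow> complex) \<Rightarrow> bool" where
  "unif_O K e g \<longleftrightarrow> (\<exists>C. \<forall>\<^sub>F n in sequentially. \<forall>x\<in>K. norm (g n x) \<le> C * real n powr e)"

lemma unif_O_pos:
  assumes "unif_O K e g"
  obtains C where "C > 0" "\<forall>\<^sub>F n in sequentially. \<forall>x\<in>K. norm (g n x) \<le> C * real n powr e"
proof -
  obtain C where C: "\<forall>\<^sub>F n in sequentially. \<forall>x\<in>K. norm (g n x) \<le> C * real n powr e"
    using assms by (auto simp: unif_O_def)
  have "\<forall>\<^sub>F n in sequentially. \<forall>x\<in>K. norm (g n x) \<le> max C 1 * real n powr e"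
    using C by eventually_elim (meson max.cobounded1 mult_right_mono order_trans powr_ge_zero)
  then show ?thesis by (intro that[of "max C 1"]) auto
qed

lemma unif_O_dominated:
  assumes "unif_O K e g" "\<forall>\<^sub>F n in sequentially. \<forall>x\<in>K. norm (f n x) \<le> c * norm (g n x)"
  shows "unif_O K e f"
proof -
  obtain C where C: "\<forall>\<^sub>F n in sequentially. \<forall>x\<in>K. norm (g n x) \<le> C * real n powr e"
    using assms(1) by (auto simp: unif_O_def)
  have "\<forall>\<^sub>F n in sequentially. \<forall>x\<in>K. norm (f n x) \<le> (\<bar>c\<bar> * C) * real n powr e"
    using C assms(2)
  proof eventually_elim
    case (elim n)
    show ?case
    proof
      fix x assume "x \<in> K"
      then have "norm (f n x) \<le> \<bar>c\<bar> * norm (g n x)"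
        using elim by (meson abs_ge_self mult_right_mono norm_ge_zero order_trans)
      also have "\<dots> \<le> \<bar>c\<bar> * (C * real n powr e)"
        using elim \<open>x \<in> K\<close> by (intro mult_left_mono) auto
      finally show "norm (f n x) \<le> (\<bar>c\<bar> * C) * real n powr e" by simp
    qed
  qed
  then show ?thesis unfolding unif_O_def by blast
qed

lemma unif_O_cong:
  assumes "unif_O K e g" "\<forall>\<^sub>F n in sequentially. \<forall>x\<in>K. f n x = g n x"
  shows "unif_O K e f"
  by (rule unif_O_dominated[OF assms(1), of _ 1]) (use assms(2) in eventually_elim, auto)

lemma unif_O_mono:
  assumes "unif_O K e g" "e \<le> e'"
  shows "unif_O K e' g"
proof -
  obtain C where C: "C > 0" "\<forall>\<^sub>F n in sequentially. \<forall>x\<in>K. norm (g n x) \<le> C * real n powr e"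
    using assms(1) by (rule unif_O_pos)
  have "\<forall>\<^sub>F n in sequentially. \<forall>x\<in>K. norm (g n x) \<le> C * real n powr e'"
    using C(2) eventually_ge_at_top[of 1]
  proof eventually_elim
    case (elim n)
    then have "C * real n powr e \<le> C * real n powr e'"
      using C(1) assms(2) by (intro mult_left_mono powr_mono) auto
    with elim show ?case by (meson order_trans)
  qed
  then show ?thesis unfolding unif_O_def by blast
qed

lemma unif_O_add:
  assumes "unif_O K e f" "unif_O K e g"
  shows "unif_O K e (\<lambda>n x. f n x + g n x)"
proof -
  obtain C where C: "\<forall>\<^sub>F n in sequentially. \<forall>x\<in>K. norm (f n x) \<le> C * real n powr e"
    using assms(1) by (auto simp: unif_O_def)
  obtain D where D: "\<forall>\<^sub>F n in sequentially. \<forall>x\<in>K. norm (g n x) \<le> D * real n powr e"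
    using assms(2) by (auto simp: unif_O_def)
  have "\<forall>\<^sub>F n in sequentially. \<forall>x\<in>K. norm (f n x + g n x) \<le> (C + D) * real n powr e"
    using C D by eventually_elim (auto simp: distrib_right intro!: norm_triangle_le add_mono)
  then show ?thesis unfolding unif_O_def by blast
qed

lemma unif_O_minus: "unif_O K e f \<Longrightarrow> unif_O K e (\<lambda>n x. - f n x)"
  by (simp add: unif_O_def)

lemma unif_O_diff:
  "unif_O K e f \<Longrightarrow> unif_O K e g \<Longrightarrow> unif_O K e (\<lambda>n x. f n x - g n x)"
  using unif_O_add[OF _ unif_O_minus] by fastforce

lemma unif_O_mult:
  assumes "unif_O K d f" "unif_O K e g"
  shows "unif_O K (d + e) (\<lambda>n x. f n x * g n x)"
proof -
  obtain C where C: "C > 0" "\<forall>\<^sub>F n in sequentially. \<forall>x\<in>K. norm (f n x) \<le> C * real n powr d"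
    using assms(1) by (rule unif_O_pos)
  obtain D where D: "\<forall>\<^sub>F n in sequentially. \<forall>x\<in>K. norm (g n x) \<le> D * real n powr e"
    using assms(2) by (auto simp: unif_O_def)
  have "\<forall>\<^sub>F n in sequentially. \<forall>x\<in>K. norm (f n x * g n x) \<le> (C * D) * real n powr (d + e)"
    using C(2) D
  proof eventually_elim
    case (elim n)
    show ?case
    proof
      fix x assume "x \<in> K"
      then have "norm (f n x) * norm (g n x) \<le> (C * real n powr d) * (D * real n powr e)"
        using elim C(1) by (intro mult_mono) auto
      then show "norm (f n x * g n x) \<le> (C * D) * real n powr (d + e)"
        by (simp add: norm_mult powr_add mult_ac)
    qed
  qed
  then show ?thesis unfolding unif_O_def by blast
qed

lemma unif_O_mult_le:
  "unif_O K d f \<Longrightarrow> unif_O K e g \<Longrightarrow> d + e \<le> c \<Longrightarrow> unif_O K c (\<lambda>n x. f n x * g n x)"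
  by (rule unif_O_mono[OF unif_O_mult])

lemma unif_O_param:
  assumes "bounded (f ` K)"
  shows "unif_O K 0 (\<lambda>n. f)"
proof -
  obtain C where C: "\<forall>x\<in>K. norm (f x) \<le> C"
    using assms by (auto simp: bounded_iff)
  have "\<forall>\<^sub>F n in sequentially. \<forall>x\<in>K. norm (f x) \<le> C * real n powr 0"
    using eventually_gt_at_top[of "0::nat"] by eventually_elim (use C in auto)
  then show ?thesis unfolding unif_O_def by blast
qed

lemma unif_O_const: "unif_O K 0 (\<lambda>n x. c)"
  by (rule unif_O_param) (auto simp: image_constant_conv)

lemma unif_O_cmult: "unif_O K e f \<Longrightarrow> unif_O K e (\<lambda>n x. c * f n x)"
  using unif_O_mult[OF unif_O_const] by fastforce

lemma unif_O_zero: "unif_O K e (\<lambda>n x. 0)"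
  by (auto simp: unif_O_def intro!: exI[of _ 0])

lemma unif_O_sum:
  "(\<And>i. i \<in> I \<Longrightarrow> unif_O K e (f i)) \<Longrightarrow> unif_O K e (\<lambda>n x. \<Sum>i\<in>I. f i n x)"
  by (induction I rule: infinite_finite_induct) (auto intro: unif_O_add unif_O_zero)

lemma unif_O_power:
  assumes "unif_O K e f" shows "unif_O K (real k * e) (\<lambda>n x. f n x ^ k)"
proof (induction k)
  case 0
  show ?case using unif_O_const[of K 1] by simp
next
  case (Suc k)
  show ?case
    by (simp, rule unif_O_mult_le[OF assms Suc]) (simp add: algebra_simps)
qed

lemma unif_O_seq:
  fixes g :: "nat \<Rightarrow> real"
  assumes "g \<in> O(\<lambda>n. real n powr e)"
  shows "unif_O K e (\<lambda>n x. of_real (g n))"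
proof -
  obtain C where "\<forall>\<^sub>F n in sequentially. norm (g n) \<le> C * norm (real n powr e)"
    using assms by (auto elim: landau_o.bigE)
  then have "\<forall>\<^sub>F n in sequentially. \<forall>x\<in>K. norm (of_real (g n) :: complex) \<le> C * real n powr e"
    by eventually_elim auto
  then show ?thesis unfolding unif_O_def by blast
qed

lemma unif_O_shift:
  assumes "unif_O K e g"
  shows "unif_O K e (\<lambda>n. g (Suc n))"
proof -
  obtain C where C: "C > 0" "\<forall>\<^sub>F n in sequentially. \<forall>x\<in>K. norm (g n x) \<le> C * real n powr e"
    using assms by (rule unif_O_pos)
  have ev: "\<forall>\<^sub>F n in sequentially. \<forall>x\<in>K. norm (g (Suc n) x) \<le> C * real (Suc n) powr e"
    using C(2) by (subst eventually_sequentially_Suc)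
  have "(\<lambda>n. real (Suc n) powr e / real n powr e) \<longlonglongrightarrow> 1"
    by real_asymp
  then have "\<forall>\<^sub>F n in sequentially. real (Suc n) powr e / real n powr e < 2"
    by (rule order_tendstoD) simp
  then have "\<forall>\<^sub>F n in sequentially. \<forall>x\<in>K. norm (g (Suc n) x) \<le> (C * 2) * real n powr e"
    using ev eventually_gt_at_top[of 0]
  proof eventually_elim
    case (elim n)
    then have "real (Suc n) powr e \<le> 2 * real n powr e"
      by (simp add: field_simps)
    then have "C * real (Suc n) powr e \<le> (C * 2) * real n powr e"
      using C(1) by simp
    with elim show ?case by (meson order_trans)
  qed
  then show ?thesis unfolding unif_O_def by blast
qed

lemma unif_O_small:
  assumes "unif_O K e g" "e < 0" "\<delta> > 0"
  shows "\<forall>\<^sub>F n in sequentially. \<forall>x\<in>K. norm (g n x) < \<delta>"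
proof -
  obtain C where C: "C > 0" "\<forall>\<^sub>F n in sequentially. \<forall>x\<in>K. norm (g n x) \<le> C * real n powr e"
    using assms(1) by (rule unif_O_pos)
  have "(\<lambda>n. C * real n powr e) \<longlonglongrightarrow> 0"
    using assms(2) by real_asymp
  then have "\<forall>\<^sub>F n in sequentially. C * real n powr e < \<delta>"
    using assms(3) by (rule order_tendstoD)
  with C(2) show ?thesis
    by eventually_elim (meson le_less_trans)
qed

lemma unif_O_inverse:
  assumes "c > 0" "\<forall>\<^sub>F n in sequentially. \<forall>x\<in>K. norm (g n x) \<ge> c * real n powr e"
  shows "unif_O K (- e) (\<lambda>n x. 1 / g n x)"
proof -
  have "\<forall>\<^sub>F n in sequentially. \<forall>x\<in>K. norm (1 / g n x) \<le> (1 / c) * real n powr (- e)"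
    using assms(2) eventually_gt_at_top[of 0]
  proof eventually_elim
    case (elim n)
    show ?case
    proof
      fix x assume "x \<in> K"
      then have le: "c * real n powr e \<le> norm (g n x)" and pos: "0 < c * real n powr e"
        using elim assms(1) by auto
      from le pos have "1 / norm (g n x) \<le> 1 / (c * real n powr e)"
        by (intro divide_left_mono) (auto intro!: mult_pos_pos dest: less_le_trans)
      then show "norm (1 / g n x) \<le> (1 / c) * real n powr (- e)"
        by (simp add: norm_divide powr_minus field_simps)
    qed
  qed
  then show ?thesis unfolding unif_O_def by blast
qed

lemma norm_exp_minus_1_le:
  fixes u :: complex assumes "norm u \<le> 1" shows "norm (exp u - 1) \<le> 3 * norm u"
proof -
  have "norm (exp u - 1) \<le> exp (norm u) * norm u"
    using Taylor_exp_field[of u 0] by simp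
  also have "\<dots> \<le> 3 * norm u"
    using assms exp_le order_trans[OF _ exp_le, of "exp (norm u)"] by (intro mult_right_mono) simp_all
  finally show ?thesis .
qed

lemma norm_exp_minus_linear_le:
  fixes u :: complex assumes "norm u \<le> 1" shows "norm (exp u - 1 - u) \<le> 3 * norm (u * u)"
proof -
  have "norm (exp u - (1 + u)) \<le> exp (norm u) * (norm u)^2"
    using Taylor_exp_field[of u 1] by (simp add: power2_eq_square)
  also have "\<dots> \<le> 3 * (norm u)^2"
    using assms exp_le order_trans[OF _ exp_le, of "exp (norm u)"] by (intro mult_right_mono) simp_all
  finally show ?thesis by (simp add: norm_mult power2_eq_square algebra_simps)
qed

text \<open>
  As \<open>e < 0\<close>, \<open>u\<close> is eventually at most \<open>1\<close> in norm and the Taylor remainders of \<open>exp\<close> hold with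
  fixed constants.
\<close>
lemma unif_O_exp:
  assumes "unif_O K e u" "e < 0"
  shows "unif_O K e (\<lambda>n x. exp (u n x) - 1)"
    and "unif_O K (2 * e) (\<lambda>n x. exp (u n x) - 1 - u n x)"
proof -
  have small: "\<forall>\<^sub>F n in sequentially. \<forall>x\<in>K. norm (u n x) < 1"
    using assms by (rule unif_O_small) simp
  show "unif_O K e (\<lambda>n x. exp (u n x) - 1)"
    by (rule unif_O_dominated[OF assms(1), of _ 3])
      (use small in eventually_elim, simp add: norm_exp_minus_1_le less_imp_le)
  have "unif_O K (2 * e) (\<lambda>n x. u n x * u n x)"
    using unif_O_mult[OF assms(1) assms(1)] by simp
  then show "unif_O K (2 * e) (\<lambda>n x. exp (u n x) - 1 - u n x)"
    by (rule unif_O_dominated[of _ _ _ _ 3])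
      (use small in eventually_elim, simp add: norm_exp_minus_linear_le less_imp_le)
qed

text \<open>
  Discrete symbols: taking a difference gains one power of \<open>n\<close>. The class is closed under sums,
  products, polynomials and exponentials, so the difference estimates for the phase need no
  computation of derivatives.
\<close>
definition unif_symbol :: "'x set \<Rightarrow> real \<Rightarrow> (nat \<Rightarrow> 'x \<Rightarrow> complex) \<Rightarrow> bool" where
  "unif_symbol K e g \<longleftrightarrow> unif_O K e g \<and> unif_O K (e - 1) (\<lambda>n x. g (Suc n) x - g n x)"

lemma unif_symbolD:
  assumes "unif_symbol K e g"
  shows "unif_O K e g" "unif_O K (e - 1) (\<lambda>n x. g (Suc n) x - g n x)"
  using assms by (auto simp: unif_symbol_def)

lemma unif_symbol_mono: "unif_symbol K e g \<Longrightarrow> e \<le> e' \<Longrightarrow> unif_symbol K e' g"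
  by (auto simp: unif_symbol_def intro: unif_O_mono)

lemma unif_symbol_add:
  assumes "unif_symbol K e f" "unif_symbol K e g"
  shows "unif_symbol K e (\<lambda>n x. f n x + g n x)"
  using unif_O_add[OF unif_symbolD(1)[OF assms(1)] unif_symbolD(1)[OF assms(2)]]
    unif_O_add[OF unif_symbolD(2)[OF assms(1)] unif_symbolD(2)[OF assms(2)]]
  by (simp add: unif_symbol_def add_diff_add)

lemma unif_symbol_mult:
  assumes f: "unif_symbol K d f" and g: "unif_symbol K e g"
  shows "unif_symbol K (d + e) (\<lambda>n x. f n x * g n x)"
proof -
  have "unif_O K (d + e - 1) (\<lambda>n x. f (Suc n) x * (g (Suc n) x - g n x) + (f (Suc n) x - f n x) * g n x)"
    by (intro unif_O_add unif_O_mult_le[OF unif_O_shift[OF unif_symbolD(1)[OF f]] unif_symbolD(2)[OF g]]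
        unif_O_mult_le[OF unif_symbolD(2)[OF f] unif_symbolD(1)[OF g]]) auto
  also have "(\<lambda>n x. f (Suc n) x * (g (Suc n) x - g n x) + (f (Suc n) x - f n x) * g n x)
      = (\<lambda>n x. f (Suc n) x * g (Suc n) x - f n x * g n x)"
    by (simp add: fun_eq_iff algebra_simps)
  finally show ?thesis
    using unif_O_mult[OF unif_symbolD(1)[OF f] unif_symbolD(1)[OF g]] by (simp add: unif_symbol_def)
qed

lemma unif_symbol_mult_le:
  "unif_symbol K d f \<Longrightarrow> unif_symbol K e g \<Longrightarrow> d + e \<le> c \<Longrightarrow> unif_symbol K c (\<lambda>n x. f n x * g n x)"
  by (rule unif_symbol_mono[OF unif_symbol_mult])

lemma unif_symbol_param: "bounded (f ` K) \<Longrightarrow> unif_symbol K 0 (\<lambda>n. f)"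
  by (simp add: unif_symbol_def unif_O_param unif_O_zero)

lemma unif_symbol_const: "unif_symbol K 0 (\<lambda>n x. c)"
  by (rule unif_symbol_param) (auto simp: image_constant_conv)

lemma unif_symbol_zero: "unif_symbol K e (\<lambda>n x. 0)"
  by (simp add: unif_symbol_def unif_O_zero)

lemma unif_symbol_sum:
  "(\<And>i. i \<in> I \<Longrightarrow> unif_symbol K e (f i)) \<Longrightarrow> unif_symbol K e (\<lambda>n x. \<Sum>i\<in>I. f i n x)"
  by (induction I rule: infinite_finite_induct) (auto intro: unif_symbol_add unif_symbol_zero)

lemma unif_symbol_power:
  assumes "unif_symbol K e f" shows "unif_symbol K (real k * e) (\<lambda>n x. f n x ^ k)"
proof (induction k)
  case 0
  show ?case using unif_symbol_const[of K 1] by simp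
next
  case (Suc k)
  show ?case
    by (simp, rule unif_symbol_mult_le[OF assms Suc]) (simp add: algebra_simps)
qed

lemma unif_symbol_poly:
  assumes "unif_symbol K e f" "e \<le> 0"
  shows "unif_symbol K 0 (\<lambda>n x. poly q (f n x))"
proof (induction q)
  case 0
  show ?case by (simp add: unif_symbol_zero)
next
  case (pCons a q)
  have "unif_symbol K 0 (\<lambda>n x. f n x * poly q (f n x))"
    using assms by (intro unif_symbol_mult_le[OF assms(1) pCons.IH]) auto
  then show ?case
    by (simp, intro unif_symbol_add unif_symbol_const)
qed

lemma powr_diff_bigo: "(\<lambda>n. real (Suc n) powr e - real n powr e) \<in> O(\<lambda>n. real n powr (e - 1))"
  by real_asymp

lemma unif_symbol_powr: "unif_symbol K e (\<lambda>n x. of_real (real n powr e))"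
  unfolding unif_symbol_def using unif_O_seq[of "\<lambda>n. real n powr e" e K] unif_O_seq[OF powr_diff_bigo,
      of K e] by simp

lemma unif_symbol_cong:
  assumes "unif_symbol K e g" "\<forall>\<^sub>F n in sequentially. \<forall>x\<in>K. f n x = g n x"
  shows "unif_symbol K e f"
proof -
  have "\<forall>\<^sub>F n in sequentially. \<forall>x\<in>K. f (Suc n) x = g (Suc n) x"
    using assms(2) by (subst eventually_sequentially_Suc)
  then have "\<forall>\<^sub>F n in sequentially. \<forall>x\<in>K. f (Suc n) x - f n x = g (Suc n) x - g n x"
    using assms(2) by eventually_elim auto
  with assms show ?thesis
    unfolding unif_symbol_def by (auto intro: unif_O_cong)
qed

lemma unif_symbol_shift: "unif_symbol K e g \<Longrightarrow> unif_symbol K e (\<lambda>n. g (Suc n))"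
  by (auto simp: unif_symbol_def intro: unif_O_shift[of K e g] unif_O_shift[of K "e - 1" "\<lambda>n x. g (Suc
      n) x - g n x"])

lemma unif_symbol_minus: "unif_symbol K e g \<Longrightarrow> unif_symbol K e (\<lambda>n x. - g n x)"
  using unif_symbol_mult[OF unif_symbol_const[of K "-1"], of e g] by simp

lemma unif_symbol_diff: "unif_symbol K e f \<Longrightarrow> unif_symbol K e g \<Longrightarrow> unif_symbol K e (\<lambda>n x. f n x - g n x)"
  using unif_symbol_add[OF _ unif_symbol_minus, of K e f g] by simp

lemma unif_O_bound_from:
  assumes "unif_O K e g"
  obtains C N where "C > 0" "\<forall>n\<ge>N. \<forall>x\<in>K. norm (g n x) \<le> C * real n powr e"
  using assms by (elim unif_O_pos) (auto simp: eventually_sequentially)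

text \<open>Lower bounds survive perturbations of smaller order; they are needed to invert the gap below.\<close>
lemma unif_O_lower_bound:
  assumes "unif_O K (e - \<delta>) (\<lambda>n x. g n x - u n x)" "\<delta> > 0" "c > 0"
    and "\<forall>\<^sub>F n in sequentially. \<forall>x\<in>K. norm (u n x) \<ge> c * real n powr e"
  shows "\<forall>\<^sub>F n in sequentially. \<forall>x\<in>K. norm (g n x) \<ge> c / 2 * real n powr e"
proof -
  obtain C where C: "C > 0" "\<forall>\<^sub>F n in sequentially. \<forall>x\<in>K. norm (g n x - u n x) \<le> C * real n powr (e - \<delta>)"
    using assms(1) by (rule unif_O_pos)
  have "(\<lambda>n. C * real n powr (- \<delta>)) \<longlonglongrightarrow> 0"
    using assms(2) by real_asymp
  then have "\<forall>\<^sub>F n in sequentially. C * real n powr (- \<delta>) < c / 2"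
    using assms(3) by (intro order_tendstoD) auto
  with C(2) assms(4) show ?thesis
  proof eventually_elim
    case (elim n)
    show ?case
    proof
      fix x assume x: "x \<in> K"
      have "norm (g n x - u n x) \<le> (C * real n powr (- \<delta>)) * real n powr e"
        using elim(1) x by (simp add: powr_add[symmetric] mult.assoc)
      also have "\<dots> \<le> c / 2 * real n powr e"
        using elim(3) by (intro mult_right_mono) auto
      finally have "norm (g n x - u n x) \<le> c / 2 * real n powr e" .
      moreover have "c * real n powr e \<le> norm (u n x)" using elim(2) x by auto
      moreover have "norm (u n x) \<le> norm (g n x) + norm (g n x - u n x)"
        using norm_triangle_ineq4[of "g n x" "g n x - u n x"] by simp
      ultimately show "norm (g n x) \<ge> c / 2 * real n powr e" by (simp add: field_simps)
    qed
  qed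
qed

lemma unif_symbol_exp:
  assumes "unif_symbol K e u" "e < 0"
  shows "unif_symbol K e (\<lambda>n x. exp (u n x) - 1)" "unif_symbol K 0 (\<lambda>n x. exp (u n x))"
proof -
  have b: "unif_O K 0 (\<lambda>n x. exp (u n x))"
  proof -
    have "unif_O K 0 (\<lambda>n x. exp (u n x) - 1)"
      using unif_O_exp(1)[OF unif_symbolD(1)[OF assms(1)] assms(2)] by (rule unif_O_mono) (use assms(2)
          in simp)
    from unif_O_add[OF this unif_O_const[of K 1]] show ?thesis by simp
  qed
  have "unif_O K (e - 1) (\<lambda>n x. exp (u n x) * (exp (u (Suc n) x - u n x) - 1))"
    using assms(2) by (intro unif_O_mult_le[OF b unif_O_exp(1)[OF unif_symbolD(2)[OF assms(1)]]]) auto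
  then have d: "unif_O K (e - 1) (\<lambda>n x. exp (u (Suc n) x) - exp (u n x))"
    by (simp add: right_diff_distrib flip: exp_add)
  then show "unif_symbol K e (\<lambda>n x. exp (u n x) - 1)"
    using unif_O_exp(1)[OF unif_symbolD(1)[OF assms(1)] assms(2)] by (simp add: unif_symbol_def)
  show "unif_symbol K 0 (\<lambda>n x. exp (u n x))"
    using b unif_O_mono[OF d, of "-1"] assms(2) by (simp add: unif_symbol_def)
qed

lemma unif_symbol_inverse:
  assumes g: "unif_symbol K e g" and "c > 0"
    and lower: "\<forall>\<^sub>F n in sequentially. \<forall>x\<in>K. norm (g n x) \<ge> c * real n powr e"
  shows "unif_symbol K (- e) (\<lambda>n x. 1 / g n x)"
proof -
  have inv: "unif_O K (- e) (\<lambda>n x. 1 / g n x)"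
    using \<open>c > 0\<close> lower by (rule unif_O_inverse)
  have "unif_O K (- e - 1) (\<lambda>n x. - ((g (Suc n) x - g n x) * (1 / g n x * (1 / g (Suc n) x))))"
    by (intro unif_O_minus unif_O_mult_le[OF unif_symbolD(2)[OF g] unif_O_mult[OF inv unif_O_shift[OF
        inv]]]) auto
  moreover have nz: "\<forall>\<^sub>F n in sequentially. \<forall>x\<in>K. g n x \<noteq> 0"
    using lower eventually_gt_at_top[of 0]
  proof eventually_elim
    case (elim n)
    then have "0 < c * real n powr e" using \<open>c > 0\<close> by simp
    with elim show ?case by fastforce
  qed
  moreover have "\<forall>\<^sub>F n in sequentially. \<forall>x\<in>K. g (Suc n) x \<noteq> 0"
    using nz by (subst eventually_sequentially_Suc)
  with nz have "\<forall>\<^sub>F n in sequentially. \<forall>x\<in>K. 1 / g (Suc n) x - 1 / g n x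
      = - ((g (Suc n) x - g n x) * (1 / g n x * (1 / g (Suc n) x)))"
    by eventually_elim (auto simp: field_simps)
  ultimately have "unif_O K (- e - 1) (\<lambda>n x. 1 / g (Suc n) x - 1 / g n x)"
    by (blast intro: unif_O_cong)
  with inv show ?thesis by (simp add: unif_symbol_def)
qed

lemma unif_O_seq_diff:
  fixes g h :: "nat \<Rightarrow> real"
  assumes "(\<lambda>n. g n - h n) \<in> O(\<lambda>n. real n powr e)"
  shows "unif_O K e (\<lambda>n x. of_real (g n) - of_real (h n))"
  using unif_O_seq[OF assms, of K] by simp

section \<open>Solutions of three-term recurrences close to a given sequence\<close>

text \<open>
  The values at \<open>0\<close> and \<open>1\<close> are \<open>u\<close> and \<open>v\<close>. In the application \<open>d k\<close> is a polynomial in the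
  spectral parameter, so these solutions are polynomials too.
\<close>
fun rec_solution :: "(nat \<Rightarrow> real) \<Rightarrow> (nat \<Rightarrow> complex) \<Rightarrow> complex \<Rightarrow> complex \<Rightarrow> nat \<Rightarrow> complex" where
  "rec_solution a d u v 0 = u"
| "rec_solution a d u v (Suc 0) = v"
| "rec_solution a d u v (Suc (Suc n)) =
     (d (Suc n) * rec_solution a d u v (Suc n) - of_real (a n) * rec_solution a d u v n) / of_real (a
         (Suc n))"

text \<open>
  The initial values make the Wronskian of the two solutions \<open>1\<close>. Hence \<open>green a d n\<close> is, as a
  function of its last argument, the solution with values \<open>0\<close> at \<open>n\<close> and \<open>1 / a n\<close> at \<open>n + 1\<close>.
\<close>
definition green :: "(nat \<Rightarrow> real) \<Rightarrow> (nat \<Rightarrow> complex) \<Rightarrow> nat \<Rightarrow> nat \<Rightarrow> complex" where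
  "green a d n m =
     rec_solution a d 1 0 n * rec_solution a d 0 (1 / of_real (a 0)) m
   - rec_solution a d 1 0 m * rec_solution a d 0 (1 / of_real (a 0)) n"

text \<open>
  As a function of \<open>n\<close> this is the solution that agrees with \<open>A\<close> at \<open>N\<close> and \<open>N + 1\<close>. As a
  function of \<open>N\<close> it is the Wronskian of \<open>A\<close> with \<open>green a d n\<close>.
\<close>
definition rec_approx :: "(nat \<Rightarrow> real) \<Rightarrow> (nat \<Rightarrow> complex) \<Rightarrow> (nat \<Rightarrow> complex) \<Rightarrow> nat \<Rightarrow> nat \<Rightarrow> complex" where
  "rec_approx a d A N n = of_real (a N) * (A N * green a d n (Suc N) - A (Suc N) * green a d n N)"

text \<open>
  If \<open>A\<close> is an exact solution, then \<open>A m * (\<Sum>k=n..<m. 1 / (a k * A k * A (k + 1)))\<close> is a second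
  solution, by reduction of order; the kernel is \<open>a m * A m\<close> times it.
\<close>
definition kernel_sum :: "(nat \<Rightarrow> real) \<Rightarrow> (nat \<Rightarrow> complex) \<Rightarrow> nat \<Rightarrow> nat \<Rightarrow> complex" where
  "kernel_sum a A n m = (\<Sum>k=n..<m. of_real (a m) * (A m)\<^sup>2 / (of_real (a k) * A k * A (Suc k)))"

context
  fixes a :: "nat \<Rightarrow> real"
  assumes a_pos: "\<And>n. a n > 0"
begin

lemma a_nz: "complex_of_real (a n) \<noteq> 0"
  using a_pos[of n] by simp

lemma rec_solution_eq:
  "of_real (a n) * rec_solution a d u v n + of_real (a (Suc n)) * rec_solution a d u v (Suc (Suc n))
     = d (Suc n) * rec_solution a d u v (Suc n)"
  using a_nz[of "Suc n"] by (simp add: field_simps)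

lemma green_rec_right:
  "of_real (a m) * green a d n m + of_real (a (Suc m)) * green a d n (Suc (Suc m)) = d (Suc m) * green a
      d n (Suc m)"
proof -
  let ?P = "rec_solution a d 1 0" and ?Q = "rec_solution a d 0 (1 / of_real (a 0))"
  have "of_real (a m) * green a d n m + of_real (a (Suc m)) * green a d n (Suc (Suc m))
      = ?P n * (of_real (a m) * ?Q m + of_real (a (Suc m)) * ?Q (Suc (Suc m)))
      - ?Q n * (of_real (a m) * ?P m + of_real (a (Suc m)) * ?P (Suc (Suc m)))"
    by (simp only: green_def) (simp only: algebra_simps)
  also have "\<dots> = d (Suc m) * green a d n (Suc m)"
    unfolding rec_solution_eq by (simp only: green_def) (simp only: algebra_simps)
  finally show ?thesis .
qed

lemma green_antisym: "green a d n m = - green a d m n"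
  by (simp add: green_def)

lemma green_rec_left:
  "of_real (a n) * green a d n m + of_real (a (Suc n)) * green a d (Suc (Suc n)) m = d (Suc n) * green a
      d (Suc n) m"
  using green_rec_right[of n d m] unfolding green_antisym[of d m] by (simp add: algebra_simps)

lemma green_self [simp]: "green a d n n = 0"
  by (simp add: green_def)

lemma green_Suc: "of_real (a n) * green a d n (Suc n) = 1"
proof (induction n)
  case 0
  show ?case using a_nz[of 0] by (simp add: green_def)
next
  case (Suc n)
  have "of_real (a (Suc n)) * green a d (Suc n) (Suc (Suc n)) = - (of_real (a n) * green a d (Suc n) n)"
    using green_rec_right[of n d "Suc n"] by (simp add: eq_neg_iff_add_eq_0 add.commute)
  also have "\<dots> = of_real (a n) * green a d n (Suc n)"
    by (subst green_antisym) simp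
  finally show ?case using Suc by simp
qed

lemma rec_approx_rec:
  "of_real (a n) * rec_approx a d A N n + of_real (a (Suc n)) * rec_approx a d A N (Suc (Suc n))
     = d (Suc n) * rec_approx a d A N (Suc n)"
proof -
  have "of_real (a n) * rec_approx a d A N n + of_real (a (Suc n)) * rec_approx a d A N (Suc (Suc n))
    = of_real (a N) * (A N * (of_real (a n) * green a d n (Suc N) + of_real (a (Suc n)) * green a d (Suc
        (Suc n)) (Suc N))
     - A (Suc N) * (of_real (a n) * green a d n N + of_real (a (Suc n)) * green a d (Suc (Suc n)) N))"
    by (simp add: rec_approx_def algebra_simps)
  then show ?thesis
    unfolding green_rec_left by (simp add: rec_approx_def algebra_simps)
qed

lemma rec_approx_self: "rec_approx a d A n n = A n"
  using green_Suc[of n d] by (simp add: rec_approx_def mult.commute mult.left_commute)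

text \<open>
  The Wronskian of two solutions does not depend on the point; for a sequence \<open>A\<close> with residual
  \<open>r\<close> it changes by the residual.
\<close>
lemma rec_approx_step:
  assumes "of_real (a N) * A N + of_real (a (Suc N)) * A (Suc (Suc N)) - d (Suc N) * A (Suc N)
             = of_real (a (Suc N)) * r * A (Suc N)"
  shows "rec_approx a d A (Suc N) n = rec_approx a d A N n - r * (of_real (a (Suc N)) * A (Suc N) *
      green a d n (Suc N))"
proof -
  have "rec_approx a d A (Suc N) n - rec_approx a d A N n
     = A (Suc N) * (of_real (a N) * green a d n N + of_real (a (Suc N)) * green a d n (Suc (Suc N)))
       - green a d n (Suc N) * (of_real (a N) * A N + of_real (a (Suc N)) * A (Suc (Suc N)))"
    by (simp add: rec_approx_def algebra_simps)
  also have "of_real (a N) * A N + of_real (a (Suc N)) * A (Suc (Suc N))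
      = d (Suc N) * A (Suc N) + of_real (a (Suc N)) * r * A (Suc N)"
    using assms by (simp add: algebra_simps)
  finally show ?thesis
    unfolding green_rec_right by (simp add: algebra_simps)
qed

text \<open>
  Variation of constants around \<open>A\<close>: the increments of \<open>green a d n m / A m\<close> are Wronskians
  divided by \<open>a m * A m * A (m + 1)\<close>, and the Wronskians differ from \<open>A n\<close> by the accumulated
  residuals. Exchanging the two summations gives a Volterra equation for the normalised Green
  function.
\<close>
lemma green_volterra:
  assumes res: "\<And>k. k > n \<Longrightarrow>
      of_real (a (k - 1)) * A (k - 1) + of_real (a k) * A (Suc k) - d k * A k = of_real (a k) * r k * A k"
    and nz: "\<And>k. k \<ge> n \<Longrightarrow> A k \<noteq> 0" and "n \<le> m"
  defines "h \<equiv> \<lambda>j. of_real (a j) * A j * green a d n j / A n"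
  shows "h m = kernel_sum a A n m - (\<Sum>j\<in>{n<..<m}. r j * h j * kernel_sum a A j m)"
proof -
  \<comment> \<open>The Wronskian starts from \<open>A n\<close> at \<open>k = n\<close>.\<close>
  have F: "rec_approx a d A k n = A n * (1 - (\<Sum>j\<in>{n<..k}. r j * h j))" if "k \<ge> n" for k
    using that
  proof (induction k rule: dec_induct)
    case base
    show ?case by (simp add: rec_approx_self)
  next
    case (step k)
    have "rec_approx a d A (Suc k) n = rec_approx a d A k n - r (Suc k) * (A n * h (Suc k))"
      using rec_approx_step[of k A d "r (Suc k)" n] res[of "Suc k"] step.hyps nz[of n]
      by (simp add: h_def)
    moreover have "{n<..Suc k} = insert (Suc k) {n<..k}"
      using step.hyps by auto
    ultimately show ?case
      using step by (simp add: algebra_simps)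
  qed
  have q: "green a d n m / A m = (\<Sum>k=n..<m. rec_approx a d A k n / (of_real (a k) * A k * A (Suc k)))"
    using \<open>n \<le> m\<close>
  proof (induction m rule: dec_induct)
    case base
    show ?case by simp
  next
    case (step m)
    have "green a d n (Suc m) / A (Suc m) - green a d n m / A m
        = rec_approx a d A m n / (of_real (a m) * A m * A (Suc m))"
      using nz[of m] nz[of "Suc m"] a_nz[of m] step.hyps by (simp add: rec_approx_def field_simps)
    then show ?case
      using step by (simp add: algebra_simps)
  qed
  let ?g = "\<lambda>k. of_real (a m) * (A m)\<^sup>2 / (of_real (a k) * A k * A (Suc k))"
  have "h m = of_real (a m) * (A m)\<^sup>2 / A n * (green a d n m / A m)"
    using nz[of m] \<open>n \<le> m\<close> by (simp add: h_def power2_eq_square field_simps)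
  also have "\<dots> = (\<Sum>k=n..<m. ?g k * (1 - (\<Sum>j\<in>{n<..k}. r j * h j)))"
    unfolding q sum_distrib_left
    by (rule sum.cong) (use F nz[of n] in auto)
  also have "\<dots> = kernel_sum a A n m - (\<Sum>k=n..<m. \<Sum>j\<in>{n<..k}. r j * h j * ?g k)"
    unfolding kernel_sum_def sum_subtractf[symmetric]
    by (intro sum.cong refl) (simp only: right_diff_distrib left_diff_distrib mult_1_left
        mult_1_right sum_distrib_left sum_distrib_right mult.commute)
  also have "(\<Sum>k=n..<m. \<Sum>j\<in>{n<..k}. r j * h j * ?g k)
      = (\<Sum>k=n..<m. \<Sum>j\<in>{j. j \<in> {n<..<m} \<and> j \<le> k}. r j * h j * ?g k)"
    by (intro sum.cong) auto
  also have "\<dots> = (\<Sum>j\<in>{n<..<m}. \<Sum>k\<in>{k. k \<in> {n..<m} \<and> j \<le> k}. r j * h j * ?g k)"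
    by (rule sum.swap_restrict) auto
  also have "\<dots> = (\<Sum>j\<in>{n<..<m}. r j * h j * kernel_sum a A j m)"
    unfolding kernel_sum_def sum_distrib_left by (intro sum.cong) auto
  finally show ?thesis .
qed

end

lemma discrete_gronwall:
  fixes u \<kappa> \<rho> :: "nat \<Rightarrow> real"
  assumes nonneg: "\<And>m. \<rho> m \<ge> 0" "\<And>m. \<kappa> m \<ge> 0"
    and u: "\<And>m. m \<ge> n \<Longrightarrow> u m \<le> \<kappa> m * (1 + (\<Sum>j=n..<m. \<rho> j * u j))"
    and "m \<ge> n"
  shows "u m \<le> \<kappa> m * exp (\<Sum>j=n..<m. \<rho> j * \<kappa> j)"
proof -
  have "1 + (\<Sum>j=n..<m. \<rho> j * u j) \<le> exp (\<Sum>j=n..<m. \<rho> j * \<kappa> j)"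
    using \<open>m \<ge> n\<close>
  proof (induction m rule: dec_induct)
    case base
    show ?case by simp
  next
    case (step m)
    let ?s = "1 + (\<Sum>j=n..<m. \<rho> j * u j)" and ?E = "exp (\<Sum>j=n..<m. \<rho> j * \<kappa> j)"
    have "\<rho> m * u m \<le> \<rho> m * (\<kappa> m * ?s)"
      using u[of m] step.hyps nonneg by (intro mult_left_mono) auto
    also have "\<dots> \<le> \<rho> m * (\<kappa> m * ?E)"
      using step.IH nonneg by (intro mult_left_mono) auto
    finally have "?s + \<rho> m * u m \<le> ?E * (1 + \<rho> m * \<kappa> m)"
      using step.IH by (simp add: algebra_simps)
    also have "\<dots> \<le> ?E * exp (\<rho> m * \<kappa> m)"
      by (intro mult_left_mono) auto
    finally show ?case
      using step.hyps by (simp add: exp_add)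
  qed
  with u[OF \<open>m \<ge> n\<close>] nonneg(2)[of m] show ?thesis
    by (meson mult_left_mono order_trans)
qed

text \<open>
  Summability of \<open>\<rho> * \<kappa>\<close>, residual bound times kernel bound, is all that the Volterra equation
  needs. The bounds are required from \<open>N0\<close> on only; below \<open>N0\<close> convergence follows by running
  the recurrence backwards, which costs a constant factor at each step.
\<close>
theorem jost_solution_uniform:
  fixes a :: "nat \<Rightarrow> real" and d A r :: "nat \<Rightarrow> 'x \<Rightarrow> complex" and X :: "'x set" and \<rho> \<kappa> :: "nat \<Rightarrow> real"
  assumes a_pos: "\<And>n. a n > 0"
    and res: "\<And>k x. k > N0 \<Longrightarrow> x \<in> X \<Longrightarrow>
      of_real (a (k - 1)) * A (k - 1) x + of_real (a k) * A (Suc k) x - d k x * A k x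
        = of_real (a k) * r k x * A k x"
    and nz: "\<And>k x. k \<ge> N0 \<Longrightarrow> x \<in> X \<Longrightarrow> A k x \<noteq> 0"
    and r: "\<And>k x. k \<ge> N0 \<Longrightarrow> x \<in> X \<Longrightarrow> norm (r k x) \<le> \<rho> k"
    and G: "\<And>j m x. N0 \<le> j \<Longrightarrow> j < m \<Longrightarrow> x \<in> X \<Longrightarrow> norm (kernel_sum a (\<lambda>k. A k x) j m) \<le> \<kappa> m"
    and nonneg: "\<And>m. \<rho> m \<ge> 0" "\<And>m. \<kappa> m \<ge> 0"
    and summ: "summable (\<lambda>m. \<rho> m * \<kappa> m)"
    and bA: "\<And>n. bounded (A n ` X)" and bd: "\<And>n. bounded (d n ` X)"
  defines "F \<equiv> \<lambda>N n x. rec_approx a (\<lambda>k. d k x) (\<lambda>k. A k x) N n"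
  shows "uniformly_convergent_on X (\<lambda>N. F N n)"
    and "x \<in> X \<Longrightarrow> (\<lambda>n. lim (\<lambda>N. F N n x) / A n x) \<longlonglongrightarrow> 1"
proof -
  note a_pos [simp]
  define g where "g = (\<lambda>m. \<rho> m * \<kappa> m)"
  define E where "E = exp (suminf g)"
  \<comment> \<open>The change of the approximant at \<open>n\<close> when the matching point moves from \<open>N - 1\<close> to \<open>N\<close>.\<close>
  define T where "T = (\<lambda>n N x. r N x * (of_real (a N) * A N x * green a (\<lambda>k. d k x) n N))"
  have g0: "g m \<ge> 0" for m using nonneg by (simp add: g_def)
  have gs: "summable g" using summ by (simp add: g_def)
  have h: "norm (of_real (a m) * A m x * green a (\<lambda>k. d k x) n m / A n x) \<le> \<kappa> m * E"
    if "N0 \<le> n" "n \<le> m" "x \<in> X" for n m x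
  proof -
    define h where "h = (\<lambda>m. of_real (a m) * A m x * green a (\<lambda>k. d k x) n m / A n x)"
    have "norm (h m) \<le> \<kappa> m * (1 + (\<Sum>j=n..<m. \<rho> j * norm (h j)))" if "m \<ge> n" for m
    proof (cases "m = n")
      case True
      then show ?thesis using nonneg by (simp add: h_def green_self)
    next
      case False
      with that have "n < m" by simp
      have "norm (h m) = norm (kernel_sum a (\<lambda>k. A k x) n m
          - (\<Sum>j\<in>{n<..<m}. r j x * h j * kernel_sum a (\<lambda>k. A k x) j m))"
        unfolding h_def using res nz \<open>N0 \<le> n\<close> \<open>x \<in> X\<close> that
        by (subst green_volterra[where r = "\<lambda>k. r k x"]) auto
      also have "\<dots> \<le> norm (kernel_sum a (\<lambda>k. A k x) n m)
          + norm (\<Sum>j\<in>{n<..<m}. r j x * h j * kernel_sum a (\<lambda>k. A k x) j m)"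
        by (rule norm_triangle_ineq4)
      also have "\<dots> \<le> \<kappa> m + (\<Sum>j\<in>{n<..<m}. \<rho> j * norm (h j) * \<kappa> m)"
        using \<open>n < m\<close> \<open>N0 \<le> n\<close> \<open>x \<in> X\<close>
        by (intro add_mono G sum_norm_le) (auto simp: norm_mult intro!: mult_mono r G nonneg
            mult_nonneg_nonneg)
      also have "(\<Sum>j\<in>{n<..<m}. \<rho> j * norm (h j) * \<kappa> m) \<le> (\<Sum>j=n..<m. \<rho> j * norm (h j) * \<kappa> m)"
        using nonneg by (intro sum_mono2) auto
      finally show ?thesis
        by (simp add: distrib_left sum_distrib_left mult_ac)
    qed
    then have "norm (h m) \<le> \<kappa> m * exp (\<Sum>j=n..<m. \<rho> j * \<kappa> j)"
      using nonneg \<open>n \<le> m\<close> by (intro discrete_gronwall[where u = "\<lambda>m. norm (h m)"]) auto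
    also have "(\<Sum>j=n..<m. \<rho> j * \<kappa> j) \<le> suminf g"
      using sum_le_suminf[OF gs, of "{n..<m}"] g0 by (simp add: g_def)
    finally show ?thesis
      using nonneg(2)[of m] by (simp add: h_def E_def mult_left_mono)
  qed
  have T: "norm (T n N x) \<le> norm (A n x) * E * g N" if "N0 \<le> n" "n \<le> N" "x \<in> X" for n N x
  proof -
    have "norm (T n N x) = norm (A n x) * (norm (r N x) * norm (of_real (a N) * A N x * green a (\<lambda>k. d k
        x) n N / A n x))"
      using nz[of n x] that by (simp add: T_def norm_mult norm_divide field_simps)
    also have "\<dots> \<le> norm (A n x) * (\<rho> N * (\<kappa> N * E))"
      using that nonneg by (intro mult_left_mono mult_mono h r) auto
    finally show ?thesis by (simp add: g_def mult_ac)
  qed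
  have stepF: "F (Suc N) n x = F N n x - T n (Suc N) x" if "N \<ge> N0" "x \<in> X" for N n x
    using rec_approx_step[of a N "\<lambda>k. A k x" "\<lambda>k. d k x" "r (Suc N) x" n] res[of "Suc N" x] that
    by (simp add: F_def T_def)
  define ok where "ok = (\<lambda>n. \<exists>C. \<forall>\<^sub>F N in sequentially. \<forall>x\<in>X. norm (T n N x) \<le> C * g N)"
  have ok_ge: "ok n" if "n \<ge> N0" for n
  proof -
    obtain C where C: "\<And>x. x \<in> X \<Longrightarrow> norm (A n x) \<le> C"
      using bA[of n] by (auto simp: bounded_iff)
    have "\<forall>x\<in>X. norm (T n N x) \<le> (C * E) * g N" if "N \<ge> n" for N
    proof
      fix x assume "x \<in> X"
      have "norm (T n N x) \<le> norm (A n x) * E * g N" by (rule T) fact+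
      also have "\<dots> \<le> C * E * g N"
        using C[OF \<open>x \<in> X\<close>] g0 by (intro mult_right_mono) (auto simp: E_def)
      finally show "norm (T n N x) \<le> (C * E) * g N" .
    qed
    then show ?thesis
      unfolding ok_def eventually_sequentially by blast
  qed
  \<comment> \<open>The Green function satisfies the recurrence in its first argument too.\<close>
  have ok_down: "ok n" if "ok (Suc n)" "ok (Suc (Suc n))" for n
  proof -
    obtain C1 where C1: "\<forall>\<^sub>F N in sequentially. \<forall>x\<in>X. norm (T (Suc n) N x) \<le> C1 * g N"
      using \<open>ok (Suc n)\<close> by (auto simp: ok_def)
    obtain C2 where C2: "\<forall>\<^sub>F N in sequentially. \<forall>x\<in>X. norm (T (Suc (Suc n)) N x) \<le> C2 * g N"
      using \<open>ok (Suc (Suc n))\<close> by (auto simp: ok_def)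
    obtain D where D: "\<And>x. x \<in> X \<Longrightarrow> norm (d (Suc n) x) \<le> D"
      using bd[of "Suc n"] by (auto simp: bounded_iff)
    have "\<forall>\<^sub>F N in sequentially. \<forall>x\<in>X. norm (T n N x) \<le> ((D * C1 + a (Suc n) * C2) / a n) * g N"
      using C1 C2
    proof eventually_elim
      case (elim N)
      show ?case
      proof
        fix x assume x: "x \<in> X"
        have "of_real (a n) * T n N x = d (Suc n) x * T (Suc n) N x - of_real (a (Suc n)) * T (Suc (Suc
            n)) N x"
        proof -
          have "of_real (a n) * green a (\<lambda>k. d k x) n N = d (Suc n) x * green a (\<lambda>k. d k x) (Suc n) N
              - of_real (a (Suc n)) * green a (\<lambda>k. d k x) (Suc (Suc n)) N"
            using green_rec_left[of a n "\<lambda>k. d k x" N] by (simp add: algebra_simps)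
          then have "r N x * (of_real (a N) * A N x) * (of_real (a n) * green a (\<lambda>k. d k x) n N)
             = r N x * (of_real (a N) * A N x) * (d (Suc n) x * green a (\<lambda>k. d k x) (Suc n) N
              - of_real (a (Suc n)) * green a (\<lambda>k. d k x) (Suc (Suc n)) N)"
            by simp
          then show ?thesis by (simp add: T_def algebra_simps)
        qed
        then have "a n * norm (T n N x) = norm (d (Suc n) x * T (Suc n) N x - of_real (a (Suc n)) * T
            (Suc (Suc n)) N x)"
          using a_pos[of n] by (metis norm_mult norm_of_real abs_of_pos)
        also have "\<dots> \<le> norm (d (Suc n) x) * norm (T (Suc n) N x) + a (Suc n) * norm (T (Suc (Suc n)) N x)"
          using norm_triangle_ineq4 a_pos[of "Suc n"] by (metis norm_mult norm_of_real abs_of_pos)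
        also have "\<dots> \<le> D * (C1 * g N) + a (Suc n) * (C2 * g N)"
          using elim x D[OF x] a_pos[of "Suc n"]
          by (intro add_mono mult_mono mult_left_mono less_imp_le[OF a_pos]) (auto intro: order_trans[OF
            norm_ge_zero])
        finally show "norm (T n N x) \<le> ((D * C1 + a (Suc n) * C2) / a n) * g N"
          using a_pos[of n] by (simp add: field_simps)
      qed
    qed
    then show ?thesis unfolding ok_def by blast
  qed
  have down: "ok (N0 - k) \<and> ok (Suc (N0 - k))" for k
  proof (induction k)
    case 0
    then show ?case using ok_ge by simp
  next
    case (Suc k)
    then show ?case
    proof (cases "k < N0")
      case True
      then have "Suc (N0 - Suc k) = N0 - k" by simp
      with Suc ok_down[of "N0 - Suc k"] show ?thesis by simp
    qed simp
  qed
  have ok: "ok n" for n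
    using down[of "N0 - n"] by (cases "n \<ge> N0") (auto intro: ok_ge)
  have conv: "uniformly_convergent_on X (\<lambda>N. F N n)" for n
  proof -
    obtain C where C: "\<forall>\<^sub>F N in sequentially. \<forall>x\<in>X. norm (T n N x) \<le> C * g N"
      using ok[of n] by (auto simp: ok_def)
    have "\<forall>\<^sub>F N in sequentially. \<forall>x\<in>X. norm (T n (Suc N) x) \<le> C * g (Suc N)"
      using C by (subst eventually_sequentially_Suc)
    then have "\<forall>\<^sub>F N in sequentially. \<forall>x\<in>X. norm (F (Suc N) n x - F N n x) \<le> C * g (Suc N)"
      using eventually_ge_at_top[of N0] by eventually_elim (auto simp: stepF)
    then have "uniform_limit X (\<lambda>m x. \<Sum>N<m. F (Suc N) n x - F N n x) (\<lambda>x. \<Sum>N. F (Suc N) n x - F N n x)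
        sequentially"
      by (rule Weierstrass_m_test_ev) (intro summable_mult, use gs in \<open>simp add: summable_Suc_iff\<close>)
    then have "uniform_limit X (\<lambda>m x. F m n x - F 0 n x) (\<lambda>x. \<Sum>N. F (Suc N) n x - F N n x) sequentially"
      by (simp only: sum_lessThan_telescope[where f = "\<lambda>N. F N n x" for x])
    from uniform_limit_add[OF this uniform_limit_const[where f = sequentially and c = "F 0 n"]]
    show ?thesis
      unfolding uniformly_convergent_on_def by auto
  qed
  then show "uniformly_convergent_on X (\<lambda>N. F N n)" .
  assume x: "x \<in> X"
  define tail where "tail = (\<lambda>n. suminf g - (\<Sum>j<Suc n. g j))"
  have "norm (lim (\<lambda>N. F N n x) / A n x - 1) \<le> E * tail n" if "n \<ge> N0" for n
  proof -
    have "norm (F N n x - A n x) \<le> norm (A n x) * E * ((\<Sum>j<Suc N. g j) - (\<Sum>j<Suc n. g j))" if "N \<ge> n" for N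
      using that
    proof (induction N rule: dec_induct)
      case base
      show ?case by (simp add: F_def rec_approx_self)
    next
      case (step N)
      have "norm (F (Suc N) n x - A n x) \<le> norm (F N n x - A n x) + norm (T n (Suc N) x)"
        using \<open>n \<ge> N0\<close> step.hyps \<open>x \<in> X\<close> norm_triangle_ineq4[of "F N n x - A n x" "T n (Suc N) x"]
        by (subst stepF) (auto simp: algebra_simps)
      also have "norm (T n (Suc N) x) \<le> norm (A n x) * E * g (Suc N)"
        using step.hyps \<open>n \<ge> N0\<close> \<open>x \<in> X\<close> by (intro T) auto
      finally show ?case
        using step.IH by (simp add: algebra_simps)
    qed
    moreover have "(\<Sum>j<Suc N. g j) \<le> suminf g" for N
      using g0 gs by (intro sum_le_suminf) auto
    ultimately have bd: "norm (F N n x - A n x) \<le> norm (A n x) * E * tail n" if "N \<ge> n" for N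
      using that unfolding tail_def E_def by (meson diff_right_mono exp_ge_zero mult_left_mono
          norm_ge_zero mult_nonneg_nonneg order_trans)
    have "(\<lambda>N. F N n x) \<longlonglongrightarrow> lim (\<lambda>N. F N n x)"
      using conv[of n] x
      by (metis convergent_LIMSEQ_iff uniformly_convergent_imp_convergent)
    then have "(\<lambda>N. norm (F N n x - A n x)) \<longlonglongrightarrow> norm (lim (\<lambda>N. F N n x) - A n x)"
      by (intro tendsto_intros)
    then have "norm (lim (\<lambda>N. F N n x) - A n x) \<le> norm (A n x) * E * tail n"
      by (rule LIMSEQ_le_const2) (use bd in blast)
    then show ?thesis
      using nz[OF \<open>n \<ge> N0\<close> x] by (simp add: field_simps norm_divide flip: diff_divide_distrib)
  qed
  then have ev: "\<forall>\<^sub>F n in sequentially. norm (lim (\<lambda>N. F N n x) / A n x - 1) \<le> E * tail n"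
    by (auto simp: eventually_sequentially)
  have "(\<lambda>n. \<Sum>j<Suc n. g j) \<longlonglongrightarrow> suminf g"
    using summable_LIMSEQ[OF gs] by (rule LIMSEQ_Suc)
  then have "(\<lambda>n. E * tail n) \<longlonglongrightarrow> E * (suminf g - suminf g)"
    unfolding tail_def by (intro tendsto_intros)
  then have "(\<lambda>n. lim (\<lambda>N. F N n x) / A n x - 1) \<longlonglongrightarrow> 0"
    by (intro Lim_null_comparison[OF ev]) simp
  then show "(\<lambda>n. lim (\<lambda>N. F N n x) / A n x) \<longlonglongrightarrow> 1"
    by (simp add: LIM_zero_iff)
qed

section \<open>Algebra of the phase\<close>

text \<open>
  Taylor polynomials of \<open>sqrt (1 + X)\<close>, obtained by correcting one coefficient at a time: with
  \<open>c\<close> the constant coefficient of the error \<open>H\<close>, subtracting \<open>c / 2 * X ^ (J + 1)\<close> from \<open>R\<close>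
  changes \<open>R\<^sup>2\<close> by \<open>- c * X ^ (J + 1)\<close> up to higher order.
\<close>
lemma ex_sqrt_poly:
  "\<exists>R H :: complex poly. R\<^sup>2 = [:1, 1:] + monom 1 (Suc J) * H \<and> poly R 0 = 1"
proof (induction J)
  case 0
  have "(1 :: complex poly)\<^sup>2 = [:1, 1:] + monom 1 (Suc 0) * [:-1:]"
    by (simp add: monom_Suc)
  then show ?case by (metis poly_1)
next
  case (Suc J)
  then obtain R H :: "complex poly" where R: "R\<^sup>2 = [:1, 1:] + monom 1 (Suc J) * H" "poly R 0 = 1"
    by blast
  define c where "c = poly H 0"
  define k where "k = [:c / 2:]"
  define R' where "R' = R - k * monom 1 (Suc J)"
  have "poly (H - smult c R) 0 = 0"
    using R(2) by (simp add: c_def)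
  then obtain H1 where H1: "H - smult c R = pCons 0 H1"
    by (metis pCons_cases poly_pCons mult_zero_left add.right_neutral)
  have "smult c R = (k + k) * R"
    by (simp add: k_def)
  then have "R'\<^sup>2 = R\<^sup>2 - monom 1 (Suc J) * smult c R + monom 1 (Suc J) * monom 1 (Suc J) * k\<^sup>2"
    by (simp only: R'_def power2_eq_square) (simp only: algebra_simps)
  also have "\<dots> = [:1, 1:] + monom 1 (Suc J) * (H - smult c R) + monom 1 (Suc J) * monom 1 (Suc J) * k\<^sup>2"
    unfolding R(1) by (simp only: algebra_simps)
  also have "monom 1 (Suc J) * (H - smult c R) = monom 1 (Suc (Suc J)) * H1"
    unfolding H1 by (simp add: monom_Suc)
  also have "monom 1 (Suc J) * monom 1 (Suc J) * k\<^sup>2 = monom 1 (Suc (Suc J)) * (monom 1 J * k\<^sup>2)"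
    by (simp add: mult_monom flip: mult.assoc)
  finally have "R'\<^sup>2 = [:1, 1:] + monom 1 (Suc (Suc J)) * (H1 + monom 1 J * k\<^sup>2)"
    by (simp only: distrib_left add.assoc)
  moreover have "poly R' 0 = 1"
    using R(2) by (simp add: R'_def poly_monom)
  ultimately show ?case by blast
qed

definition eval_poly :: "real poly \<Rightarrow> complex \<Rightarrow> complex" where
  "eval_poly q z = poly (map_poly of_real q) z"

lemma eval_poly_add: "eval_poly (p + q) z = eval_poly p z + eval_poly q z"
proof -
  have "map_poly complex_of_real (p + q) = map_poly of_real p + map_poly of_real q"
    by (rule poly_eqI) (simp add: coeff_map_poly)
  then show ?thesis by (simp add: eval_poly_def)
qed

lemma eval_poly_mult: "eval_poly (p * q) z = eval_poly p z * eval_poly q z"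
proof -
  have "map_poly complex_of_real (p * q) = map_poly of_real p * map_poly of_real q"
    by (rule poly_eqI) (simp add: coeff_map_poly coeff_mult)
  then show ?thesis by (simp add: eval_poly_def)
qed

lemma eval_poly_0: "eval_poly 0 z = 0" by (simp add: eval_poly_def)

lemma eval_poly_monom: "eval_poly (monom c n) z = of_real c * z ^ n"
  by (simp add: eval_poly_def map_poly_monom poly_monom)

lemma eval_poly_X: "eval_poly [:0, 1:] z = z"
  by (simp add: eval_poly_def map_poly_pCons)

lemma eval_poly_smult: "eval_poly (smult c q) z = of_real c * eval_poly q z"
  using eval_poly_mult[of "[:c:]" q z] by (simp add: eval_poly_def map_poly_pCons)

lemma eval_poly_power: "eval_poly (q ^ k) z = eval_poly q z ^ k"
  by (induction k) (simp_all add: eval_poly_mult, simp add: eval_poly_def one_pCons map_poly_pCons)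

lemma eval_poly_sum: "eval_poly (\<Sum>i\<in>I. f i) z = (\<Sum>i\<in>I. eval_poly (f i) z)"
  by (induction I rule: infinite_finite_induct) (simp_all add: eval_poly_add eval_poly_0)

lemma T_fun_eq_eval_poly: "T_fun \<sigma> \<tau> L p n z = eval_poly (P_poly L p + [:0, 1:]) (t_fun \<sigma> \<tau> n z)"
  by (simp add: T_fun_def P_poly_def eval_poly_add eval_poly_sum eval_poly_monom eval_poly_X)

text \<open>
  The meaning of admissibility: \<open>c_coeff 1 = 1\<close>, so the sum is \<open>T + \<Sum>k=2..L. c_coeff k * T ^ k\<close>
  with \<open>T = t + P t\<close>, and the polynomial that it exceeds \<open>t\<close> by has a zero of order \<open>L + 1\<close>.
\<close>
lemma admissible_expansion:
  assumes "admissible_coeffs L p" "L \<ge> 1"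
  obtains V where "\<And>\<sigma> \<tau> n z. (\<Sum>k=1..L. of_real (c_coeff k) * T_fun \<sigma> \<tau> L p n z ^ k)
     = t_fun \<sigma> \<tau> n z + t_fun \<sigma> \<tau> n z ^ Suc L * poly V (t_fun \<sigma> \<tau> n z)"
proof -
  define X where "X = P_poly L p + [:0, 1:]"
  define Q where "Q = P_poly L p + (\<Sum>k = 2..L. smult (c_coeff k) (X ^ k))"
  have "monom 1 (Suc L) dvd Q"
    using assms(1) by (auto simp: monom_1_dvd_iff' admissible_coeffs_def Q_def X_def)
  then obtain V where V: "Q = monom 1 (Suc L) * V" by blast
  have "(\<Sum>k=1..L. of_real (c_coeff k) * T_fun \<sigma> \<tau> L p n z ^ k)
     = t_fun \<sigma> \<tau> n z + t_fun \<sigma> \<tau> n z ^ Suc L * poly (map_poly of_real V) (t_fun \<sigma> \<tau> n z)" for \<sigma> \<tau> n z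
  proof -
    let ?t = "t_fun \<sigma> \<tau> n z"
    have c1: "c_coeff 1 = 1" by (simp add: c_coeff_def fact_numeral)
    have "(\<Sum>k=1..L. of_real (c_coeff k) * T_fun \<sigma> \<tau> L p n z ^ k)
      = eval_poly X ?t + (\<Sum>k=2..L. of_real (c_coeff k) * T_fun \<sigma> \<tau> L p n z ^ k)"
      using assms(2) by (subst sum.atLeast_Suc_atMost) (simp_all add: c1[simplified] T_fun_eq_eval_poly
          X_def numeral_2_eq_2)
    also have "\<dots> = ?t + eval_poly Q ?t"
      by (simp add: T_fun_eq_eval_poly Q_def eval_poly_add eval_poly_sum eval_poly_smult eval_poly_power
          X_def eval_poly_X)
    finally show ?thesis
      by (simp add: V eval_poly_mult eval_poly_monom) (simp add: eval_poly_def)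
  qed
  then show ?thesis by (rule that)
qed

lemma cos_even_expansion:
  fixes z :: complex
  assumes "norm z \<le> 1"
  shows "norm (2 - 2 * cos z - (\<Sum>k=1..L. of_real (c_coeff k) * (z\<^sup>2) ^ k)) \<le> 6 * norm (z ^ (2 * L + 2))"
proof -
  have sum: "2 * (\<Sum>k\<le>2 * L + 1. complex_of_real (cos_coeff k) * z ^ k)
      = 2 - (\<Sum>k=1..L. of_real (c_coeff k) * (z\<^sup>2) ^ k)"
  proof (induction L)
    case 0
    show ?case by (simp add: cos_coeff_def)
  next
    case (Suc L)
    have "{..2 * Suc L + 1} = insert (2 * L + 3) (insert (2 * L + 2) {..2 * L + 1})"
      by auto
    then have "2 * (\<Sum>k\<le>2 * Suc L + 1. complex_of_real (cos_coeff k) * z ^ k)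
      = 2 * of_real (cos_coeff (2 * L + 3)) * z ^ (2 * L + 3) + 2 * of_real (cos_coeff (2 * L + 2)) * z
          ^ (2 * L + 2)
        + 2 * (\<Sum>k\<le>2 * L + 1. complex_of_real (cos_coeff k) * z ^ k)"
      by (simp add: algebra_simps)
    also have "cos_coeff (2 * L + 3) = 0" by (simp add: cos_coeff_def)
    also have "2 * complex_of_real (cos_coeff (2 * L + 2)) = - of_real (c_coeff (Suc L))"
    proof -
      have "2 * cos_coeff (2 * L + 2) = - c_coeff (Suc L)"
        by (simp add: cos_coeff_def c_coeff_def)
      then show ?thesis
        by (metis of_real_mult of_real_numeral of_real_minus)
    qed
    also have "z ^ (2 * L + 2) = (z\<^sup>2) ^ Suc L"
      by (simp only: power_mult[symmetric]) (simp add: algebra_simps)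
    finally show ?case
      unfolding Suc.IH by (subst sum.nat_ivl_Suc') (simp_all add: algebra_simps del: power_Suc)
  qed
  have "norm (cos z - (\<Sum>k\<le>2 * L + 1. complex_of_real (cos_coeff k) * z ^ k))
     \<le> exp \<bar>Im z\<bar> * norm z ^ Suc (2 * L + 1) / fact (2 * L + 1)"
    by (rule Taylor_cos)
  also have "\<dots> \<le> exp \<bar>Im z\<bar> * norm z ^ Suc (2 * L + 1) / 1"
    by (intro divide_left_mono fact_ge_1) auto
  also have "\<dots> \<le> 3 * norm z ^ (2 * L + 2)"
  proof -
    have "exp \<bar>Im z\<bar> \<le> exp 1"
      using abs_Im_le_cmod[of z] assms by (simp add: order_trans)
    also have "\<dots> \<le> 3" by (rule exp_le)
    finally show ?thesis by (auto intro!: mult_right_mono simp del: power_Suc)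
  qed
  finally have "norm (2 * (cos z - (\<Sum>k\<le>2 * L + 1. complex_of_real (cos_coeff k) * z ^ k))) \<le> 6 * norm (z
      ^ (2 * L + 2))"
    by (simp only: norm_mult norm_power norm_numeral)
  also have "2 * (cos z - (\<Sum>k\<le>2 * L + 1. complex_of_real (cos_coeff k) * z ^ k))
     = - (2 - 2 * cos z - (\<Sum>k=1..L. of_real (c_coeff k) * (z\<^sup>2) ^ k))"
    using sum by (simp add: right_diff_distrib)
  finally show ?thesis by (simp only: norm_minus_cancel)
qed

section \<open>A phase defined off the origin\<close>

text \<open>
  Every compact subset of the closed upper half-plane without \<open>0\<close> lies in one of these sets.
\<close>
definition half_annulus :: "real \<Rightarrow> complex set" where
  "half_annulus M = {w. Im w \<ge> 0 \<and> 1 / M \<le> norm w \<and> norm w \<le> M}"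

lemma half_annulusD:
  assumes "w \<in> half_annulus M" "M > 0"
  shows "Im w \<ge> 0" "w \<noteq> 0" "norm w \<le> M" "norm w \<ge> 1 / M" "norm (1 / w) \<le> M"
proof -
  have "0 < 1 / M" using assms(2) by simp
  with assms(1) have pos: "norm w > 0" unfolding half_annulus_def by (auto intro: less_le_trans simp
      del: divide_eq_0_iff)
  show "Im w \<ge> 0" "norm w \<le> M" and le: "norm w \<ge> 1 / M"
    using assms(1) by (auto simp: half_annulus_def)
  from pos show "w \<noteq> 0" by auto
  from le pos assms(2) show "norm (1 / w) \<le> M"
    by (simp add: norm_divide field_simps)
qed

lemma unif_symbol_annulus:
  assumes "M > 0"
  shows "unif_symbol (half_annulus M) 0 (\<lambda>n w. w)" "unif_symbol (half_annulus M) 0 (\<lambda>n w. 1 / w)"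
  using half_annulusD[OF _ assms]
  by (intro unif_symbol_param; force simp: bounded_iff)+

text \<open>
  The exponent \<open>\<epsilon>\<close> is the margin in all estimates. The degree of \<open>R\<close> is so large that \<open>R\<^sup>2 - (1
  + X)\<close>, evaluated at a quantity of order \<open>n powr (- \<epsilon>)\<close>, is \<open>O(n powr (-2))\<close>.
\<close>
locale critical_phase =
  fixes \<sigma> \<tau> \<epsilon> :: real and L J :: nat and p :: "nat \<Rightarrow> real" and R H :: "complex poly"
  assumes \<sigma>: "0 < \<sigma>" "\<sigma> < 1"
    and \<epsilon>: "0 < \<epsilon>" "\<epsilon> \<le> (real L + 1 / 2) * \<sigma> - 1" "\<epsilon> \<le> \<sigma> / 2" "\<epsilon> \<le> 1 - \<sigma>"
    and L: "L \<ge> 1" and adm: "admissible_coeffs L p"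
    and R_square: "R\<^sup>2 = [:1, 1:] + monom 1 (Suc J) * H" and R_0: "poly R 0 = 1"
    and J: "2 \<le> real (Suc J) * \<epsilon>"
begin

abbreviation t :: "nat \<Rightarrow> complex \<Rightarrow> complex" where "t n w \<equiv> t_fun \<sigma> \<tau> n (w\<^sup>2)"
abbreviation T :: "nat \<Rightarrow> complex \<Rightarrow> complex" where "T n w \<equiv> T_fun \<sigma> \<tau> L p n (w\<^sup>2)"
abbreviation pw :: "real \<Rightarrow> nat \<Rightarrow> complex" where "pw e n \<equiv> of_real (real n powr e)"

text \<open>
  To leading order \<open>T n w\<close> is \<open>w\<^sup>2 * n powr (- \<sigma>)\<close>; the relative deviation comes from the term
  \<open>- \<tau> / n\<close> and from the higher powers of \<open>t n w\<close>.
\<close>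
definition deviation :: "nat \<Rightarrow> complex \<Rightarrow> complex" where
  "deviation n w = T n w / (w\<^sup>2 * pw (- \<sigma>) n) - 1"

text \<open>
  A substitute for \<open>sqrt (T n w)\<close> without branch points: for \<open>n \<ge> 1\<close> it is a polynomial in \<open>w\<close>
  and \<open>1 / w\<close>.
\<close>
definition phase :: "nat \<Rightarrow> complex \<Rightarrow> complex" where
  "phase n w = w * pw (- \<sigma> / 2) n * poly R (deviation n w)"

lemma t_eq: "t n w = - of_real \<tau> * pw (- 1) n + w\<^sup>2 * pw (- \<sigma>) n"
  by (simp add: t_fun_def powr_minus divide_inverse)

context
  fixes M :: real and K
  assumes M: "M > 0" and K: "K = half_annulus M"
begin

lemma symbol_w: "unif_symbol K 0 (\<lambda>n w. w)" "unif_symbol K 0 (\<lambda>n w. 1 / w)"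
  using unif_symbol_annulus[OF M] by (simp_all add: K)

lemma symbol_w2: "unif_symbol K 0 (\<lambda>n w. w\<^sup>2)" "unif_symbol K 0 (\<lambda>n w. 1 / w\<^sup>2)"
  using unif_symbol_mult[OF symbol_w(1) symbol_w(1)] unif_symbol_mult[OF symbol_w(2) symbol_w(2)]
  by (simp_all add: power2_eq_square)

lemma symbol_t: "unif_symbol K (- \<sigma>) t"
  unfolding t_eq using \<sigma>
  by (intro unif_symbol_add unif_symbol_mult_le[OF unif_symbol_const unif_symbol_powr]
      unif_symbol_mult_le[OF symbol_w2(1) unif_symbol_powr]) auto

lemma symbol_T_minus_t: "unif_symbol K (- 2 * \<sigma>) (\<lambda>n w. T n w - t n w)"
proof -
  have "unif_symbol K (- 2 * \<sigma>) (\<lambda>n w. \<Sum>l = 2..L. of_real (p l) * t n w ^ l)"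
    by (intro unif_symbol_sum unif_symbol_mult_le[OF unif_symbol_const unif_symbol_power[OF symbol_t]])
      (use \<sigma> in auto)
  then show ?thesis by (simp add: T_fun_def)
qed

text \<open>Here \<open>\<epsilon> \<le> 1 - \<sigma>\<close> controls the term \<open>- \<tau> / n\<close> and \<open>\<epsilon> \<le> \<sigma>\<close> the powers \<open>t ^ l\<close> with \<open>l \<ge> 2\<close>.\<close>
lemma symbol_deviation: "unif_symbol K (- \<epsilon>) deviation"
proof -
  have "unif_symbol K (- \<sigma> - \<epsilon>) (\<lambda>n w. - of_real \<tau> * pw (- 1) n + (T n w - t n w))"
    using \<epsilon> \<sigma>
    by (intro unif_symbol_add unif_symbol_mult_le[OF unif_symbol_const unif_symbol_powr]
        unif_symbol_mono[OF symbol_T_minus_t]) auto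
  then have "unif_symbol K (- \<epsilon>) (\<lambda>n w. 1 / w\<^sup>2 * (pw \<sigma> n * (- of_real \<tau> * pw (- 1) n + (T n w - t n w))))"
    by (intro unif_symbol_mult_le[OF symbol_w2(2) unif_symbol_mult_le[OF unif_symbol_powr, of _ _ _ _ "-
        \<epsilon>"]]) auto
  moreover have "\<forall>\<^sub>F n in sequentially. \<forall>w\<in>K.
      deviation n w = 1 / w\<^sup>2 * (pw \<sigma> n * (- of_real \<tau> * pw (- 1) n + (T n w - t n w)))"
    using eventually_gt_at_top[of 0]
  proof eventually_elim
    case (elim n)
    show ?case
    proof
      fix w assume "w \<in> K"
      then have w: "w \<noteq> 0" using half_annulusD M K by auto
      have "pw \<sigma> n * pw (- \<sigma>) n = 1"
        using elim by (simp flip: of_real_mult powr_add)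
      then have "1 / w\<^sup>2 * (pw \<sigma> n * (T n w - w\<^sup>2 * pw (- \<sigma>) n)) = deviation n w"
        using w elim by (simp add: deviation_def field_simps)
      then show "deviation n w = 1 / w\<^sup>2 * (pw \<sigma> n * (- of_real \<tau> * pw (- 1) n + (T n w - t n w)))"
        by (simp add: t_eq)
    qed
  qed
  ultimately show ?thesis by (rule unif_symbol_cong)
qed

lemma symbol_phase_minus_leading: "unif_symbol K (- \<sigma> / 2 - \<epsilon>) (\<lambda>n w. phase n w - w * pw (- \<sigma> / 2) n)"
proof -
  obtain c R1 where "R = pCons c R1" by (rule pCons_cases)
  with R_0 have R1: "poly R z = 1 + z * poly R1 z" for z by simp
  have "unif_symbol K (- \<epsilon>) (\<lambda>n w. deviation n w * poly R1 (deviation n w))"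
    using \<epsilon> by (intro unif_symbol_mult_le[OF symbol_deviation unif_symbol_poly[OF symbol_deviation]]) auto
  then have "unif_symbol K (- \<sigma> / 2 - \<epsilon>) (\<lambda>n w. (w * pw (- \<sigma> / 2) n) * (deviation n w * poly R1
      (deviation n w)))"
    by (intro unif_symbol_mult_le[OF unif_symbol_mult[OF symbol_w(1) unif_symbol_powr]]) auto
  then show ?thesis by (simp add: phase_def R1 algebra_simps)
qed

lemma symbol_phase: "unif_symbol K (- \<sigma> / 2) phase"
proof -
  have "unif_symbol K (- \<sigma> / 2) (\<lambda>n w. (phase n w - w * pw (- \<sigma> / 2) n) + w * pw (- \<sigma> / 2) n)"
    using \<epsilon> by (intro unif_symbol_add unif_symbol_mono[OF symbol_phase_minus_leading]
      unif_symbol_mult_le[OF symbol_w(1) unif_symbol_powr]) auto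
  then show ?thesis by simp
qed

text \<open>
  The leading term \<open>w * n powr (- \<sigma> / 2)\<close> of the phase satisfies this by the Taylor expansion of
  the power, with error \<open>O(n powr (-2 - \<sigma> / 2))\<close>; the rest is a symbol that is smaller by \<open>n
  powr (- \<epsilon>)\<close>.
\<close>
lemma phase_increment:
  "unif_O K (- 1 - \<sigma> / 2 - \<epsilon>) (\<lambda>n w. phase (Suc n) w - phase n w + of_real (\<sigma> / 2) * pw (- 1) n * phase
      n w)"
proof -
  let ?g = "\<lambda>n w. phase n w - w * pw (- \<sigma> / 2) n"
  have g: "unif_O K (- 1 - \<sigma> / 2 - \<epsilon>) (\<lambda>n w. ?g (Suc n) w - ?g n w)"
    using unif_symbolD(2)[OF symbol_phase_minus_leading] by (rule unif_O_mono) simp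
  have g': "unif_O K (- 1 - \<sigma> / 2 - \<epsilon>) (\<lambda>n w. of_real (\<sigma> / 2) * pw (- 1) n * ?g n w)"
    by (intro unif_O_mult_le[OF unif_O_mult[OF unif_O_const unif_symbolD(1)[OF unif_symbol_powr]]
          unif_symbolD(1)[OF symbol_phase_minus_leading]]) auto
  have "(\<lambda>n. real (Suc n) powr (- \<sigma> / 2) - real n powr (- \<sigma> / 2) + \<sigma> / 2 * real n powr (- 1) * real n
      powr (- \<sigma> / 2))
     \<in> O(\<lambda>n. real n powr (- 2 - \<sigma> / 2))"
    by real_asymp
  from unif_O_mult_le[OF unif_symbolD(1)[OF symbol_w(1)] unif_O_seq[OF this], of "- 1 - \<sigma> / 2 - \<epsilon>"]
  have m: "unif_O K (- 1 - \<sigma> / 2 - \<epsilon>) (\<lambda>n w. w * of_real (real (Suc n) powr (- \<sigma> / 2) - real n powr (- \<sigma>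
      / 2)
     + \<sigma> / 2 * real n powr (- 1) * real n powr (- \<sigma> / 2)))"
    using \<epsilon> \<sigma> by simp
  show ?thesis
    by (rule unif_O_cong[OF unif_O_add[OF m unif_O_add[OF g g']]]) (simp add: algebra_simps)
qed

lemma phase_square: "unif_O K (- 2 - \<sigma>) (\<lambda>n w. (phase n w)\<^sup>2 - T n w)"
proof -
  have "unif_symbol K (- 2) (\<lambda>n w. deviation n w ^ Suc J * poly H (deviation n w))"
    using \<epsilon> J by (intro unif_symbol_mult_le[OF unif_symbol_power[OF symbol_deviation]
        unif_symbol_poly[OF symbol_deviation]]) auto
  then have "unif_O K (- 2 - \<sigma>) (\<lambda>n w. (w\<^sup>2 * pw (- \<sigma>) n) * (deviation n w ^ Suc J * poly H (deviation n
      w)))"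
    by (intro unif_symbolD(1) unif_symbol_mult_le[OF unif_symbol_mult[OF symbol_w2(1)
        unif_symbol_powr]]) auto
  moreover have "\<forall>\<^sub>F n in sequentially. \<forall>w\<in>K.
      (phase n w)\<^sup>2 - T n w = (w\<^sup>2 * pw (- \<sigma>) n) * (deviation n w ^ Suc J * poly H (deviation n w))"
    using eventually_gt_at_top[of 0]
  proof eventually_elim
    case (elim n)
    show ?case
    proof
      fix w assume "w \<in> K"
      then have w: "w \<noteq> 0" using half_annulusD M K by auto
      have "poly (R\<^sup>2) (deviation n w) = 1 + deviation n w + deviation n w ^ Suc J * poly H (deviation n w)"
        unfolding R_square by (simp add: poly_monom)
      moreover have "(pw (- \<sigma> / 2) n)\<^sup>2 = pw (- \<sigma>) n"
        by (simp add: power2_eq_square flip: of_real_mult powr_add)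
      ultimately have "(phase n w)\<^sup>2 = w\<^sup>2 * pw (- \<sigma>) n * (1 + deviation n w + deviation n w ^ Suc J *
          poly H (deviation n w))"
        by (simp add: phase_def power_mult_distrib)
      moreover have "w\<^sup>2 * pw (- \<sigma>) n * (1 + deviation n w) = T n w"
        using w elim by (simp add: deviation_def)
      ultimately show "(phase n w)\<^sup>2 - T n w = (w\<^sup>2 * pw (- \<sigma>) n) * (deviation n w ^ Suc J * poly H
          (deviation n w))"
        by (simp add: distrib_left)
    qed
  qed
  ultimately show ?thesis by (rule unif_O_cong)
qed

lemma unif_O_T: "unif_O K (- \<sigma>) T"
proof -
  have "unif_O K (- \<sigma>) (\<lambda>n w. (T n w - t n w) + t n w)"
    using \<sigma> by (intro unif_O_add unif_O_mono[OF unif_symbolD(1)[OF symbol_T_minus_t]] unif_symbolD(1)[OF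
        symbol_t]) auto
  then show ?thesis by simp
qed

text \<open>
  The phase solves \<open>2 - 2 * cos \<phi> = t\<close> approximately. There are three errors: the remainder of
  the cosine series, the difference between \<open>phase\<^sup>2\<close> and \<open>T\<close>, and the remainder in the
  admissible expansion. The first and the last are \<open>O(n powr (- (L + 1) * \<sigma>))\<close>, which is where
  \<open>(L + 1 / 2) * \<sigma> > 1\<close> enters.
\<close>
lemma phase_cos: "unif_O K (- 1 - \<sigma> / 2 - \<epsilon>) (\<lambda>n w. 2 * cos (phase n w) - 2 + t n w)"
proof -
  let ?e = "- 1 - \<sigma> / 2 - \<epsilon>"
  define D where "D = (\<lambda>n w. 2 - 2 * cos (phase n w) - (\<Sum>k=1..L. of_real (c_coeff k) * ((phase n w)\<^sup>2) ^
      k))"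
  have Le: "- (real L + 1) * \<sigma> \<le> ?e"
    using \<epsilon>(2) by (simp add: algebra_simps)
  have small: "\<forall>\<^sub>F n in sequentially. \<forall>w\<in>K. norm (phase n w) < 1"
    using unif_symbolD(1)[OF symbol_phase] by (rule unif_O_small) (use \<sigma> in auto)
  \<comment> \<open>The remainder of the cosine series.\<close>
  have "unif_O K ?e (\<lambda>n w. phase n w ^ (2 * L + 2))"
    by (rule unif_O_mono[OF unif_O_power[OF unif_symbolD(1)[OF symbol_phase]]]) (use Le in \<open>simp add:
        algebra_simps\<close>)
  then have D: "unif_O K ?e D"
    by (rule unif_O_dominated[of _ _ _ _ 6])
      (use small in eventually_elim, unfold D_def, blast intro: cos_even_expansion less_imp_le)
  have pow: "unif_O K (- 2) (\<lambda>n w. ((phase n w)\<^sup>2) ^ k - T n w ^ k)" for k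
  proof (induction k)
    case 0
    show ?case by (simp add: unif_O_zero)
  next
    case (Suc k)
    have "unif_O K (- \<sigma>) (\<lambda>n w. (phase n w)\<^sup>2)"
      using unif_O_power[OF unif_symbolD(1)[OF symbol_phase], of 2] by simp
    moreover have "- \<sigma> \<le> real k * \<sigma>" by (rule order_trans[of _ 0]) (use \<sigma> in simp_all)
    ultimately have "unif_O K (- 2) (\<lambda>n w. (phase n w)\<^sup>2 * (((phase n w)\<^sup>2) ^ k - T n w ^ k) + ((phase n
        w)\<^sup>2 - T n w) * T n w ^ k)"
      using \<sigma> \<open>- \<sigma> \<le> real k * \<sigma>\<close>
      by (intro unif_O_add unif_O_mult_le[OF _ Suc] unif_O_mult_le[OF phase_square unif_O_power[OF
          unif_O_T]]) auto
    then show ?case by (simp add: algebra_simps)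
  qed
  \<comment> \<open>Replacing \<open>phase\<^sup>2\<close> by \<open>T\<close>.\<close>
  have S: "unif_O K ?e (\<lambda>n w. \<Sum>k=1..L. of_real (c_coeff k) * (((phase n w)\<^sup>2) ^ k - T n w ^ k))"
    using \<epsilon> by (intro unif_O_sum unif_O_cmult unif_O_mono[OF pow]) auto
  obtain V where V: "\<And>\<sigma> \<tau> n z. (\<Sum>k=1..L. of_real (c_coeff k) * T_fun \<sigma> \<tau> L p n z ^ k)
     = t_fun \<sigma> \<tau> n z + t_fun \<sigma> \<tau> n z ^ Suc L * poly V (t_fun \<sigma> \<tau> n z)"
    using admissible_expansion[OF adm L] by blast
  \<comment> \<open>The remainder of the admissible expansion.\<close>
  have Vb: "unif_O K ?e (\<lambda>n w. t n w ^ Suc L * poly V (t n w))"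
    using \<sigma> Le
    by (intro unif_O_mult_le[OF unif_O_power[OF unif_symbolD(1)[OF symbol_t]] unif_symbolD(1)[OF
        unif_symbol_poly[OF symbol_t]]])
      (auto simp: algebra_simps)
  show ?thesis
  proof (rule unif_O_cong[OF unif_O_minus[OF unif_O_add[OF D unif_O_add[OF S Vb]]]], intro
      always_eventually allI ballI)
    fix n w
    have eq: "(\<Sum>k=1..L. of_real (c_coeff k) * (((phase n w)\<^sup>2) ^ k - T n w ^ k))
      = (\<Sum>k=1..L. of_real (c_coeff k) * ((phase n w)\<^sup>2) ^ k) - (t n w + t n w ^ Suc L * poly V (t n w))"
      unfolding V[symmetric] by (simp only: right_diff_distrib sum_subtractf)
    show "2 * cos (phase n w) - 2 + t n w = - (D n w + ((\<Sum>k=1..L. of_real (c_coeff k) *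
        (((phase n w)\<^sup>2) ^ k - T n w ^ k)) + t n w ^ Suc L * poly V (t n w)))"
      unfolding D_def eq by (simp del: power_Suc)
  qed
qed

end
end

section \<open>Comparison with the square root on the cut plane\<close>

lemma Im_power_le: "\<bar>Im (z ^ l)\<bar> \<le> real l * norm z ^ (l - 1) * \<bar>Im z\<bar>"
proof (induction l)
  case (Suc l)
  have "\<bar>Im (z ^ Suc l)\<bar> \<le> \<bar>Re z\<bar> * \<bar>Im (z ^ l)\<bar> + \<bar>Im z\<bar> * \<bar>Re (z ^ l)\<bar>"
    by (simp add: abs_mult[symmetric])
  also have "\<dots> \<le> norm z * (real l * norm z ^ (l - 1) * \<bar>Im z\<bar>) + \<bar>Im z\<bar> * norm z ^ l"
    using abs_Re_le_cmod[of "z ^ l"] by (intro add_mono mult_mono Suc abs_Re_le_cmod) (auto simp: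
        norm_power)
  also have "\<dots> = real (Suc l) * norm z ^ (Suc l - 1) * \<bar>Im z\<bar>"
    by (cases l) (auto simp: algebra_simps)
  finally show ?case .
qed simp

lemma Re_csqrt_pos:
  assumes "norm u < 1" shows "Re (csqrt (1 + u)) > 0"
proof -
  have "Re (1 + u) > 0" using assms abs_Re_le_cmod[of u] by auto
  then show ?thesis
    using csqrt_principal[of "1 + u"]
    by (metis Re_csqrt csqrt.simps(1) less_eq_real_def not_less power2_csqrt Re_power2 power2_less_0
        zero_power2 diff_gt_0_iff_gt zero_le_power2)
qed

lemma Re_mult_cnj: "Re (u * cnj v) = Re u * Re v + Im u * Im v"
  by simp

context critical_phase
begin

abbreviation \<theta> :: "nat \<Rightarrow> complex \<Rightarrow> complex" where
  "\<theta> n w \<equiv> theta \<sigma> \<tau> L p n (w\<^sup>2, w)"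

lemma theta_off:
  assumes "\<not> (Im (T n w) = 0 \<and> Re (T n w) > 0)"
  shows "\<theta> n w = sqrt_slit (T n w)"
  unfolding theta_def Let_def prod.case if_not_P[OF assms] by (rule refl)

text \<open>
  On the imaginary axis \<open>sgn (Re w)\<close> vanishes, and \<open>\<theta>\<close> would be \<open>0\<close> if \<open>T\<close> were positive there.
\<close>
lemma theta_square: "(\<theta> n w)\<^sup>2 = T n w \<or> Re w = 0"
proof (cases "Im (T n w) = 0 \<and> Re (T n w) > 0")
  case True
  then have "T n w = of_real (Re (T n w))" by (simp add: complex_eq_iff)
  then show ?thesis
    using True by (auto simp: theta_def Let_def sgn_if simp flip: of_real_power)
next
  case False
  then show ?thesis by (simp add: theta_off)
qed

lemma Im_theta_nonneg: "Im (\<theta> n w) \<ge> 0"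
proof -
  have "Re (csqrt (- z)) \<ge> 0" for z
    using csqrt_principal[of "- z"] by auto
  then show ?thesis by (auto simp: theta_def Let_def sqrt_slit_def)
qed

text \<open>
  The branch of the square root is characterised by lying in the same closed quadrant as \<open>w\<close>. If
  \<open>T\<close> is a positive number, this is the convention for the edges; otherwise the imaginary part
  of \<open>\<theta>\<close> is nonnegative and \<open>2 * Re \<theta> * Im \<theta> = Im T\<close> fixes the sign of the real part.
\<close>
lemma Re_theta_cnj_nonneg:
  assumes "Im w \<ge> 0" "Im (T n w) * Re w \<ge> 0"
  shows "Re (\<theta> n w * cnj w) \<ge> 0"
proof (cases "Im (T n w) = 0 \<and> Re (T n w) > 0")
  case True
  then show ?thesis by (auto simp: theta_def Let_def sgn_if mult_nonneg_nonpos)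
next
  case False
  then have th: "\<theta> n w = sqrt_slit (T n w)" by (rule theta_off)
  have "0 \<le> Re (\<theta> n w) * Re w"
  proof (cases "Im (T n w) = 0")
    case True
    with False have "- T n w = of_real (- Re (T n w))" "Re (T n w) \<le> 0" by (auto simp: complex_eq_iff)
    then have "csqrt (- T n w) = of_real (sqrt (- Re (T n w)))"
      by (metis csqrt_of_real_nonneg Im_complex_of_real Re_complex_of_real neg_0_le_iff_le of_real_sqrt)
    then have "Re (\<theta> n w) = 0" unfolding th by (simp add: sqrt_slit_def)
    then show ?thesis by simp
  next
    case nz: False
    have "(\<theta> n w)\<^sup>2 = T n w" unfolding th by simp
    then have eq: "Im (T n w) = 2 * Re (\<theta> n w) * Im (\<theta> n w)"
      by (metis Im_power2)
    then have "Im (\<theta> n w) > 0"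
      using Im_theta_nonneg[of n w] nz by (cases "Im (\<theta> n w) = 0") auto
    moreover have "0 \<le> (2 * Im (\<theta> n w)) * (Re (\<theta> n w) * Re w)"
      using assms(2) unfolding eq by (simp add: mult_ac)
    ultimately show ?thesis by (simp add: zero_le_mult_iff)
  qed
  then show ?thesis
    using Im_theta_nonneg[of n w] assms(1) by (simp add: Re_mult_cnj)
qed

text \<open>
  The value of \<open>\<theta>\<close> for large \<open>n\<close>. Here continuity in \<open>w\<close> is visible, because the argument of
  \<open>csqrt\<close> stays near \<open>1\<close>.
\<close>
definition theta_csqrt :: "nat \<Rightarrow> complex \<Rightarrow> complex" where
  "theta_csqrt n w = w * pw (- \<sigma> / 2) n * csqrt (1 + deviation n w)"

lemma continuous_on_theta_csqrt: "n \<ge> 1 \<Longrightarrow> (\<And>w. w \<in> S \<Longrightarrow> w \<noteq> 0 \<and> norm (deviation n w) < 1) \<Longrightarrow> continuous_on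
    S (theta_csqrt n)"
  unfolding theta_csqrt_def
proof (intro continuous_intros)
  assume n: "n \<ge> 1" and S: "\<And>w. w \<in> S \<Longrightarrow> w \<noteq> 0 \<and> norm (deviation n w) < 1"
  have "continuous_on S (deviation n)"
    unfolding deviation_def T_fun_def t_fun_def using n S by (intro continuous_intros) auto
  moreover have "1 + deviation n w \<notin> \<real>\<^sub>\<le>\<^sub>0" if "w \<in> S" for w
    using S[OF that] abs_Re_le_cmod[of "deviation n w"] by (auto simp: complex_nonpos_Reals_iff)
  moreover have "continuous_on (- \<real>\<^sub>\<le>\<^sub>0) csqrt"
    by (rule continuous_at_imp_continuous_on) (simp add: continuous_at_csqrt)
  ultimately show "continuous_on S (\<lambda>w. csqrt (1 + deviation n w))"
    by (intro continuous_on_compose2[of "- \<real>\<^sub>\<le>\<^sub>0" csqrt S] continuous_on_add continuous_on_const) auto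
qed

context
  fixes M :: real and K
  assumes M: "M > 0" and K: "K = half_annulus M"
begin

text \<open>
  \<open>T\<close> has real coefficients in \<open>t\<close>, so the imaginary part of \<open>T - t\<close> is bounded by \<open>Im t\<close> in
  absolute value once \<open>t\<close> is small, and \<open>Im t\<close> has the sign of \<open>Im (w\<^sup>2) = 2 * Re w * Im w\<close>.
  This holds up to the edges, where both imaginary parts vanish.
\<close>
lemma Im_T_sign: "\<forall>\<^sub>F n in sequentially. \<forall>w\<in>K. Im (T n w) * Re w \<ge> 0"
proof -
  define S where "S = (\<Sum>l=2..L. \<bar>p l\<bar> * real l)"
  have S0: "S \<ge> 0" by (auto simp: S_def intro!: sum_nonneg)
  have "\<forall>\<^sub>F n in sequentially. \<forall>w\<in>K. norm (t n w) < min 1 (1 / (S + 1))"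
    by (rule unif_O_small[OF unif_symbolD(1)[OF symbol_t[OF M K]]]) (use \<sigma> S0 in auto)
  then show ?thesis
  proof eventually_elim
    case (elim n)
    show ?case
    proof
      fix w assume w: "w \<in> K"
      define u where "u = t n w"
      have "norm u < 1 \<and> norm u < 1 / (S + 1)"
        unfolding min_less_iff_conj[symmetric] u_def using elim w by blast
      then have u: "norm u < 1" "norm u * (S + 1) < 1" using S0 by (simp_all add: pos_less_divide_eq)
      have "\<bar>Im (\<Sum>l=2..L. of_real (p l) * u ^ l)\<bar> \<le> (\<Sum>l=2..L. \<bar>p l\<bar> * \<bar>Im (u ^ l)\<bar>)"
        by (simp add: sum_abs abs_mult[symmetric])
      also have "\<dots> \<le> (\<Sum>l=2..L. \<bar>p l\<bar> * (real l * norm u * \<bar>Im u\<bar>))"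
      proof (intro sum_mono mult_left_mono)
        fix l assume "l \<in> {2..L}"
        have "\<bar>Im (u ^ l)\<bar> \<le> real l * norm u ^ (l - 1) * \<bar>Im u\<bar>" by (rule Im_power_le)
        also have "norm u ^ (l - 1) \<le> norm u ^ 1"
          using \<open>l \<in> {2..L}\<close> u(1) by (intro power_decreasing) auto
        finally show "\<bar>Im (u ^ l)\<bar> \<le> real l * norm u * \<bar>Im u\<bar>" by (simp add: mult_left_mono mult_right_mono)
      qed auto
      also have "\<dots> = (norm u * S) * \<bar>Im u\<bar>" by (simp add: S_def sum_distrib_left sum_distrib_right mult_ac)
      also have "\<dots> \<le> 1 * \<bar>Im u\<bar>"
        using u S0 by (intro mult_right_mono) (auto simp: algebra_simps intro: order_trans[OF _
            less_imp_le[OF u(2)]])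
      finally have le: "\<bar>Im (T n w) - Im u\<bar> \<le> \<bar>Im u\<bar>"
        by (simp add: T_fun_def u_def)
      have Imu: "Im u * Re w = 2 * (Re w)\<^sup>2 * Im w * real n powr (- \<sigma>)"
        unfolding u_def t_eq by (simp add: Im_power2) (simp add: power2_eq_square)
      also have "\<dots> \<ge> 0" using half_annulusD(1)[of w M] w K M by simp
      finally have "Im u * Re w \<ge> 0" .
      then show "Im (T n w) * Re w \<ge> 0"
        using le by (auto simp: zero_le_mult_iff abs_le_iff abs_if split: if_splits)
    qed
  qed
qed

text \<open>
  Both sides are square roots of \<open>T n w\<close>. The right side has positive scalar product with \<open>w\<close>
  and the left side has a nonnegative one, so they cannot be opposite.
\<close>
lemma theta_eq_csqrt: "\<forall>\<^sub>F n in sequentially. \<forall>w\<in>K. norm (deviation n w) < 1 \<and> \<theta> n w = theta_csqrt n w"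
proof -
  have "\<forall>\<^sub>F n in sequentially. \<forall>w\<in>K. norm (deviation n w) < 1"
    by (rule unif_O_small[OF unif_symbolD(1)[OF symbol_deviation[OF M K]]]) (use \<epsilon> in auto)
  then show ?thesis
    using Im_T_sign eventually_gt_at_top[of 0]
  proof eventually_elim
    case (elim n)
    show ?case
    proof
      fix w assume w: "w \<in> K"
      have w0: "Im w \<ge> 0" "w \<noteq> 0" using half_annulusD[of w M] w M K by auto
      define c where "c = csqrt (1 + deviation n w)"
      have s1: "norm (deviation n w) < 1" using elim w by auto
      then have c: "Re c > 0"
        unfolding c_def by (rule Re_csqrt_pos)
      have Tw: "T n w = w\<^sup>2 * pw (- \<sigma>) n * (1 + deviation n w)" using w0 elim by (simp add: deviation_def)
      have "(pw (- \<sigma> / 2) n)\<^sup>2 = pw (- \<sigma>) n"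
        by (simp add: power2_eq_square flip: of_real_mult powr_add)
      then have "(theta_csqrt n w)\<^sup>2 = w\<^sup>2 * pw (- \<sigma>) n * (1 + deviation n w)"
        by (simp add: theta_csqrt_def power_mult_distrib)
      also have "\<dots> = T n w" by (rule Tw[symmetric])
      finally have sq: "(theta_csqrt n w)\<^sup>2 = T n w" .
      have "(\<theta> n w)\<^sup>2 = T n w"
      proof -
        have "\<theta> n w = sqrt_slit (T n w)" if "\<not> (Im (T n w) = 0 \<and> Re (T n w) > 0)"
          using that by (rule theta_off)
        \<comment> \<open>On the imaginary axis \<open>T n w\<close> has the sign of \<open>w\<^sup>2\<close>, so it is not positive.\<close>
        moreover have "Re w \<noteq> 0" if "Im (T n w) = 0 \<and> Re (T n w) > 0"
        proof
          assume "Re w = 0"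
          then have "w\<^sup>2 = of_real (- (Im w)\<^sup>2)" by (simp add: complex_eq_iff Re_power2 Im_power2)
          then have "Re (T n w) = - (Im w)\<^sup>2 * real n powr (- \<sigma>) * Re (1 + deviation n w)"
            unfolding Tw by (simp only: Re_complex_of_real flip: of_real_mult) simp
          moreover have "Re (1 + deviation n w) \<ge> 0" using s1 abs_Re_le_cmod[of "deviation n w"] by auto
          then have "(Im w)\<^sup>2 * real n powr (- \<sigma>) * Re (1 + deviation n w) \<ge> 0" by simp
          ultimately show False using that by linarith
        qed
        ultimately show ?thesis using theta_square[of n w] by (metis sqrt_slit_square)
      qed
      with sq have "(\<theta> n w)\<^sup>2 = (theta_csqrt n w)\<^sup>2" by simp
      then have alt: "\<theta> n w = theta_csqrt n w \<or> \<theta> n w = - theta_csqrt n w"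
        by (simp only: power2_eq_iff)
      have "theta_csqrt n w * cnj w = of_real ((norm w)\<^sup>2 * real n powr (- \<sigma> / 2)) * c"
        using complex_norm_square[of w] by (simp add: theta_csqrt_def c_def mult_ac)
      then have "Re (theta_csqrt n w * cnj w) > 0"
        using c w0 elim by simp
      moreover have "Re (\<theta> n w * cnj w) \<ge> 0"
        using w0 elim w by (intro Re_theta_cnj_nonneg) auto
      ultimately have "\<theta> n w = theta_csqrt n w" using alt by auto
      with s1 show "norm (deviation n w) < 1 \<and> \<theta> n w = theta_csqrt n w" by simp
    qed
  qed
qed

text \<open>
  The difference of the squares is \<open>O(n powr (-2 - \<sigma>))\<close> and the sum is at least of order \<open>n powr
  (- \<sigma> / 2)\<close>: it is close to \<open>w * n powr (- \<sigma> / 2) * (csqrt (1 + deviation n w) + 1)\<close>.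
\<close>
lemma theta_minus_phase: "unif_O K (- 2) (\<lambda>n w. \<theta> n w - phase n w)"
proof -
  have "\<forall>\<^sub>F n in sequentially. \<forall>w\<in>K. norm (theta_csqrt n w + w * pw (- \<sigma> / 2) n) \<ge> 1 / M * real n powr
      (- \<sigma> / 2)"
    using theta_eq_csqrt
  proof eventually_elim
    case (elim n)
    show ?case
    proof
      fix w assume w: "w \<in> K"
      have "1 \<le> Re (csqrt (1 + deviation n w) + 1)" using Re_csqrt_pos[of "deviation n w"] elim w by auto
      then have "1 \<le> norm (csqrt (1 + deviation n w) + 1)" using complex_Re_le_cmod order_trans by blast
      moreover have "norm w \<ge> 1 / M" using half_annulusD(4)[of w M] w K M by simp
      ultimately have "1 / M * 1 \<le> norm w * norm (csqrt (1 + deviation n w) + 1)"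
        by (intro mult_mono) auto
      then have "1 / M * real n powr (- \<sigma> / 2) \<le> (norm w * norm (csqrt (1 + deviation n w) + 1)) * real
          n powr (- \<sigma> / 2)"
        by (intro mult_right_mono) auto
      also have "\<dots> = norm (w * pw (- \<sigma> / 2) n * (csqrt (1 + deviation n w) + 1))"
        by (simp only: norm_mult norm_of_real) (simp add: mult_ac)
      finally show "norm (theta_csqrt n w + w * pw (- \<sigma> / 2) n) \<ge> 1 / M * real n powr (- \<sigma> / 2)"
        by (simp add: theta_csqrt_def algebra_simps)
    qed
  qed
  moreover have "unif_O K (- \<sigma> / 2 - \<epsilon>) (\<lambda>n w. (theta_csqrt n w + phase n w) - (theta_csqrt n w + w * pw
      (- \<sigma> / 2) n))"
    using unif_symbolD(1)[OF symbol_phase_minus_leading[OF M K]] by simp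
  ultimately have low: "\<forall>\<^sub>F n in sequentially. \<forall>w\<in>K. norm (theta_csqrt n w + phase n w) \<ge> 1 / M / 2 *
      real n powr (- \<sigma> / 2)"
    using M \<epsilon> by (intro unif_O_lower_bound[where \<delta> = \<epsilon> and e = "- \<sigma> / 2"]) auto
  then have inv: "unif_O K (- (- \<sigma> / 2)) (\<lambda>n w. 1 / (theta_csqrt n w + phase n w))"
    using M by (intro unif_O_inverse[of "1 / M / 2"]) auto
  have "unif_O K (- 2) (\<lambda>n w. - ((phase n w)\<^sup>2 - T n w) * (1 / (theta_csqrt n w + phase n w)))"
    using \<sigma> by (intro unif_O_mult_le[OF unif_O_minus[OF phase_square[OF M K]] inv]) auto
  moreover have "\<forall>\<^sub>F n in sequentially. \<forall>w\<in>K. \<theta> n w - phase n w =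
      - ((phase n w)\<^sup>2 - T n w) * (1 / (theta_csqrt n w + phase n w))"
    using low theta_eq_csqrt eventually_gt_at_top[of 0]
  proof eventually_elim
    case (elim n)
    show ?case
    proof
      fix w assume w: "w \<in> K"
      have "0 < 1 / M / 2 * real n powr (- \<sigma> / 2)" using M elim by simp
      also have "\<dots> \<le> norm (theta_csqrt n w + phase n w)" using elim w by blast
      finally have nz: "theta_csqrt n w + phase n w \<noteq> 0" by auto
      have "w \<noteq> 0" using half_annulusD(2)[of w M] w K M by simp
      moreover have "(pw (- \<sigma> / 2) n)\<^sup>2 = pw (- \<sigma>) n"
        by (simp add: power2_eq_square flip: of_real_mult powr_add)
      ultimately have "(theta_csqrt n w)\<^sup>2 = T n w"
        using elim by (simp add: theta_csqrt_def power_mult_distrib deviation_def)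
      then have "- ((phase n w)\<^sup>2 - T n w) = (theta_csqrt n w - phase n w) * (theta_csqrt n w + phase n w)"
        by (simp add: power2_eq_square algebra_simps)
      moreover have "\<theta> n w = theta_csqrt n w" using elim w by blast
      ultimately show "\<theta> n w - phase n w = - ((phase n w)\<^sup>2 - T n w) * (1 / (theta_csqrt n w + phase n w))"
        using nz by simp
    qed
  qed
  ultimately show ?thesis by (rule unif_O_cong)
qed

end
end

section \<open>The ansatz and its residual\<close>

text \<open>
  The case \<open>\<gamma> = 1\<close>, to which the general one is reduced by \<open>F n = (-\<gamma>) ^ n * G n\<close> and \<open>b n \<mapsto> \<gamma> *
  b n\<close>.
\<close>
locale critical_jacobi = critical_phase +
  fixes a b :: "nat \<Rightarrow> real" and \<alpha> \<beta> :: real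
  assumes a_pos: "\<And>n. a n > 0"
    and a_asymp: "(\<lambda>n. a n - real n powr \<sigma> * (1 + \<alpha> / real n)) \<in> O(\<lambda>n. real n powr \<sigma> / real n ^ 2)"
    and b_asymp: "(\<lambda>n. b n - 2 * real n powr \<sigma> * (1 + \<beta> / real n)) \<in> O(\<lambda>n. real n powr \<sigma> / real n ^ 2)"
    and \<tau>: "\<tau> = 2 * \<beta> - 2 * \<alpha> + \<sigma>"
begin

lemma bigo_norm: "f \<in> O(\<lambda>n. real n powr \<sigma> / real n ^ 2) \<longleftrightarrow> f \<in> O(\<lambda>n. real n powr (\<sigma> - 2))"
proof -
  have "(\<lambda>n. real n powr \<sigma> / real n ^ 2) \<in> \<Theta>(\<lambda>n. real n powr (\<sigma> - 2))"
    by real_asymp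
  then show ?thesis by (simp add: landau_o.big.cong_bigtheta)
qed

lemma a_equiv: "(\<lambda>n. a n / real n powr \<sigma>) \<longlonglongrightarrow> 1"
proof -
  have "(\<lambda>n. a n - real n powr \<sigma> * (1 + \<alpha> / real n)) \<in> o(\<lambda>n. real n powr \<sigma>)"
    by (rule landau_o.big_small_trans[OF a_asymp]) real_asymp
  then have "(\<lambda>n. (a n - real n powr \<sigma> * (1 + \<alpha> / real n)) / real n powr \<sigma>) \<longlonglongrightarrow> 0"
    by (rule smalloD_tendsto)
  moreover have "(\<lambda>n. (real n powr \<sigma> * (1 + \<alpha> / real n)) / real n powr \<sigma>) \<longlonglongrightarrow> 1"
    by real_asymp
  ultimately have "(\<lambda>n. (a n - real n powr \<sigma> * (1 + \<alpha> / real n)) / real n powr \<sigma>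
      + (real n powr \<sigma> * (1 + \<alpha> / real n)) / real n powr \<sigma>) \<longlonglongrightarrow> 0 + 1"
    by (rule tendsto_add)
  then show ?thesis by (simp add: diff_divide_distrib)
qed

lemma a_bounds: "\<forall>\<^sub>F n in sequentially. real n powr \<sigma> / 2 \<le> a n \<and> a n \<le> 2 * real n powr \<sigma>"
proof -
  have "\<forall>\<^sub>F n in sequentially. a n / real n powr \<sigma> > 1 / 2" "\<forall>\<^sub>F n in sequentially. a n / real n powr \<sigma> < 2"
    using order_tendstoD(1)[OF a_equiv, of "1 / 2"] order_tendstoD(2)[OF a_equiv, of 2] by simp_all
  then show ?thesis
    using eventually_gt_at_top[of 0] by eventually_elim (simp add: field_simps)
qed

lemma inverse_a_bigo: "(\<lambda>n. 1 / a n) \<in> O(\<lambda>n. real n powr (- \<sigma>))"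
proof (rule landau_o.bigI[of 2])
  show "\<forall>\<^sub>F n in sequentially. norm (1 / a n) \<le> 2 * norm (real n powr (- \<sigma>))"
    using a_bounds eventually_gt_at_top[of 0]
    by eventually_elim (use a_pos in \<open>simp add: powr_minus field_simps\<close>)
qed simp

lemma div_a_bigo: "f \<in> O(\<lambda>n. real n powr e) \<Longrightarrow> (\<lambda>n. f n / a n) \<in> O(\<lambda>n. real n powr (e - \<sigma>))"
  using landau_o.big.mult[OF _ inverse_a_bigo, of f "\<lambda>n. real n powr e"] by (simp add: powr_add[symmetric])

lemma a_pred_bigo: "(\<lambda>n. a (n - 1) / a n - (1 - \<sigma> / real n)) \<in> O(\<lambda>n. real n powr (- 2))"
proof -
  have a: "(\<lambda>n. a n - real n powr \<sigma> * (1 + \<alpha> / real n)) \<in> O(\<lambda>n. real n powr (\<sigma> - 2))"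
    using a_asymp by (simp add: bigo_norm)
  have lim: "filterlim (\<lambda>n::nat. n - 1) at_top sequentially"
    by (rule filterlim_minus_const_nat_at_top)
  have "(\<lambda>n. a (n - 1) - real (n - 1) powr \<sigma> * (1 + \<alpha> / real (n - 1))) \<in> O(\<lambda>n. real (n - 1) powr (\<sigma> - 2))"
    using landau_o.big.compose[OF a lim] by simp
  also have "(\<lambda>n. real (n - 1) powr (\<sigma> - 2)) \<in> O(\<lambda>n. real n powr (\<sigma> - 2))"
    by real_asymp
  finally have 1: "(\<lambda>n. a (n - 1) - real (n - 1) powr \<sigma> * (1 + \<alpha> / real (n - 1))) \<in> O(\<lambda>n. real n powr (\<sigma>
      - 2))" .
  have "(\<lambda>n. 1 - \<sigma> / real n) \<in> O(\<lambda>n. 1)" by real_asymp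
  from landau_o.big.mult[OF this a]
  have 2: "(\<lambda>n. (1 - \<sigma> / real n) * (a n - real n powr \<sigma> * (1 + \<alpha> / real n))) \<in> O(\<lambda>n. real n powr (\<sigma> - 2))"
    by simp
  have 3: "(\<lambda>n. real (n - 1) powr \<sigma> * (1 + \<alpha> / real (n - 1)) - (1 - \<sigma> / real n) * (real n powr \<sigma> * (1 +
      \<alpha> / real n)))
      \<in> O(\<lambda>n. real n powr (\<sigma> - 2))"
    by real_asymp
  have "(\<lambda>n. a (n - 1) - (1 - \<sigma> / real n) * a n) \<in> O(\<lambda>n. real n powr (\<sigma> - 2))"
    using sum_in_bigo(1)[OF sum_in_bigo(2)[OF 1 2] 3] by (simp add: algebra_simps)
  from div_a_bigo[OF this]
  have "(\<lambda>n. (a (n - 1) - (1 - \<sigma> / real n) * a n) / a n) \<in> O(\<lambda>n. real n powr (- 2))" by simp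
  also have "(\<lambda>n. (a (n - 1) - (1 - \<sigma> / real n) * a n) / a n) = (\<lambda>n. a (n - 1) / a n - (1 - \<sigma> / real n))"
    using a_pos by (simp add: fun_eq_iff diff_divide_distrib less_imp_neq[THEN not_sym])
  finally show ?thesis .
qed

lemma a_succ_bigo: "(\<lambda>n. a n / a (Suc n) - 1) \<in> O(\<lambda>n. real n powr (- 1))"
proof -
  have "(\<lambda>n. a (Suc n - 1) / a (Suc n) - (1 - \<sigma> / real (Suc n))) \<in> O(\<lambda>n. real (Suc n) powr (- 2))"
    using landau_o.big.compose[OF a_pred_bigo filterlim_Suc] by simp
  also have "(\<lambda>n. real (Suc n) powr (- 2)) \<in> O(\<lambda>n. real n powr (- 1))" by real_asymp
  finally have 1: "(\<lambda>n. a (Suc n - 1) / a (Suc n) - (1 - \<sigma> / real (Suc n))) \<in> O(\<lambda>n. real n powr (- 1))" .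
  have 2: "(\<lambda>n. \<sigma> / real (Suc n)) \<in> O(\<lambda>n. real n powr (- 1))" by real_asymp
  show ?thesis using sum_in_bigo(2)[OF 1 2] by simp
qed

lemma b_over_a_bigo: "(\<lambda>n. b n / a n - (2 + (\<tau> - \<sigma>) * real n powr (- 1))) \<in> O(\<lambda>n. real n powr (- 2))"
proof -
  have a: "(\<lambda>n. a n - real n powr \<sigma> * (1 + \<alpha> / real n)) \<in> O(\<lambda>n. real n powr (\<sigma> - 2))"
    and b: "(\<lambda>n. b n - 2 * real n powr \<sigma> * (1 + \<beta> / real n)) \<in> O(\<lambda>n. real n powr (\<sigma> - 2))"
    using a_asymp b_asymp by (simp_all add: bigo_norm)
  have "(\<lambda>n. 2 + (\<tau> - \<sigma>) * real n powr (- 1)) \<in> O(\<lambda>n. 1)" by real_asymp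
  from landau_o.big.mult[OF this a]
  have 2: "(\<lambda>n. (2 + (\<tau> - \<sigma>) * real n powr (- 1)) * (a n - real n powr \<sigma> * (1 + \<alpha> / real n))) \<in> O(\<lambda>n.
      real n powr (\<sigma> - 2))"
    by simp
  have 3: "(\<lambda>n. 2 * real n powr \<sigma> * (1 + \<beta> / real n)
        - (2 + (\<tau> - \<sigma>) * real n powr (- 1)) * (real n powr \<sigma> * (1 + \<alpha> / real n))) \<in> O(\<lambda>n. real n powr (\<sigma>
            - 2))"
    unfolding \<tau> by real_asymp
  have "(\<lambda>n. b n - (2 + (\<tau> - \<sigma>) * real n powr (- 1)) * a n) \<in> O(\<lambda>n. real n powr (\<sigma> - 2))"
    using sum_in_bigo(1)[OF sum_in_bigo(2)[OF b 2] 3] by (simp add: algebra_simps)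
  from div_a_bigo[OF this]
  have "(\<lambda>n. (b n - (2 + (\<tau> - \<sigma>) * real n powr (- 1)) * a n) / a n) \<in> O(\<lambda>n. real n powr (- 2))" by simp
  also have "(\<lambda>n. (b n - (2 + (\<tau> - \<sigma>) * real n powr (- 1)) * a n) / a n) = (\<lambda>n. b n / a n - (2 + (\<tau> - \<sigma>)
      * real n powr (- 1)))"
    using a_pos by (simp add: fun_eq_iff diff_divide_distrib less_imp_neq[THEN not_sym])
  finally show ?thesis .
qed

lemma inverse_a_expansion: "(\<lambda>n. 1 / a n - real n powr (- \<sigma>)) \<in> O(\<lambda>n. real n powr (- 1 - \<sigma>))"
proof -
  have "(\<lambda>n. a n - real n powr \<sigma> * (1 + \<alpha> / real n)) \<in> O(\<lambda>n. real n powr (\<sigma> - 2))"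
    using a_asymp by (simp add: bigo_norm)
  also have "(\<lambda>n. real n powr (\<sigma> - 2)) \<in> O(\<lambda>n. real n powr (\<sigma> - 1))" by real_asymp
  finally have 1: "(\<lambda>n. a n - real n powr \<sigma> * (1 + \<alpha> / real n)) \<in> O(\<lambda>n. real n powr (\<sigma> - 1))" .
  have 2: "(\<lambda>n. real n powr \<sigma> * (1 + \<alpha> / real n) - real n powr \<sigma>) \<in> O(\<lambda>n. real n powr (\<sigma> - 1))" by
      real_asymp
  have "(\<lambda>n. a n - real n powr \<sigma>) \<in> O(\<lambda>n. real n powr (\<sigma> - 1))"
    using sum_in_bigo(1)[OF 1 2] by simp
  from landau_o.big.mult[OF div_a_bigo[OF this] landau_o.big_refl[of "\<lambda>n. real n powr (- \<sigma>)"]]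
  have "(\<lambda>n. - ((a n - real n powr \<sigma>) / a n * real n powr (- \<sigma>))) \<in> O(\<lambda>n. real n powr (\<sigma> - 1 - \<sigma>) * real
      n powr (- \<sigma>))"
    by (simp only: landau_o.big.uminus_in_iff)
  also have "(\<lambda>n. real n powr (\<sigma> - 1 - \<sigma>) * real n powr (- \<sigma>)) = (\<lambda>n. real n powr (- 1 - \<sigma>))"
    by (simp only: powr_add[symmetric]) simp
  finally have "(\<lambda>n. - ((a n - real n powr \<sigma>) / a n * real n powr (- \<sigma>))) \<in> O(\<lambda>n. real n powr (- 1 - \<sigma>))" .
  moreover have "\<forall>\<^sub>F n in sequentially. - ((a n - real n powr \<sigma>) / a n * real n powr (- \<sigma>)) = 1 / a n -
      real n powr (- \<sigma>)"
    using eventually_gt_at_top[of 0]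
  proof eventually_elim
    case (elim n)
    then show ?case using a_pos[of n] by (simp add: powr_minus field_simps)
  qed
  ultimately show ?thesis by (subst (asm) landau_o.big.in_cong)
qed

text \<open>
  At \<open>n = 0\<close> the factor \<open>n powr (- \<sigma> / 4)\<close> is \<open>0\<close> by convention; the ansatz is used for \<open>n \<ge> 1\<close>.
\<close>
definition ansatz :: "nat \<Rightarrow> complex \<Rightarrow> complex" where
  "ansatz n w = pw (- \<sigma> / 4) n * exp (\<i> * (\<Sum>m=1..n. phase m w))"

definition amp :: "nat \<Rightarrow> real" where
  "amp n = (real (Suc n) / real n) powr (- \<sigma> / 4)"

text \<open>
  The value of \<open>(a (n - 1) * A (n - 1) + a n * A (n + 1) - (b n - w\<^sup>2) * A n) / (a n * A n)\<close> for
  the ansatz \<open>A\<close>, written out so that the size of each term can be read off.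
\<close>
definition residual :: "nat \<Rightarrow> complex \<Rightarrow> complex" where
  "residual n w = of_real (amp n) * exp (\<i> * phase (Suc n) w)
     + of_real (a (n - 1) / a n / amp (n - 1)) * exp (- \<i> * phase n w) - (of_real (b n) - w\<^sup>2) / of_real
         (a n)"

lemma ansatz_nz: "n \<ge> 1 \<Longrightarrow> ansatz n w \<noteq> 0"
  by (simp add: ansatz_def)

lemma amp_pos: "n \<ge> 1 \<Longrightarrow> amp n > 0"
  by (simp add: amp_def)

lemma ansatz_Suc:
  assumes "n \<ge> 1"
  shows "ansatz (Suc n) w = of_real (amp n) * exp (\<i> * phase (Suc n) w) * ansatz n w"
proof -
  have "real (Suc n) powr (- \<sigma> / 4) = amp n * real n powr (- \<sigma> / 4)"
    using assms by (simp add: amp_def powr_divide)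
  then show ?thesis
    by (simp add: ansatz_def distrib_left exp_add)
qed

lemma ansatz_equation:
  assumes "n \<ge> 2"
  shows "of_real (a (n - 1)) * ansatz (n - 1) w + of_real (a n) * ansatz (Suc n) w
     - (of_real (b n) - w\<^sup>2) * ansatz n w = of_real (a n) * residual n w * ansatz n w"
proof -
  have "n - 1 \<ge> 1" using assms by simp
  then have nz: "amp (n - 1) \<noteq> 0" using amp_pos[of "n - 1"] by linarith
  have "ansatz n w = of_real (amp (n - 1)) * exp (\<i> * phase n w) * ansatz (n - 1) w"
    using ansatz_Suc[of "n - 1" w] assms by simp
  then have prev: "ansatz (n - 1) w = of_real (1 / amp (n - 1)) * exp (- \<i> * phase n w) * ansatz n w"
    using nz by (simp add: exp_minus field_simps)
  have "complex_of_real (a n) \<noteq> 0" using a_pos[of n] by simp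
  then have res: "of_real (a n) * residual n w = of_real (a n) * (of_real (amp n) * exp (\<i> * phase (Suc
      n) w))
     + of_real (a (n - 1)) * (of_real (1 / amp (n - 1)) * exp (- \<i> * phase n w)) - (of_real (b n) - w\<^sup>2)"
    by (simp add: residual_def distrib_left right_diff_distrib diff_divide_distrib)
  have succ: "ansatz (Suc n) w = of_real (amp n) * exp (\<i> * phase (Suc n) w) * ansatz n w"
    using assms by (intro ansatz_Suc) simp
  show ?thesis
    unfolding prev succ res by (simp only: algebra_simps)
qed

lemma amp_bigo: "(\<lambda>n. amp n - (1 - \<sigma> / 4 * real n powr (- 1))) \<in> O(\<lambda>n. real n powr (- 2))"
  unfolding amp_def by real_asymp

lemma amp_pred_bigo:
  "(\<lambda>n. a (n - 1) / a n / amp (n - 1) - (1 - 3 * \<sigma> / 4 * real n powr (- 1))) \<in> O(\<lambda>n. real n powr (- 2))"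
proof -
  have 1: "(\<lambda>n. 1 / amp (n - 1)) \<in> O(\<lambda>n. 1)"
    unfolding amp_def by real_asymp
  have 2: "(\<lambda>n. (1 - \<sigma> / real n) * (1 / amp (n - 1)) - (1 - 3 * \<sigma> / 4 * real n powr (- 1))) \<in> O(\<lambda>n. real
      n powr (- 2))"
    unfolding amp_def by real_asymp
  have "(\<lambda>n. (a (n - 1) / a n - (1 - \<sigma> / real n)) * (1 / amp (n - 1))) \<in> O(\<lambda>n. real n powr (- 2))"
    using landau_o.big.mult[OF a_pred_bigo 1] by simp
  from sum_in_bigo(1)[OF this 2]
  have "(\<lambda>n. (a (n - 1) / a n - (1 - \<sigma> / real n)) * (1 / amp (n - 1))
      + ((1 - \<sigma> / real n) * (1 / amp (n - 1)) - (1 - 3 * \<sigma> / 4 * real n powr (- 1)))) \<in> O(\<lambda>n. real n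
          powr (- 2))" .
  also have "(\<lambda>n. (a (n - 1) / a n - (1 - \<sigma> / real n)) * (1 / amp (n - 1))
      + ((1 - \<sigma> / real n) * (1 / amp (n - 1)) - (1 - 3 * \<sigma> / 4 * real n powr (- 1))))
    = (\<lambda>n. a (n - 1) / a n / amp (n - 1) - (1 - 3 * \<sigma> / 4 * real n powr (- 1)))"
    by (rule ext) (simp add: diff_divide_distrib)
  finally show ?thesis .
qed

context
  fixes M :: real and K
  assumes M: "M > 0" and K: "K = half_annulus M"
begin

lemma symbol_i_phase: "unif_symbol K (- \<sigma> / 2) (\<lambda>n w. \<i> * phase n w)" "unif_symbol K (- \<sigma> / 2) (\<lambda>n w. -
    \<i> * phase n w)"
  by (intro unif_symbol_mult_le[OF unif_symbol_const symbol_phase[OF M K]]; simp)+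

text \<open>
  With \<open>E = exp (\<i> * phase n w)\<close> and \<open>D\<close> the increment of \<open>\<i> * phase\<close>, the residual is \<open>2 * cos
  (phase n w) - 2 + t\<close>, plus \<open>D\<close>, plus terms with a factor \<open>1 / n\<close>, plus terms that are
  quadratic in small quantities. The terms with \<open>1 / n\<close> are \<open>\<sigma> - \<sigma> / 4 * E - 3 * \<sigma> / 4 / E\<close>,
  that is \<open>\<i> * \<sigma> / 2 * phase n w\<close> to first order; this is cancelled by \<open>D\<close> according to
  \<open>phase_increment\<close>.
\<close>
lemma residual_bound: "unif_O K (- 1 - \<sigma> / 2 - \<epsilon>) residual"
proof -
  let ?e = "- 1 - \<sigma> / 2 - \<epsilon>"
  let ?\<Delta> = "\<lambda>n w. \<i> * phase (Suc n) w - \<i> * phase n w"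
  note ip = symbol_i_phase(1) and im = symbol_i_phase(2)
  have neg: "- \<sigma> / 2 < 0" using \<sigma> by simp
  note E = unif_symbol_exp[OF ip neg] and E' = unif_symbol_exp[OF im neg]
  have \<Delta>: "unif_O K (- \<sigma> / 2 - 1) ?\<Delta>" by (rule unif_symbolD(2)[OF ip])
  have i1: "unif_O K (- 1) (\<lambda>n w. pw (- 1) n)" by (rule unif_symbolD(1)[OF unif_symbol_powr])
  have le2: "- 2 \<le> ?e" using \<epsilon> \<sigma> by simp
  have 1: "unif_O K ?e (\<lambda>n w. (of_real (amp n) - of_real (1 - \<sigma> / 4 * real n powr (- 1))) * exp (\<i> *
      phase (Suc n) w))"
    using le2 by (intro unif_O_mult_le[OF unif_O_seq_diff[OF amp_bigo] unif_O_shift[OF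
        unif_symbolD(1)[OF E(2)]]]) auto
  have 2: "unif_O K ?e (\<lambda>n w. (of_real (a (n - 1) / a n / amp (n - 1)) - of_real (1 - 3 * \<sigma> / 4 * real n
      powr (- 1))) * exp (- \<i> * phase n w))"
    using le2 by (intro unif_O_mult_le[OF unif_O_seq_diff[OF amp_pred_bigo] unif_symbolD(1)[OF E'(2)]]) auto
  \<comment> \<open>The coefficient \<open>(b n - w\<^sup>2) / a n\<close> is \<open>2 - t n w - \<sigma> / n\<close>, because \<open>\<tau> - \<sigma> = 2 * \<beta> - 2 * \<alpha>\<close>.\<close>
  have 3: "unif_O K ?e (\<lambda>n w. (of_real (b n / a n) - of_real (2 + (\<tau> - \<sigma>) * real n powr (- 1)))
      - w\<^sup>2 * (of_real (1 / a n) - pw (- \<sigma>) n))"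
    using le2 \<epsilon> by (intro unif_O_diff unif_O_mono[OF unif_O_seq_diff[OF b_over_a_bigo]]
      unif_O_mult_le[OF unif_symbolD(1)[OF symbol_w2(1)[OF M K]] unif_O_seq_diff[OF
          inverse_a_expansion]]) auto
  have 4: "unif_O K ?e (\<lambda>n w. 2 * cos (phase n w) - 2 + t n w)"
    by (rule phase_cos[OF M K])
  have 5: "unif_O K ?e (\<lambda>n w. \<i> * (phase (Suc n) w - phase n w + of_real (\<sigma> / 2) * pw (- 1) n * phase n w))"
    by (rule unif_O_cmult[OF phase_increment[OF M K]])
  \<comment> \<open>Passing from \<open>exp (\<i> * phase (n + 1) w)\<close> to \<open>exp (\<i> * phase n w)\<close> plus the increment of \<open>\<i> * phase\<close>.\<close>
  have 6: "unif_O K ?e (\<lambda>n w. exp (\<i> * phase n w) * (exp (?\<Delta> n w) - 1 - ?\<Delta> n w))"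
    using \<epsilon> \<sigma> by (intro unif_O_mult_le[OF unif_symbolD(1)[OF E(2)] unif_O_exp(2)[OF \<Delta>]]) auto
  have 7: "unif_O K ?e (\<lambda>n w. (exp (\<i> * phase n w) - 1) * ?\<Delta> n w)"
    using \<epsilon> by (intro unif_O_mult_le[OF unif_symbolD(1)[OF E(1)] \<Delta>]) auto
  have i\<sigma>: "unif_O K (- 1) (\<lambda>n w. - of_real (\<sigma> / 4) * pw (- 1) n)"
    by (rule unif_O_cmult[OF i1])
  \<comment> \<open>The terms with a factor \<open>1 / n\<close>, of second order in the phase once the linear part is split off into
    the fifth estimate.\<close>
  have 8: "unif_O K ?e (\<lambda>n w. (- of_real (\<sigma> / 4) * pw (- 1) n) *
      ((exp (\<i> * phase (Suc n) w) - 1 - \<i> * phase (Suc n) w) + ?\<Delta> n w + 3 * (exp (- \<i> * phase n w) - 1 -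
          (- \<i> * phase n w))))"
  proof (rule unif_O_mult_le[OF i\<sigma>, where e = "- \<sigma>"])
    have "unif_O K (2 * (- \<sigma> / 2)) (\<lambda>n w. exp (\<i> * phase (Suc n) w) - 1 - \<i> * phase (Suc n) w)"
      by (rule unif_O_shift[OF unif_O_exp(2)[OF unif_symbolD(1)[OF ip] neg]])
    moreover have "unif_O K (2 * (- \<sigma> / 2)) (\<lambda>n w. 3 * (exp (- \<i> * phase n w) - 1 - (- \<i> * phase n w)))"
      by (rule unif_O_cmult[OF unif_O_exp(2)[OF unif_symbolD(1)[OF im] neg]])
    ultimately show "unif_O K (- \<sigma>) (\<lambda>n w. (exp (\<i> * phase (Suc n) w) - 1 - \<i> * phase (Suc n) w) + ?\<Delta> n w
         + 3 * (exp (- \<i> * phase n w) - 1 - (- \<i> * phase n w)))"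
      using \<sigma> by (intro unif_O_add unif_O_mono[OF \<Delta>]) auto
  qed (use \<epsilon> in auto)
  show ?thesis
  proof (rule unif_O_cong[OF unif_O_add[OF unif_O_add[OF unif_O_add[OF unif_O_diff[OF unif_O_add[OF 1 2]
      3] unif_O_add[OF 4 5]]
        unif_O_add[OF 6 7]] 8]], intro always_eventually allI ballI)
    fix n w
    define E E1 E' I where "E = exp (\<i> * phase n w)" and "E1 = exp (\<i> * phase (Suc n) w)"
      and "E' = exp (- \<i> * phase n w)" and "I = pw (- 1) n"
    have "2 * cos (phase n w) = E + E'"
      by (simp add: cos_exp_eq E_def E'_def)
    moreover have "E * exp (?\<Delta> n w) = E1"
      by (simp add: E_def E1_def flip: exp_add)
    moreover have "t n w = - of_real \<tau> * I + w\<^sup>2 * pw (- \<sigma>) n"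
      by (simp add: t_eq I_def)
    ultimately show "residual n w = (of_real (amp n) - of_real (1 - \<sigma> / 4 * real n powr (- 1))) * exp (\<i>
        * phase (Suc n) w)
      + (of_real (a (n - 1) / a n / amp (n - 1)) - of_real (1 - 3 * \<sigma> / 4 * real n powr (- 1))) * exp (-
          \<i> * phase n w)
      - ((of_real (b n / a n) - of_real (2 + (\<tau> - \<sigma>) * real n powr (- 1))) - w\<^sup>2 * (of_real (1 / a n) -
          pw (- \<sigma>) n))
      + (2 * cos (phase n w) - 2 + t n w + \<i> * (phase (Suc n) w - phase n w + of_real (\<sigma> / 2) * pw (- 1)
          n * phase n w))
      + (exp (\<i> * phase n w) * (exp (?\<Delta> n w) - 1 - ?\<Delta> n w) + (exp (\<i> * phase n w) - 1) * ?\<Delta> n w)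
      + (- of_real (\<sigma> / 4) * pw (- 1) n) *
      ((exp (\<i> * phase (Suc n) w) - 1 - \<i> * phase (Suc n) w) + ?\<Delta> n w + 3 * (exp (- \<i> * phase n w) - 1 -
          (- \<i> * phase n w)))"
      unfolding residual_def E_def[symmetric] E1_def[symmetric] E'_def[symmetric] of_real_add
          of_real_diff of_real_mult
        of_real_1 I_def[symmetric]
      by (simp add: diff_divide_distrib) (simp add: algebra_simps, simp add: field_simps)
  qed
qed

end
end

section \<open>Oscillation of the kernel\<close>

context critical_jacobi
begin

text \<open>
  Equal to \<open>- 2 * \<i> * sin (phase n w)\<close>, of exact order \<open>n powr (- \<sigma> / 2)\<close>; it is the small
  denominator in the summation by parts.
\<close>
definition gap :: "nat \<Rightarrow> complex \<Rightarrow> complex" where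
  "gap n w = exp (- \<i> * phase n w) - exp (\<i> * phase n w)"

text \<open>The quotient \<open>ansatz (n + 1) w / ansatz n w\<close>.\<close>
definition mult_ratio :: "nat \<Rightarrow> complex \<Rightarrow> complex" where
  "mult_ratio n w = of_real (amp n) * exp (\<i> * phase (Suc n) w)"

text \<open>
  Put \<open>B n = a n * (ansatz n w)\<^sup>2\<close>. If \<open>B\<close> were a geometric progression and the quotient of
  consecutive values of the ansatz were \<open>exp (\<i> * \<phi>)\<close>, then \<open>1 / (a n * A n * A (n + 1)) = exp
  (- \<i> * \<phi>) / B n\<close> would be the difference of \<open>1 / (gap * B)\<close> at \<open>n + 1\<close> and \<open>n\<close>. The defect,
  multiplied by \<open>B n\<close>, is \<open>kernel_error\<close>. The index of \<open>gap\<close> is shifted by one because the step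
  from \<open>n\<close> to \<open>n + 1\<close> uses \<open>phase (n + 1)\<close>.
\<close>
definition kernel_error :: "nat \<Rightarrow> complex \<Rightarrow> complex" where
  "kernel_error n w = 1 / mult_ratio n w + 1 / gap (Suc n) w
     - 1 / gap (Suc (Suc n)) w * (of_real (a n / a (Suc n)) / (mult_ratio n w)\<^sup>2)"

context
  fixes M :: real and K
  assumes M: "M > 0" and K: "K = half_annulus M"
begin

lemma gap_lower: "\<forall>\<^sub>F n in sequentially. \<forall>w\<in>K. norm (gap n w) \<ge> 2 / M / 2 * real n powr (- \<sigma> / 2)"
proof (rule unif_O_lower_bound[where \<delta> = \<epsilon> and u = "\<lambda>n w. - 2 * \<i> * (w * pw (- \<sigma> / 2) n)"])
  have neg: "- \<sigma> / 2 < 0" using \<sigma> by simp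
  note ip = symbol_i_phase(1)[OF M K] and im = symbol_i_phase(2)[OF M K]
  have le: "2 * (- \<sigma> / 2) \<le> - \<sigma> / 2 - \<epsilon>" using \<epsilon> by simp
  have 1: "unif_O K (- \<sigma> / 2 - \<epsilon>) (\<lambda>n w. exp (\<i> * phase n w) - 1 - \<i> * phase n w)"
    by (rule unif_O_mono[OF unif_O_exp(2)[OF unif_symbolD(1)[OF ip] neg] le])
  have 2: "unif_O K (- \<sigma> / 2 - \<epsilon>) (\<lambda>n w. exp (- \<i> * phase n w) - 1 - (- \<i> * phase n w))"
    by (rule unif_O_mono[OF unif_O_exp(2)[OF unif_symbolD(1)[OF im] neg] le])
  have 3: "unif_O K (- \<sigma> / 2 - \<epsilon>) (\<lambda>n w. - 2 * \<i> * (phase n w - w * pw (- \<sigma> / 2) n))"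
    by (rule unif_O_cmult[OF unif_symbolD(1)[OF symbol_phase_minus_leading[OF M K]]])
  show "unif_O K (- \<sigma> / 2 - \<epsilon>) (\<lambda>n w. gap n w - - 2 * \<i> * (w * pw (- \<sigma> / 2) n))"
    by (rule unif_O_cong[OF unif_O_add[OF unif_O_diff[OF 2 1] 3]]) (simp add: gap_def algebra_simps)
  show "\<forall>\<^sub>F n in sequentially. \<forall>w\<in>K. norm (- 2 * \<i> * (w * pw (- \<sigma> / 2) n)) \<ge> 2 / M * real n powr (- \<sigma> / 2)"
  proof (intro always_eventually allI ballI)
    fix n w assume "w \<in> K"
    then have "1 / M \<le> norm w" using half_annulusD(4)[of w M] K M by simp
    then have "2 * (1 / M) * real n powr (- \<sigma> / 2) \<le> 2 * norm w * real n powr (- \<sigma> / 2)"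
      by (intro mult_right_mono mult_left_mono) auto
    then show "norm (- 2 * \<i> * (w * pw (- \<sigma> / 2) n)) \<ge> 2 / M * real n powr (- \<sigma> / 2)"
      by (simp add: norm_mult)
  qed
qed (use M \<epsilon> in auto)

lemma symbol_inverse_gap: "unif_symbol K (\<sigma> / 2) (\<lambda>n w. 1 / gap n w)"
proof -
  have neg: "- \<sigma> / 2 < 0" using \<sigma> by simp
  have "unif_symbol K (- \<sigma> / 2) (\<lambda>n w. (exp (- \<i> * phase n w) - 1) - (exp (\<i> * phase n w) - 1))"
    using symbol_i_phase[OF M K] neg by (intro unif_symbol_diff unif_symbol_exp(1))
  then have "unif_symbol K (- \<sigma> / 2) gap" by (simp add: gap_def[abs_def])
  from unif_symbol_inverse[OF this _ gap_lower] M show ?thesis by simp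
qed

text \<open>
  The summand \<open>1 / mult_ratio\<close> has size \<open>1\<close>; the main terms cancel, and what remains is the
  variation of \<open>1 / gap\<close> and of the amplitudes, both at most of the order of \<open>1 / gap\<close> divided
  by \<open>n\<close>.
\<close>
lemma kernel_error_bound: "unif_O K (\<sigma> / 2 - 1) kernel_error"
proof -
  let ?q = "\<lambda>n. a n / a (Suc n) * (1 / (amp n)\<^sup>2)"
  let ?E = "\<lambda>n w. exp (- \<i> * phase (Suc n) w)"
  have neg: "- \<sigma> / 2 < 0" using \<sigma> by simp
  have E: "unif_O K 0 ?E"
    by (rule unif_O_shift[OF unif_symbolD(1)[OF unif_symbol_exp(2)[OF symbol_i_phase(2)[OF M K] neg]]])
  have E2: "unif_O K 0 (\<lambda>n w. ?E n w * ?E n w)" using unif_O_mult[OF E E] by simp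
  note \<gamma> = unif_symbol_shift[OF symbol_inverse_gap]
  have 1: "(\<lambda>n. 1 / amp n - 1) \<in> O(\<lambda>n. real n powr (- 1))"
    unfolding amp_def by real_asymp
  have 2: "(\<lambda>n. 1 / (amp n)\<^sup>2) \<in> O(\<lambda>n. 1)" "(\<lambda>n. 1 / (amp n)\<^sup>2 - 1) \<in> O(\<lambda>n. real n powr (- 1))"
    unfolding amp_def by real_asymp+
  have "(\<lambda>n. (a n / a (Suc n) - 1) * (1 / (amp n)\<^sup>2) + (1 / (amp n)\<^sup>2 - 1)) \<in> O(\<lambda>n. real n powr (- 1))"
    using landau_o.big.mult[OF a_succ_bigo 2(1)] 2(2) by (intro sum_in_bigo(1)) simp_all
  also have "(\<lambda>n. (a n / a (Suc n) - 1) * (1 / (amp n)\<^sup>2) + (1 / (amp n)\<^sup>2 - 1)) = (\<lambda>n. ?q n - 1)"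
    by (simp add: fun_eq_iff algebra_simps diff_divide_distrib)
  finally have q: "(\<lambda>n. ?q n - 1) \<in> O(\<lambda>n. real n powr (- 1))" .
  have q1: "unif_O K (- 1) (\<lambda>n w. of_real (?q n - 1))" by (rule unif_O_seq[OF q])
  have q0: "unif_O K 0 (\<lambda>n w. of_real (?q n))"
  proof -
    have "unif_O K 0 (\<lambda>n w. of_real (?q n - 1) + 1)"
      by (intro unif_O_add unif_O_mono[OF q1] unif_O_const) auto
    then show ?thesis by simp
  qed
  have A: "unif_O K (\<sigma> / 2 - 1) (\<lambda>n w. of_real (1 / amp n - 1) * ?E n w)"
    using \<sigma> by (intro unif_O_mult_le[OF unif_O_seq[OF 1] E]) auto
  have B: "unif_O K (\<sigma> / 2 - 1) (\<lambda>n w. 1 / gap (Suc n) w * (of_real (?q n - 1) * (?E n w * ?E n w)))"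
    using \<sigma> by (intro unif_O_mult_le[OF unif_symbolD(1)[OF \<gamma>] unif_O_mult[OF q1 E2]]) auto
  have C: "unif_O K (\<sigma> / 2 - 1) (\<lambda>n w. (1 / gap (Suc (Suc n)) w - 1 / gap (Suc n) w) * (of_real (?q n) *
      (?E n w * ?E n w)))"
    using \<sigma> by (intro unif_O_mult_le[OF unif_symbolD(2)[OF \<gamma>] unif_O_mult[OF q0 E2]]) auto
  have nz: "\<forall>\<^sub>F n in sequentially. \<forall>w\<in>K. gap (Suc n) w \<noteq> 0"
  proof -
    have "\<forall>\<^sub>F n in sequentially. \<forall>w\<in>K. gap n w \<noteq> 0"
      using gap_lower eventually_gt_at_top[of 0]
    proof eventually_elim
      case (elim n)
      then have "0 < 2 / M / 2 * real n powr (- \<sigma> / 2)" using M by simp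
      with elim(1) show ?case by fastforce
    qed
    then show ?thesis by (subst eventually_sequentially_Suc)
  qed
  show ?thesis
  proof (rule unif_O_cong[OF unif_O_diff[OF unif_O_diff[OF A B] C]])
    show "\<forall>\<^sub>F n in sequentially. \<forall>w\<in>K. kernel_error n w = of_real (1 / amp n - 1) * ?E n w
      - 1 / gap (Suc n) w * (of_real (?q n - 1) * (?E n w * ?E n w))
      - (1 / gap (Suc (Suc n)) w - 1 / gap (Suc n) w) * (of_real (?q n) * (?E n w * ?E n w))"
      using nz eventually_ge_at_top[of 1]
    proof eventually_elim
      case (elim n)
      show ?case
      proof
        fix w assume w: "w \<in> K"
        \<comment> \<open>The cancellation rests on \<open>(e\<^sup>2 - 1) / g = e\<close>, as \<open>g = e - 1 / e\<close>.\<close>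
        define e g g' q where "e = ?E n w" and "g = gap (Suc n) w" and "g' = gap (Suc (Suc n)) w" and "q
            = complex_of_real (?q n)"
        have e: "exp (\<i> * phase (Suc n) w) = 1 / e" "e \<noteq> 0" by (simp_all add: e_def exp_minus
            divide_inverse)
        have g: "g \<noteq> 0" "g = e - 1 / e" using elim w by (simp_all add: g_def gap_def e_def exp_minus
            inverse_eq_divide)
        have am: "amp n \<noteq> 0" using amp_pos[of n] elim by simp
        have "kernel_error n w = of_real (1 / amp n) * e + 1 / g - 1 / g' * (q * (e * e))"
          using am e(2) by (simp add: kernel_error_def mult_ratio_def e(1) q_def power2_eq_square g_def
            g'_def field_simps)
        moreover have "e * e - 1 = e * g" using e(2) by (simp add: g(2) right_diff_distrib)
        then have "1 / g * (e * e - 1) = e" using g(1) by simp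
        moreover have "of_real (1 / amp n - 1) * e - 1 / g * ((q - 1) * (e * e)) - (1 / g' - 1 / g) * (q
            * (e * e))
          = of_real (1 / amp n) * e - e + 1 / g * (e * e - 1) + 1 / g - 1 / g' * (q * (e * e))"
          by (simp only: of_real_diff of_real_1) (simp only: algebra_simps mult_1_left mult_1_right)
        ultimately show "kernel_error n w = of_real (1 / amp n - 1) * ?E n w
            - 1 / gap (Suc n) w * (of_real (?q n - 1) * (?E n w * ?E n w))
            - (1 / gap (Suc (Suc n)) w - 1 / gap (Suc n) w) * (of_real (?q n) * (?E n w * ?E n w))"
          by (simp only: e_def[symmetric] g_def[symmetric] g'_def[symmetric] q_def[symmetric]
            of_real_diff of_real_1) simp
      qed
    qed
  qed
qed

text \<open>
  The exponential factor of the quotient is bounded because \<open>Im \<theta> \<ge> 0\<close> and the phase differs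
  from \<open>\<theta>\<close> by a summable amount.
\<close>
lemma ansatz_ratio_bound:
  obtains N C where "N \<ge> 1" "C > 0"
    "\<forall>k\<ge>N. \<forall>m\<ge>k. \<forall>w\<in>K.
      norm (of_real (a m) * (ansatz m w)\<^sup>2 / (of_real (a k) * (ansatz k w)\<^sup>2))
        \<le> C * real m powr (\<sigma> / 2) * real k powr (- \<sigma> / 2)"
proof -
  obtain D N1 where D: "D > 0" "\<forall>n\<ge>N1. \<forall>w\<in>K. norm (\<theta> n w - phase n w) \<le> D * real n powr (- 2)"
    using theta_minus_phase[OF M K] by (rule unif_O_bound_from)
  note D = D(1) D(2)[rule_format]
  obtain N2 where N2: "\<And>n. n \<ge> N2 \<Longrightarrow> real n powr \<sigma> / 2 \<le> a n \<and> a n \<le> 2 * real n powr \<sigma>"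
    using a_bounds by (auto simp: eventually_sequentially)
  define N where "N = max 1 (max N1 N2)"
  have summ: "summable (\<lambda>n. real n powr (- 2))" by (simp add: summable_real_powr_iff)
  define Z where "Z = (\<Sum>n. real n powr (- 2))"
  have "norm (of_real (a m) * (ansatz m w)\<^sup>2 / (of_real (a k) * (ansatz k w)\<^sup>2))
        \<le> 4 * (exp (D * Z))\<^sup>2 * real m powr (\<sigma> / 2) * real k powr (- \<sigma> / 2)"
    if "N \<le> k" "k \<le> m" "w \<in> K" for k m w
  proof -
    have k: "k \<ge> 1" "k \<ge> N1" "k \<ge> N2" using that(1) by (auto simp: N_def)
    have "{1..m} = {1..k} \<union> {k<..m}" using that k by auto
    then have "(\<Sum>j=1..m. phase j w) = (\<Sum>j=1..k. phase j w) + (\<Sum>j\<in>{k<..m}. phase j w)"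
      by (simp only:) (rule sum.union_disjoint; force)
    then have "ansatz m w / ansatz k w = of_real (real m powr (- \<sigma> / 4) / real k powr (- \<sigma> / 4)) * exp
        (\<i> * (\<Sum>j\<in>{k<..m}. phase j w))"
      by (simp add: ansatz_def distrib_left exp_add)
    then have "norm (ansatz m w / ansatz k w) = real m powr (- \<sigma> / 4) / real k powr (- \<sigma> / 4) * exp (-
        (\<Sum>j\<in>{k<..m}. Im (phase j w)))"
      by (simp add: norm_mult norm_divide)
    also have "\<dots> \<le> real m powr (- \<sigma> / 4) / real k powr (- \<sigma> / 4) * exp (D * Z)"
    proof (intro mult_left_mono)
      have "- (\<Sum>j\<in>{k<..m}. Im (phase j w)) = (\<Sum>j\<in>{k<..m}. - Im (phase j w))"
        by (simp add: sum_negf)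
      also have "\<dots> \<le> (\<Sum>j\<in>{k<..m}. D * real j powr (- 2))"
      proof (intro sum_mono)
        fix j assume "j \<in> {k<..m}"
        then have "norm (\<theta> j w - phase j w) \<le> D * real j powr (- 2)"
          using k that by (intro D(2)) auto
        moreover have "\<bar>Im (\<theta> j w - phase j w)\<bar> \<le> norm (\<theta> j w - phase j w)" by (rule abs_Im_le_cmod)
        ultimately show "- Im (phase j w) \<le> D * real j powr (- 2)"
          using Im_theta_nonneg[of j w] by simp
      qed
      also have "\<dots> \<le> D * Z"
        unfolding sum_distrib_left[symmetric] Z_def using D(1) summ
        by (intro mult_left_mono sum_le_suminf) auto
      finally show "exp (- (\<Sum>j\<in>{k<..m}. Im (phase j w))) \<le> exp (D * Z)" by simp
    qed auto
    finally have r: "norm (ansatz m w / ansatz k w) \<le> real m powr (- \<sigma> / 4) / real k powr (- \<sigma> / 4) *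
        exp (D * Z)" .
    have "norm (of_real (a m) * (ansatz m w)\<^sup>2 / (of_real (a k) * (ansatz k w)\<^sup>2))
       = a m / a k * (norm (ansatz m w / ansatz k w))\<^sup>2"
      using a_pos[of m] a_pos[of k] by (simp add: norm_mult norm_divide norm_power power_divide)
    also have "\<dots> \<le> (2 * real m powr \<sigma>) / (real k powr \<sigma> / 2) * (real m powr (- \<sigma> / 4) / real k powr (- \<sigma>
        / 4) * exp (D * Z))\<^sup>2"
      using N2[of k] N2[of m] k that a_pos[of k] a_pos[of m] r
      by (intro mult_mono frac_le power_mono) auto
    also have "\<dots> = 4 * (exp (D * Z))\<^sup>2 * (real m powr \<sigma> * (real m powr (- \<sigma> / 4))\<^sup>2) * (1 / (real k powr
        \<sigma> * (real k powr (- \<sigma> / 4))\<^sup>2))"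
      by (simp add: power_mult_distrib power_divide)
    also have "real m powr \<sigma> * (real m powr (- \<sigma> / 4))\<^sup>2 = real m powr (\<sigma> / 2)"
      by (simp add: power2_eq_square powr_add[symmetric])
    also have "real k powr \<sigma> * (real k powr (- \<sigma> / 4))\<^sup>2 = real k powr (\<sigma> / 2)"
      by (simp add: power2_eq_square powr_add[symmetric])
    also have "1 / real k powr (\<sigma> / 2) = real k powr (- \<sigma> / 2)"
      by (simp add: powr_minus_divide)
    finally show ?thesis .
  qed
  then show ?thesis
    by (intro that[of N "4 * (exp (D * Z))\<^sup>2"]) (auto simp: N_def)
qed

text \<open>
  After the summation by parts the boundary terms are \<open>O(m powr (\<sigma> / 2))\<close> and the sum of the
  errors is at most a multiple of \<open>m powr (\<sigma> / 2) * (\<Sum>k<m. 1 / k)\<close>. The logarithm is absorbed in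
  \<open>m powr (\<epsilon> / 2)\<close>.
\<close>
lemma kernel_bound:
  obtains N C where "N \<ge> 1" "C > 0"
    "\<forall>j\<ge>N. \<forall>m>j. \<forall>w\<in>K.
      norm (kernel_sum a (\<lambda>k. ansatz k w) j m) \<le> C * real m powr (\<sigma> / 2 + \<epsilon> / 2)"
proof -
  obtain N1 C1 where N1: "N1 \<ge> 1" "C1 > 0" and C1: "\<forall>k\<ge>N1. \<forall>m\<ge>k. \<forall>w\<in>K.
      norm (of_real (a m) * (ansatz m w)\<^sup>2 / (of_real (a k) * (ansatz k w)\<^sup>2))
        \<le> C1 * real m powr (\<sigma> / 2) * real k powr (- \<sigma> / 2)"
    by (rule ansatz_ratio_bound)
  obtain C2 N2 where C2: "C2 > 0" "\<forall>n\<ge>N2. \<forall>w\<in>K. norm (1 / gap (Suc n) w) \<le> C2 * real n powr (\<sigma> / 2)"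
    using unif_symbolD(1)[OF unif_symbol_shift[OF symbol_inverse_gap]] by (rule unif_O_bound_from)
  obtain C3 N3 where C3: "C3 > 0" "\<forall>n\<ge>N3. \<forall>w\<in>K. norm (kernel_error n w) \<le> C3 * real n powr (\<sigma> / 2 - 1)"
    using kernel_error_bound by (rule unif_O_bound_from)
  note C1 = C1[rule_format] and C2 = C2(1) C2(2)[rule_format] and C3 = C3(1) C3(2)[rule_format]
  define N where "N = max N1 (max N2 N3)"
  have summ: "summable (\<lambda>n. real n powr (- 1 - \<epsilon> / 2))" using \<epsilon> by (simp add: summable_real_powr_iff)
  define Z where "Z = (\<Sum>n. real n powr (- 1 - \<epsilon> / 2))"
  have Z: "Z \<ge> 0" unfolding Z_def by (intro suminf_nonneg summ) auto
  have "norm (kernel_sum a (\<lambda>k. ansatz k w) j m) \<le> (C2 + C2 * C1 + C3 * C1 * Z) * real m powr (\<sigma> / 2 + \<epsilon>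
      / 2)"
    if "N \<le> j" "j < m" "w \<in> K" for j m w
  proof -
    define B where "B = (\<lambda>k. of_real (a k) * (ansatz k w)\<^sup>2)"
    have j: "j \<ge> 1" "j \<ge> N1" "j \<ge> N2" "j \<ge> N3" using that N1 by (auto simp: N_def)
    have B0: "B k \<noteq> 0" if "k \<ge> j" for k
      using ansatz_nz[of k w] a_pos[of k] that j by (simp add: B_def)
    define G where "G = (\<lambda>k. 1 / gap (Suc k) w / B k)"
    \<comment> \<open>Summation by parts, with \<open>G k\<close> the discrete primitive of the main part.\<close>
    have summand: "of_real (a m) * (ansatz m w)\<^sup>2 / (of_real (a k) * ansatz k w * ansatz (Suc k) w)
        = B m * (G (Suc k) - G k) + kernel_error k w * (B m / B k)" if "k \<ge> j" for k
    proof -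
      define l where "l = mult_ratio k w"
      have k1: "k \<ge> 1" using that j by simp
      have l0: "l \<noteq> 0" using amp_pos[OF k1] by (simp add: l_def mult_ratio_def)
      have A: "ansatz (Suc k) w = l * ansatz k w"
        using ansatz_Suc[OF k1] by (simp add: l_def mult_ratio_def)
      have a0: "complex_of_real (a k) \<noteq> 0" "complex_of_real (a (Suc k)) \<noteq> 0" using a_pos[of k] a_pos[of
          "Suc k"] by auto
      have A0: "ansatz k w \<noteq> 0" using ansatz_nz[OF k1] .
      have "of_real (a k / a (Suc k)) / l\<^sup>2 = B k / B (Suc k)"
        using l0 a0 A0 by (simp add: B_def A power_mult_distrib)
      then have "kernel_error k w * (B m / B k) = (1 / l) * (B m / B k) + 1 / gap (Suc k) w * (B m / B k)
         - 1 / gap (Suc (Suc k)) w * (B m / B (Suc k))"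
        using B0[OF that] by (simp add: kernel_error_def l_def[symmetric] algebra_simps)
      then have "B m * (G (Suc k) - G k) + kernel_error k w * (B m / B k) = (1 / l) * (B m / B k)"
        by (simp add: G_def algebra_simps)
      also have "\<dots> = of_real (a m) * (ansatz m w)\<^sup>2 / (of_real (a k) * ansatz k w * ansatz (Suc k) w)"
        by (simp add: A) (simp add: B_def power2_eq_square mult_ac)
      finally show ?thesis by simp
    qed
    have "kernel_sum a (\<lambda>k. ansatz k w) j m = (\<Sum>k=j..<m. B m * (G (Suc k) - G k) + kernel_error k w * (B
        m / B k))"
      unfolding kernel_sum_def by (intro sum.cong refl summand) auto
    also have "\<dots> = B m * (\<Sum>k=j..<m. G (Suc k) - G k) + (\<Sum>k=j..<m. kernel_error k w * (B m / B k))"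
      by (simp add: sum.distrib sum_distrib_left)
    also have "(\<Sum>k=j..<m. G (Suc k) - G k) = G m - G j"
      using that by (intro sum_Suc_diff') auto
    finally have "kernel_sum a (\<lambda>k. ansatz k w) j m
        = 1 / gap (Suc m) w - 1 / gap (Suc j) w * (B m / B j) + (\<Sum>k=j..<m. kernel_error k w * (B m / B k))"
      using B0[of m] that by (simp add: G_def algebra_simps)
    moreover have "norm (1 / gap (Suc m) w - 1 / gap (Suc j) w * (B m / B j) + (\<Sum>k=j..<m. kernel_error k
        w * (B m / B k)))
       \<le> norm (1 / gap (Suc m) w) + norm (1 / gap (Suc j) w * (B m / B j)) + (\<Sum>k=j..<m. norm
           (kernel_error k w * (B m / B k)))"
      by (intro norm_triangle_le add_mono norm_triangle_ineq4 norm_sum)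
    moreover have "norm (1 / gap (Suc m) w) \<le> C2 * real m powr (\<sigma> / 2 + \<epsilon> / 2)"
    proof -
      have "norm (1 / gap (Suc m) w) \<le> C2 * real m powr (\<sigma> / 2)" using j that by (intro C2(2)) auto
      also have "\<dots> \<le> C2 * real m powr (\<sigma> / 2 + \<epsilon> / 2)"
        using C2(1) \<epsilon> j that by (intro mult_left_mono powr_mono) auto
      finally show ?thesis .
    qed
    moreover have "norm (1 / gap (Suc j) w * (B m / B j)) \<le> C2 * C1 * real m powr (\<sigma> / 2 + \<epsilon> / 2)"
    proof -
      have "norm (1 / gap (Suc j) w * (B m / B j)) \<le> (C2 * real j powr (\<sigma> / 2)) * (C1 * real m powr (\<sigma> /
          2) * real j powr (- \<sigma> / 2))"
        unfolding norm_mult[where y = "B m / B j"] unfolding B_def using j that C2(1) by (intro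
            mult_mono C2(2) C1) auto
      also have "\<dots> = C2 * C1 * real m powr (\<sigma> / 2) * (real j powr (\<sigma> / 2) * real j powr (- \<sigma> / 2))" by simp
      also have "real j powr (\<sigma> / 2) * real j powr (- \<sigma> / 2) = 1" using j by (simp add: powr_add[symmetric])
      also have "C2 * C1 * real m powr (\<sigma> / 2) * 1 \<le> C2 * C1 * real m powr (\<sigma> / 2 + \<epsilon> / 2)"
        using C2(1) N1 \<epsilon> j that by (auto intro!: mult_left_mono powr_mono)
      finally show ?thesis .
    qed
    moreover have "(\<Sum>k=j..<m. norm (kernel_error k w * (B m / B k))) \<le> C3 * C1 * Z * real m powr (\<sigma> / 2
        + \<epsilon> / 2)"
    proof -
      have "(\<Sum>k=j..<m. norm (kernel_error k w * (B m / B k))) \<le> (\<Sum>k=j..<m. C3 * C1 * real m powr (\<sigma> / 2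
          + \<epsilon> / 2) * real k powr (- 1 - \<epsilon> / 2))"
      proof (intro sum_mono)
        fix k assume k: "k \<in> {j..<m}"
        have "norm (kernel_error k w * (B m / B k)) \<le> (C3 * real k powr (\<sigma> / 2 - 1)) * (C1 * real m powr
            (\<sigma> / 2) * real k powr (- \<sigma> / 2))"
          unfolding norm_mult[where y = "B m / B k"] unfolding B_def using j k that C3(1) by (intro
            mult_mono C3(2) C1) auto
        also have "\<dots> = C3 * C1 * real m powr (\<sigma> / 2) * (real k powr (\<sigma> / 2 - 1) * real k powr (- \<sigma> /
            2))" by simp
        also have "real k powr (\<sigma> / 2 - 1) * real k powr (- \<sigma> / 2) = real k powr (\<epsilon> / 2) * real k powr
            (- 1 - \<epsilon> / 2)"
          by (simp add: powr_add[symmetric])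
        also have "C3 * C1 * real m powr (\<sigma> / 2) * (real k powr (\<epsilon> / 2) * real k powr (- 1 - \<epsilon> / 2))
            \<le> C3 * C1 * real m powr (\<sigma> / 2) * (real m powr (\<epsilon> / 2) * real k powr (- 1 - \<epsilon> / 2))"
          using k \<epsilon> C3(1) N1 by (intro mult_left_mono mult_right_mono powr_mono2) auto
        finally show "norm (kernel_error k w * (B m / B k)) \<le> C3 * C1 * real m powr (\<sigma> / 2 + \<epsilon> / 2) *
            real k powr (- 1 - \<epsilon> / 2)"
          by (simp add: powr_add mult_ac)
      qed
      also have "\<dots> = C3 * C1 * real m powr (\<sigma> / 2 + \<epsilon> / 2) * (\<Sum>k=j..<m. real k powr (- 1 - \<epsilon> / 2))"
        by (simp add: sum_distrib_left)
      also have "\<dots> \<le> C3 * C1 * real m powr (\<sigma> / 2 + \<epsilon> / 2) * Z"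
        unfolding Z_def using C3(1) N1 summ by (intro mult_left_mono sum_le_suminf) auto
      finally show ?thesis by (simp add: mult_ac)
    qed
    ultimately show ?thesis by (simp add: distrib_right)
  qed
  then show ?thesis
    using N1 C2(1) C3(1) Z by (intro that[of N "C2 + C2 * C1 + C3 * C1 * Z"]) (auto simp: N_def intro!:
        add_pos_nonneg)
qed

end
end

section \<open>The Jost solution\<close>

lemma compact_half_annulus: "compact (half_annulus M)"
proof -
  have "half_annulus M = {w. Im w \<ge> 0} \<inter> {w. 1 / M \<le> norm w} \<inter> cball 0 M"
    by (auto simp: half_annulus_def)
  moreover have "closed {w. Im w \<ge> 0}" "closed {w::complex. 1 / M \<le> norm w}"
    by (intro closed_Collect_le continuous_intros)+
  ultimately show ?thesis
    by (simp add: closed_Int closed_Int_compact)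
qed

lemma rec_solution_holomorphic:
  assumes "\<And>n. d n holomorphic_on S" and "\<And>n. a n > 0"
  shows "(\<lambda>w. rec_solution a (\<lambda>k. d k w) u v n) holomorphic_on S"
proof (induction n rule: less_induct)
  case (less n)
  consider "n = 0" | "n = 1" | k where "n = Suc (Suc k)"
    by (metis One_nat_def not0_implies_Suc)
  then show ?case
  proof cases
    case (3 k)
    have "complex_of_real (a (Suc k)) \<noteq> 0" using assms(2)[of "Suc k"] by simp
    with 3 less[of k] less[of "Suc k"] assms(1) show ?thesis
      by (auto intro!: holomorphic_intros)
  qed auto
qed

context critical_phase
begin

lemma phase_holomorphic: "n \<ge> 1 \<Longrightarrow> phase n holomorphic_on - {0}"
  unfolding phase_def deviation_def T_fun_def t_fun_def by (intro holomorphic_intros) auto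

end

context critical_jacobi
begin

lemma ansatz_holomorphic: "ansatz n holomorphic_on - {0}"
  unfolding ansatz_def by (intro holomorphic_intros phase_holomorphic) auto

lemma approx_holomorphic:
  "(\<lambda>w. rec_approx a (\<lambda>k. of_real (b k) - w\<^sup>2) (\<lambda>k. ansatz k w) N n) holomorphic_on - {0}"
proof -
  have "(\<lambda>w. rec_solution a (\<lambda>k. of_real (b k) - w\<^sup>2) u v m) holomorphic_on - {0}" for u v m
    by (rule rec_solution_holomorphic) (intro holomorphic_intros a_pos)+
  then show ?thesis
    unfolding rec_approx_def green_def by (intro holomorphic_intros ansatz_holomorphic)
qed

text \<open>
  The Jost solution. The limit exists, and is locally uniform, for \<open>w \<noteq> 0\<close> with \<open>Im w \<ge> 0\<close>;
  elsewhere \<open>lim\<close> gives an arbitrary value.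
\<close>
definition jost :: "nat \<Rightarrow> complex \<Rightarrow> complex" where
  "jost n w = lim (\<lambda>N. rec_approx a (\<lambda>k. of_real (b k) - w\<^sup>2) (\<lambda>k. ansatz k w) N n)"

lemma jost_half_annulus:
  assumes M: "M > 0"
  shows "uniform_limit (half_annulus M) (\<lambda>N w. rec_approx a (\<lambda>k. of_real (b k) - w\<^sup>2) (\<lambda>k. ansatz k w) N n)
           (jost n) sequentially" (is ?lim)
    and "w \<in> half_annulus M \<Longrightarrow> (\<lambda>n. jost n w / ansatz n w) \<longlonglongrightarrow> 1" (is "_ \<Longrightarrow> ?asymp")
proof -
  let ?K = "half_annulus M" and ?d = "\<lambda>k w. of_real (b k) - w\<^sup>2"
  obtain N1 C1 where N1: "N1 \<ge> 1" "C1 > 0" and C1: "\<forall>j\<ge>N1. \<forall>m>j. \<forall>w\<in>?K.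
      norm (kernel_sum a (\<lambda>k. ansatz k w) j m) \<le> C1 * real m powr (\<sigma> / 2 + \<epsilon> / 2)"
    by (rule kernel_bound[OF M refl])
  obtain C2 N2 where C2: "C2 > 0" and r: "\<forall>n\<ge>N2. \<forall>w\<in>?K. norm (residual n w) \<le> C2 * real n powr (- 1 - \<sigma>
      / 2 - \<epsilon>)"
    using residual_bound[OF M refl] by (rule unif_O_bound_from)
  define N0 where "N0 = max N1 N2"
  define \<rho> \<kappa> where "\<rho> = (\<lambda>n. C2 * real n powr (- 1 - \<sigma> / 2 - \<epsilon>))" and "\<kappa> = (\<lambda>n. C1 * real n powr (\<sigma> / 2
      + \<epsilon> / 2))"
  have bounded: "bounded (f ` ?K)" if "f holomorphic_on - {0}" for f
  proof (rule compact_imp_bounded, rule compact_continuous_image[OF _ compact_half_annulus])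
    show "continuous_on ?K f"
      using holomorphic_on_imp_continuous_on[OF that] by (rule continuous_on_subset) (use
          half_annulusD(2)[OF _ M] in auto)
  qed
  have \<rho>\<kappa>: "\<rho> n * \<kappa> n = C2 * C1 * real n powr (- 1 - \<epsilon> / 2)" for n
    by (simp add: \<rho>_def \<kappa>_def powr_add[symmetric] mult_ac)
  have summ: "summable (\<lambda>n. \<rho> n * \<kappa> n)"
    unfolding \<rho>\<kappa> by (intro summable_mult) (use \<epsilon> in \<open>simp add: summable_real_powr_iff\<close>)
  have eq: "of_real (a (k - 1)) * ansatz (k - 1) w + of_real (a k) * ansatz (Suc k) w - ?d k w * ansatz k w
      = of_real (a k) * residual k w * ansatz k w" if "k > N0" for k w
    using that N1 by (intro ansatz_equation) (simp add: N0_def)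
  have nz: "ansatz k w \<noteq> 0" if "k \<ge> N0" for k w
    using that N1 by (intro ansatz_nz) (simp add: N0_def)
  have r: "norm (residual k w) \<le> \<rho> k" if "k \<ge> N0" "w \<in> ?K" for k w
    using that r by (simp add: \<rho>_def N0_def)
  have G: "norm (kernel_sum a (\<lambda>k. ansatz k w) j m) \<le> \<kappa> m" if "N0 \<le> j" "j < m" "w \<in> ?K" for j m w
    using that C1 by (simp add: \<kappa>_def N0_def)
  have nonneg: "\<rho> m \<ge> 0" "\<kappa> m \<ge> 0" for m using N1 C2 by (simp_all add: \<rho>_def \<kappa>_def)
  have bd: "bounded (?d k ` ?K)" for k by (intro bounded holomorphic_intros)
  note * = jost_solution_uniform[where a = a and d = ?d and A = ansatz and r = residual and X = ?K
      and \<rho> = \<rho> and \<kappa> = \<kappa> and ?N0.0 = N0, OF a_pos eq nz r G nonneg summ bounded[OF ansatz_holomorphic] bd]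
  have conv: "uniformly_convergent_on ?K (\<lambda>N w. rec_approx a (\<lambda>k. ?d k w) (\<lambda>k. ansatz k w) N n)" for n
    by (rule *(1))
  then show ?lim
    unfolding jost_def[abs_def] by (simp add: uniformly_convergent_uniform_limit_iff)
  assume "w \<in> ?K"
  show ?asymp
    unfolding jost_def by (rule *(2)) (use \<open>w \<in> ?K\<close> in auto)
qed

lemma ex_half_annulus:
  assumes "w \<noteq> 0" "Im w \<ge> 0"
  obtains M where "M > 0" "1 / M < norm w" "norm w < M" "w \<in> half_annulus M"
proof -
  define M where "M = norm w + 1 / norm w + 1"
  have "norm w > 0" using assms by simp
  then have "1 / norm w > 0" by simp
  with \<open>norm w > 0\<close> have M: "M > 0" "norm w < M" unfolding M_def by linarith+
  have "1 / norm w < M" using \<open>norm w > 0\<close> unfolding M_def by linarith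
  then have "1 / M < norm w" using \<open>norm w > 0\<close> M by (simp add: field_simps)
  with M assms show ?thesis by (intro that[of M]) (auto simp: half_annulus_def)
qed

lemma jost_tendsto:
  assumes "w \<noteq> 0" "Im w \<ge> 0"
  shows "(\<lambda>N. rec_approx a (\<lambda>k. of_real (b k) - w\<^sup>2) (\<lambda>k. ansatz k w) N n) \<longlonglongrightarrow> jost n w"
proof -
  obtain M where "M > 0" "w \<in> half_annulus M" using ex_half_annulus[OF assms] by blast
  then show ?thesis using tendsto_uniform_limitI[OF jost_half_annulus(1)] by blast
qed

lemma jost_asymp: "w \<noteq> 0 \<Longrightarrow> Im w \<ge> 0 \<Longrightarrow> (\<lambda>n. jost n w / ansatz n w) \<longlonglongrightarrow> 1"
  using ex_half_annulus[of w] jost_half_annulus(2) by metis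

lemma jost_recurrence:
  assumes "w \<noteq> 0" "Im w \<ge> 0"
  shows "of_real (a n) * jost n w + of_real (a (Suc n)) * jost (Suc (Suc n)) w = (of_real (b (Suc n)) -
      w\<^sup>2) * jost (Suc n) w"
proof -
  let ?F = "rec_approx a (\<lambda>k. of_real (b k) - w\<^sup>2) (\<lambda>k. ansatz k w)"
  have "(\<lambda>N. of_real (a n) * ?F N n + of_real (a (Suc n)) * ?F N (Suc (Suc n)))
      \<longlonglongrightarrow> of_real (a n) * jost n w + of_real (a (Suc n)) * jost (Suc (Suc n)) w"
    by (intro tendsto_intros jost_tendsto assms)
  also have "(\<lambda>N. of_real (a n) * ?F N n + of_real (a (Suc n)) * ?F N (Suc (Suc n)))
      = (\<lambda>N. (of_real (b (Suc n)) - w\<^sup>2) * ?F N (Suc n))"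
    using rec_approx_rec[where a = a] a_pos by (simp add: fun_eq_iff)
  finally have "(\<lambda>N. (of_real (b (Suc n)) - w\<^sup>2) * ?F N (Suc n))
      \<longlonglongrightarrow> of_real (a n) * jost n w + of_real (a (Suc n)) * jost (Suc (Suc n)) w" .
  moreover have "(\<lambda>N. (of_real (b (Suc n)) - w\<^sup>2) * ?F N (Suc n)) \<longlonglongrightarrow> (of_real (b (Suc n)) - w\<^sup>2) * jost
      (Suc n) w"
    by (intro tendsto_intros jost_tendsto assms)
  ultimately show ?thesis by (rule LIMSEQ_unique)
qed

lemma jost_continuous: "continuous_on {w. w \<noteq> 0 \<and> Im w \<ge> 0} (jost n)"
proof (clarsimp simp: continuous_on_eq_continuous_within)
  fix w :: complex assume w: "w \<noteq> 0" "Im w \<ge> 0"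
  obtain M where M: "M > 0" "1 / M < norm w" "norm w < M" "w \<in> half_annulus M"
    using ex_half_annulus[OF w] by blast
  have "continuous_on (half_annulus M) (jost n)"
    by (rule uniform_limit_theorem[OF _ jost_half_annulus(1)[OF M(1)]])
      (use half_annulusD(2)[OF _ M(1)] in \<open>auto intro!: always_eventually
        continuous_on_subset[OF holomorphic_on_imp_continuous_on[OF approx_holomorphic]]\<close>)
  then have "continuous (at w within half_annulus M) (jost n)"
    using M(4) by (simp add: continuous_on_eq_continuous_within)
  moreover have "at w within {w. w \<noteq> 0 \<and> Im w \<ge> 0} = at w within half_annulus M"
  proof (rule at_within_nhd)
    show "open {w :: complex. 1 / M < norm w \<and> norm w < M}"
      by (intro open_Collect_conj open_Collect_less continuous_intros)
    show "{w. w \<noteq> 0 \<and> Im w \<ge> 0} \<inter> {w. 1 / M < norm w \<and> norm w < M} - {w} = half_annulus M \<inter> {w. 1 / M <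
        norm w \<and> norm w < M} - {w}"
      using half_annulusD(2)[OF _ M(1)] by (auto simp: half_annulus_def)
  qed (use M in auto)
  ultimately show "continuous (at w within {w. w \<noteq> 0 \<and> Im w \<ge> 0}) (jost n)" by simp
qed

lemma jost_holomorphic: "jost n holomorphic_on {w. Im w > 0}"
proof (rule holomorphic_uniform_sequence)
  show "open {w. Im w > 0}" by (intro open_Collect_less continuous_intros)
  show "(\<lambda>w. rec_approx a (\<lambda>k. of_real (b k) - w\<^sup>2) (\<lambda>k. ansatz k w) N n) holomorphic_on {w. Im w > 0}"
      for N
    by (rule holomorphic_on_subset[OF approx_holomorphic]) auto
next
  fix w assume "w \<in> {w. Im w > 0}"
  then have w: "w \<noteq> 0" "Im w > 0" by auto
  obtain M where M: "M > 0" "1 / M < norm w" "norm w < M"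
    using ex_half_annulus[of w] w by (metis less_imp_le)
  have "open ({w. Im w > 0} \<inter> {w. 1 / M < norm w \<and> norm w < M})"
    by (intro open_Int open_Collect_conj open_Collect_less continuous_intros)
  moreover have "w \<in> {w. Im w > 0} \<inter> {w. 1 / M < norm w \<and> norm w < M}" using w M by simp
  ultimately obtain e where e: "e > 0" "cball w e \<subseteq> {w. Im w > 0} \<inter> {w. 1 / M < norm w \<and> norm w < M}"
    unfolding open_contains_cball by blast
  then have "cball w e \<subseteq> half_annulus M"
    by (auto simp: half_annulus_def subset_iff less_imp_le)
  then have "uniform_limit (cball w e) (\<lambda>N w. rec_approx a (\<lambda>k. of_real (b k) - w\<^sup>2) (\<lambda>k. ansatz k w) N
      n) (jost n) sequentially"
    by (rule uniform_limit_on_subset[OF jost_half_annulus(1)[OF M(1)]])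
  with e show "\<exists>d>0. cball w d \<subseteq> {w. Im w > 0} \<and>
      uniform_limit (cball w d) (\<lambda>N w. rec_approx a (\<lambda>k. of_real (b k) - w\<^sup>2) (\<lambda>k. ansatz k w) N n)
          (jost n) sequentially"
    by blast
qed

text \<open>
  The quotient of the ansatz by \<open>n powr (- \<sigma> / 4) * exp (\<i> * (\<Sum>m=N..n. \<theta> m w))\<close> is the
  exponential of \<open>\<Sum>m=1..<N. phase m w\<close> plus a partial sum of the series of \<open>phase - \<theta>\<close>, which
  converges uniformly on \<open>K\<close>; the continuity of \<open>\<theta> m\<close> holds for \<open>m \<ge> N\<close>.
\<close>
lemma ansatz_normalization:
  assumes M: "M > 0" and K: "K = half_annulus M"
  shows "\<forall>\<^sub>F N in sequentially. \<exists>C. continuous_on K C \<and> (\<forall>w\<in>K. C w \<noteq> 0) \<and>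
    (\<forall>w\<in>K. (\<lambda>n. ansatz n w / (C w * pw (- \<sigma> / 4) n * exp (\<i> * (\<Sum>m=N..n. \<theta> m w)))) \<longlonglongrightarrow> 1)"
proof -
  obtain D N1 where D: "D > 0" "\<forall>n\<ge>N1. \<forall>w\<in>K. norm (\<theta> n w - phase n w) \<le> D * real n powr (- 2)"
    using theta_minus_phase[OF M K] by (rule unif_O_bound_from)
  obtain N2 where N2: "\<forall>n\<ge>N2. \<forall>w\<in>K. norm (deviation n w) < 1 \<and> \<theta> n w = theta_csqrt n w"
    using theta_eq_csqrt[OF M K] by (auto simp: eventually_sequentially)
  have K0: "w \<noteq> 0" if "w \<in> K" for w using half_annulusD(2)[of w M] that M K by simp
  have "\<exists>C. continuous_on K C \<and> (\<forall>w\<in>K. C w \<noteq> 0) \<and>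
    (\<forall>w\<in>K. (\<lambda>n. ansatz n w / (C w * pw (- \<sigma> / 4) n * exp (\<i> * (\<Sum>m=N..n. \<theta> m w)))) \<longlonglongrightarrow> 1)"
    if N: "N \<ge> max 1 (max N1 N2)" for N
  proof -
    \<comment> \<open>\<open>C\<close> collects the phases below \<open>N\<close> and the total phase defect above.\<close>
    define \<delta> where "\<delta> = (\<lambda>i w. phase (i + N) w - \<theta> (i + N) w)"
    define S where "S = (\<lambda>w. \<Sum>i. \<delta> i w)"
    define C where "C = (\<lambda>w. exp (\<i> * ((\<Sum>m=1..<N. phase m w) + S w)))"
    have lim: "uniform_limit K (\<lambda>n w. \<Sum>i<n. \<delta> i w) S sequentially"
      unfolding S_def
    proof (rule Weierstrass_m_test)
      show "norm (\<delta> i w) \<le> D * real (i + N) powr (- 2)" if "w \<in> K" for i w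
        using D(2)[rule_format, of "i + N" w] N that by (simp add: \<delta>_def norm_minus_commute)
      have "summable (\<lambda>i. real (i + N) powr (- 2))"
        by (rule summable_ignore_initial_segment) (simp add: summable_real_powr_iff)
      then show "summable (\<lambda>i. D * real (i + N) powr (- 2))" by (rule summable_mult)
    qed
    have cont_phase: "continuous_on K (phase m)" if "m \<ge> 1" for m
      using holomorphic_on_imp_continuous_on[OF phase_holomorphic[OF that]]
      by (rule continuous_on_subset) (use K0 in auto)
    have cont_\<theta>: "continuous_on K (\<lambda>w. \<theta> m w)" if "m \<ge> N" for m
    proof (rule continuous_on_eq)
      show "continuous_on K (theta_csqrt m)"
        using that N N2 K0 by (intro continuous_on_theta_csqrt) auto
      show "theta_csqrt m w = \<theta> m w" if "w \<in> K" for w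
        using N2 that \<open>m \<ge> N\<close> N by auto
    qed
    have "continuous_on K S"
      by (rule uniform_limit_theorem[OF _ lim])
        (use N in \<open>auto simp: \<delta>_def intro!: always_eventually continuous_on_sum continuous_on_diff
            cont_phase cont_\<theta>\<close>)
    then have "continuous_on K C"
      unfolding C_def by (intro continuous_intros cont_phase) auto
    moreover have "\<forall>w\<in>K. C w \<noteq> 0" by (simp add: C_def)
    moreover have "(\<lambda>n. ansatz n w / (C w * pw (- \<sigma> / 4) n * exp (\<i> * (\<Sum>m=N..n. \<theta> m w)))) \<longlonglongrightarrow> 1" if "w \<in>
        K" for w
    proof -
      have "(\<lambda>n. \<Sum>i<n. \<delta> i w) \<longlonglongrightarrow> S w"
        by (rule tendsto_uniform_limitI[OF lim that])
      moreover have "filterlim (\<lambda>n. Suc n - N) at_top sequentially"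
        using filterlim_minus_const_nat_at_top[of N] filterlim_Suc by (rule filterlim_compose)
      ultimately have "(\<lambda>n. \<Sum>i<Suc n - N. \<delta> i w) \<longlonglongrightarrow> S w"
        by (rule filterlim_compose)
      then have "(\<lambda>n. exp (\<i> * ((\<Sum>i<Suc n - N. \<delta> i w) - S w))) \<longlonglongrightarrow> exp (\<i> * (S w - S w))"
        by (intro tendsto_intros)
      then have "(\<lambda>n. exp (\<i> * ((\<Sum>i<Suc n - N. \<delta> i w) - S w))) \<longlonglongrightarrow> 1" by simp
      moreover have "\<forall>\<^sub>F n in sequentially. exp (\<i> * ((\<Sum>i<Suc n - N. \<delta> i w) - S w))
          = ansatz n w / (C w * pw (- \<sigma> / 4) n * exp (\<i> * (\<Sum>m=N..n. \<theta> m w)))"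
        using eventually_ge_at_top[of N]
      proof eventually_elim
        case (elim n)
        have "(\<Sum>i<Suc n - N. \<delta> i w) = (\<Sum>m=N..n. phase m w - \<theta> m w)"
          unfolding \<delta>_def by (rule sum.reindex_bij_witness[of _ "\<lambda>m. m - N" "\<lambda>i. i + N"]) (use elim in auto)
        moreover have "{1..n} = {1..<N} \<union> {N..n}" using elim N by auto
        then have "(\<Sum>m=1..n. phase m w) = (\<Sum>m=1..<N. phase m w) + (\<Sum>m=N..n. phase m w)"
          by (simp only:) (rule sum.union_disjoint; force)
        ultimately have eq: "(\<Sum>i<Suc n - N. \<delta> i w) - S w
            = (\<Sum>m=1..n. phase m w) - ((\<Sum>m=1..<N. phase m w) + S w) - (\<Sum>m=N..n. \<theta> m w)"
          by (simp add: sum_subtractf)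
        have "pw (- \<sigma> / 4) n \<noteq> 0" using elim N by simp
        then show ?case
          unfolding eq ansatz_def C_def by (simp add: right_diff_distrib exp_diff)
      qed
      ultimately show ?thesis by (rule Lim_transform_eventually)
    qed
    ultimately show ?thesis by blast
  qed
  then show ?thesis unfolding eventually_sequentially by blast
qed

end

section \<open>Asymptotics on the cut plane\<close>

theorem theorem2p3:
  fixes \<gamma> \<sigma> \<alpha> \<beta> \<tau> \<rho> :: real
    and a b :: "nat \<Rightarrow> real"
    and L :: nat and p :: "nat \<Rightarrow> real"
  assumes "\<gamma> \<in> {1, -1}"
    and "0 < \<sigma>" and "\<sigma> < 1"
    and "\<And>n. a n > 0"
    and "(\<lambda>n. a n - real n powr \<sigma> * (1 + \<alpha> / real n)) \<in> O(\<lambda>n. real n powr \<sigma> / real n ^ 2)"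
    and "(\<lambda>n. b n - 2 * \<gamma> * real n powr \<sigma> * (1 + \<beta> / real n)) \<in> O(\<lambda>n. real n powr \<sigma> / real n ^ 2)"
    and "\<tau> = 2 * \<beta> - 2 * \<alpha> + \<sigma>"
    and "\<rho> = \<sigma> / 4"
    and "L \<ge> 1" and "(real L + 1 / 2) * \<sigma> > 1"
    and "admissible_coeffs L p"
  shows "\<exists>f :: nat \<Rightarrow> complex \<times> complex \<Rightarrow> complex.
    (\<forall>x \<in> cut_plane \<gamma>. \<forall>n\<ge>1.
       of_real (a (n - 1)) * f (n - 1) x + of_real (b n) * f n x + of_real (a n) * f (n + 1) x
         = fst x * f n x) \<and>
    (\<forall>n. (\<lambda>z. f n (slit_point \<gamma> z)) analytic_on (- cut_ray \<gamma>) \<and>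
         continuous_on (cut_plane \<gamma>) (f n)) \<and>
    (\<forall>K. compact K \<and> K \<subseteq> cut_plane \<gamma> \<longrightarrow>
       (\<forall>\<^sub>F N in sequentially.
          \<exists>C :: complex \<times> complex \<Rightarrow> complex.
            continuous_on K C \<and> (\<forall>x \<in> K. C x \<noteq> 0) \<and>
            (\<forall>x \<in> K. \<exists>\<epsilon> :: nat \<Rightarrow> complex. \<epsilon> \<longlonglongrightarrow> 0 \<and>
               (\<forall>\<^sub>F n in sequentially.
                  f n x = C x * of_real ((- \<gamma>) ^ n * real n powr (- \<rho>))
                    * exp (\<i> * phi \<sigma> \<tau> L p N n (cut_scale \<gamma> x)) * (1 + \<epsilon> n)))))"
proof -
  note \<gamma> = assms(1) and \<sigma> = assms(2,3) and L_large = assms(10)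
  have \<gamma>2: "\<gamma> * \<gamma> = 1" and \<gamma>c: "complex_of_real \<gamma> * complex_of_real \<gamma> = 1"
    using \<gamma> by auto
  define \<epsilon> where "\<epsilon> = min ((real L + 1 / 2) * \<sigma> - 1) (min (\<sigma> / 2) (1 - \<sigma>))"
  have \<epsilon>: "0 < \<epsilon>" "\<epsilon> \<le> (real L + 1 / 2) * \<sigma> - 1" "\<epsilon> \<le> \<sigma> / 2" "\<epsilon> \<le> 1 - \<sigma>"
    using \<sigma> L_large unfolding \<epsilon>_def min_def by auto
  obtain J where J: "2 < real J * \<epsilon>" using ex_less_of_nat_mult[OF \<epsilon>(1)] by blast
  have "real J * \<epsilon> \<le> real (Suc J) * \<epsilon>" using \<epsilon>(1) by (intro mult_right_mono) auto
  with J have J: "2 \<le> real (Suc J) * \<epsilon>" by linarith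
  obtain R H :: "complex poly" where R: "R\<^sup>2 = [:1, 1:] + monom 1 (Suc J) * H" "poly R 0 = 1"
    using ex_sqrt_poly by blast
  define b' where "b' = (\<lambda>n. \<gamma> * b n)"
  have "(\<lambda>n. \<gamma> * (b n - 2 * \<gamma> * real n powr \<sigma> * (1 + \<beta> / real n))) \<in> O(\<lambda>n. real n powr \<sigma> / real n ^ 2)"
    using assms(6) by simp
  also have "(\<lambda>n. \<gamma> * (b n - 2 * \<gamma> * real n powr \<sigma> * (1 + \<beta> / real n))) = (\<lambda>n. b' n - 2 * real n powr \<sigma>
      * (1 + \<beta> / real n))"
    using \<gamma> by (auto simp: b'_def algebra_simps)
  finally have b': "(\<lambda>n. b' n - 2 * real n powr \<sigma> * (1 + \<beta> / real n)) \<in> O(\<lambda>n. real n powr \<sigma> / real n ^ 2)" .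
  interpret critical_jacobi \<sigma> \<tau> \<epsilon> L J p R H a b' \<alpha> \<beta>
    by unfold_locales (use \<sigma> \<epsilon> J R assms b' in auto)
  \<comment> \<open>The second component of a point of the cut plane is the spectral variable \<open>w\<close>.\<close>
  define f where "f = (\<lambda>n (x :: complex \<times> complex). of_real ((- \<gamma>) ^ n) * jost n (snd x))"
  have cut: "snd x \<noteq> 0" "Im (snd x) \<ge> 0" "(snd x)\<^sup>2 = of_real \<gamma> * fst x" if "x \<in> cut_plane \<gamma>" for x
    using that \<gamma> by (auto simp: cut_plane_def)
  have gpow: "of_real ((- \<gamma>) ^ n) \<noteq> (0 :: complex)" for n using \<gamma> by auto
  have "of_real (a (n - 1)) * f (n - 1) x + of_real (b n) * f n x + of_real (a n) * f (n + 1) x = fst x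
      * f n x"
    if x: "x \<in> cut_plane \<gamma>" and n: "n \<ge> 1" for x n
  proof -
    obtain k where k: "n = Suc k" using n by (cases n) auto
    define w where "w = snd x"
    have fx: "fst x = of_real \<gamma> * w\<^sup>2" using cut(3)[OF x] \<gamma>c by (simp add: w_def flip: mult.assoc)
    have rec: "of_real (a k) * jost k w + of_real (a (Suc k)) * jost (Suc (Suc k)) w = (of_real (b' (Suc
        k)) - w\<^sup>2) * jost (Suc k) w"
      unfolding w_def by (rule jost_recurrence) (use cut[OF x] in auto)
    have "of_real (a k) * f k x + of_real (b (Suc k)) * f (Suc k) x + of_real (a (Suc k)) * f (Suc (Suc
        k)) x
      = of_real ((- \<gamma>) ^ k) * (of_real (a k) * jost k w + of_real (a (Suc k)) * jost (Suc (Suc k)) w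
          - of_real \<gamma> * of_real (b (Suc k)) * jost (Suc k) w)"
      using \<gamma>c by (simp add: f_def w_def algebra_simps)
    also have "\<dots> = of_real ((- \<gamma>) ^ k) * (- (w\<^sup>2) * jost (Suc k) w)"
      unfolding rec by (simp add: b'_def algebra_simps)
    also have "\<dots> = fst x * f (Suc k) x"
      using \<gamma>c by (simp add: f_def fx w_def[symmetric])
    finally show ?thesis by (simp add: k)
  qed
  moreover have "(\<lambda>z. f n (slit_point \<gamma> z)) analytic_on (- cut_ray \<gamma>)" for n
  proof -
    have off: "of_real \<gamma> * z \<notin> cut_ray 1" if "z \<notin> cut_ray \<gamma>" for z
      using that \<gamma> by (auto simp: in_cut_ray_iff)
    have "open (- cut_ray \<gamma>)"
    proof -
      have "cut_ray \<gamma> = {z. Im z = 0} \<inter> {z. \<gamma> * Re z \<ge> 0}" using \<gamma> by (auto simp: in_cut_ray_iff)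
      moreover have "closed {z. Im z = 0}" "closed {z. \<gamma> * Re z \<ge> 0}"
        by (intro closed_Collect_eq closed_Collect_le continuous_intros)+
      ultimately show ?thesis by (simp add: closed_Int open_closed)
    qed
    moreover have "(\<lambda>z. sqrt_slit (of_real \<gamma> * z)) holomorphic_on - cut_ray \<gamma>"
      using holomorphic_on_compose_gen[OF _ sqrt_slit_holomorphic, of "\<lambda>z. of_real \<gamma> * z" "- cut_ray \<gamma>"] off
      by (auto simp: o_def intro!: holomorphic_intros)
    then have "(\<lambda>z. jost n (sqrt_slit (of_real \<gamma> * z))) holomorphic_on - cut_ray \<gamma>"
      using holomorphic_on_compose_gen[OF _ jost_holomorphic, of "\<lambda>z. sqrt_slit (of_real \<gamma> * z)" "-
          cut_ray \<gamma>" n] off Im_sqrt_slit_pos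
      by (auto simp: o_def)
    then have "(\<lambda>z. f n (slit_point \<gamma> z)) holomorphic_on - cut_ray \<gamma>"
      by (auto simp: f_def slit_point_def intro!: holomorphic_intros)
    ultimately show ?thesis by (simp add: analytic_on_open)
  qed
  moreover have "continuous_on (cut_plane \<gamma>) (f n)" for n
    unfolding f_def using cut
    by (intro continuous_intros continuous_on_compose2[OF jost_continuous]) auto
  moreover have "\<forall>\<^sub>F N in sequentially. \<exists>C. continuous_on K C \<and> (\<forall>x\<in>K. C x \<noteq> 0) \<and>
      (\<forall>x\<in>K. \<exists>\<epsilon>. \<epsilon> \<longlonglongrightarrow> 0 \<and> (\<forall>\<^sub>F n in sequentially.
         f n x = C x * of_real ((- \<gamma>) ^ n * real n powr (- \<rho>)) * exp (\<i> * phi \<sigma> \<tau> L p N n (cut_scale \<gamma>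
            x)) * (1 + \<epsilon> n)))"
    if K: "compact K" "K \<subseteq> cut_plane \<gamma>" for K
  proof -
    have "bounded (snd ` K)"
      using K(1) by (intro compact_imp_bounded compact_continuous_image continuous_intros)
    then obtain M1 where M1: "norm (snd x) \<le> M1" if "x \<in> K" for x by (auto simp: bounded_iff)
    have "bounded ((\<lambda>x. 1 / snd x) ` K)"
      using K cut by (intro compact_imp_bounded compact_continuous_image continuous_intros) auto
    then obtain M2 where M2: "norm (1 / snd x) \<le> M2" if "x \<in> K" for x by (auto simp: bounded_iff)
    define M where "M = max 1 (max M1 M2)"
    have M: "M > 0" by (simp add: M_def)
    have sub: "snd x \<in> half_annulus M" if "x \<in> K" for x
    proof -
      have "snd x \<noteq> 0" "Im (snd x) \<ge> 0" using cut[of x] K(2) that by auto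
      moreover have "norm (snd x) \<le> M" "norm (1 / snd x) \<le> M" using M1[OF that] M2[OF that] by (auto
          simp: M_def)
      ultimately show ?thesis using M by (auto simp: half_annulus_def norm_divide field_simps)
    qed
    show ?thesis
      using ansatz_normalization[OF M refl]
    proof eventually_elim
      case (elim N)
      then obtain C where C: "continuous_on (half_annulus M) C" "\<And>w. w \<in> half_annulus M \<Longrightarrow> C w \<noteq> 0"
        and lim: "\<And>w. w \<in> half_annulus M \<Longrightarrow>
          (\<lambda>n. ansatz n w / (C w * pw (- \<sigma> / 4) n * exp (\<i> * (\<Sum>m=N..n. \<theta> m w)))) \<longlonglongrightarrow> 1"
        by blast
      have "continuous_on K (\<lambda>x. C (snd x))"
        by (rule continuous_on_compose2[OF C(1)]) (use sub in \<open>auto intro!: continuous_intros\<close>)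
      moreover have "\<exists>\<epsilon>. \<epsilon> \<longlonglongrightarrow> 0 \<and> (\<forall>\<^sub>F n in sequentially. f n x = C (snd x) * of_real ((- \<gamma>) ^ n * real n
          powr (- \<rho>))
          * exp (\<i> * phi \<sigma> \<tau> L p N n (cut_scale \<gamma> x)) * (1 + \<epsilon> n))" if x: "x \<in> K" for x
      proof -
        define w where "w = snd x"
        have w: "w \<in> half_annulus M" "w \<noteq> 0" "Im w \<ge> 0" using sub[OF x] cut[of x] K(2) x by (auto simp:
            w_def)
        have sc: "cut_scale \<gamma> x = (w\<^sup>2, w)"
          using cut(3)[of x] K(2) x by (auto simp: cut_scale_def w_def split: prod.split)
        define q where "q = (\<lambda>n. ansatz n w / (C w * pw (- \<sigma> / 4) n * exp (\<i> * (\<Sum>m=N..n. \<theta> m w))))"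
        define \<eta> where "\<eta> = (\<lambda>n. jost n w / ansatz n w * q n - 1)"
        have "(\<lambda>n. jost n w / ansatz n w * q n - 1) \<longlonglongrightarrow> 1 * 1 - 1"
          unfolding q_def by (intro tendsto_intros jost_asymp lim w)
        then have "\<eta> \<longlonglongrightarrow> 0" by (simp add: \<eta>_def)
        moreover have "\<forall>\<^sub>F n in sequentially. f n x = C (snd x) * of_real ((- \<gamma>) ^ n * real n powr (- \<rho>))
          * exp (\<i> * phi \<sigma> \<tau> L p N n (cut_scale \<gamma> x)) * (1 + \<eta> n)"
          using eventually_ge_at_top[of 1]
        proof eventually_elim
          case (elim n)
          have "ansatz n w \<noteq> 0" using elim by (rule ansatz_nz)
          moreover have "C w \<noteq> 0" using C(2) w(1) .
          moreover have "pw (- \<sigma> / 4) n \<noteq> 0" using elim by simp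
          ultimately have "jost n w = C w * pw (- \<sigma> / 4) n * exp (\<i> * (\<Sum>m=N..n. \<theta> m w)) * (1 + \<eta> n)"
            by (simp add: \<eta>_def q_def)
          then show ?case
            by (simp add: f_def sc phi_def assms(8) flip: w_def)
        qed
        ultimately show ?thesis by blast
      qed
      ultimately show ?case
        using C(2) sub by (intro exI[of _ "\<lambda>x. C (snd x)"]) auto
    qed
  qed
  ultimately show ?thesis by blast
qed

end
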